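(* Let $\mathcal M=(Q,H,\phi)$ be a forced Hamiltonian system with exact discretization $(Q,H^E_{d,h},\phi^E_{d,h})$. Let $H_{d,h}$ and $\phi_{d,h}$ be the maps constructed by the shooting method (described in the context) from a quadrature rule satisfying $$\sum_{j=0}^n b_jf(c_jh)=\int_0^hf(x)\,dx+\mathcal O(h^{a+1})$$ and a numerical integrator $\Phi_h$ satisfying $\Phi_h(q,p)=\mathbf F^{\mathcal M}_h(q,p)+\mathcal O(h^{b+1})$. Then $$H_{d,h}=H^E_{d,h}+\mathcal O(h^{\min\{a,b\}+1})\qquad\text{and}\qquad \phi_{d,h}=\phi^E_{d,h}+\mathcal O(h^{\min\{a,b\}+1}).$$
   Context: **Continuous system.** $Q$ is a finite-dimensional real vector space and $T^*Q\simeq Q\times Q^*$. A forced Hamiltonian system $(Q,H,\phi)$ consists of $Q$, a smooth function $H:T^*Q\to\mathbb R$ and a horizontal 1-form $\phi$ on $T^*Q$, so that $\phi(q,p)(\delta q,\delta p)=\check\phi(q,p)(\delta q)$. Its trajectories are the solutions of the forced Hamilton equations $\dot q=D_2H(q,p)$, $\dot p=-D_1H(q,p)+\check\phi(q,p)$; the corresponding (initial value) flow is $\mathbf F^{\mathcal M}_t$. Standing assumption: the trajectory $(q(t),p(t))$ with boundary conditions $q(0)=q_0$, $p(h)=p_1$ exists and is unique, and depends smoothly on all the variables, including $h$ near $0$; it is denoted $\mathbf F^{\mathcal M}_{h,t}(q_0,p_1)$ (boundary value flow). **Exact discretization.** For $h\ne0$, with $(q(t),p(t))=\mathbf F^{\mathcal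 M}_{h,t}(q_0,p_1)$, $$H^E_{d,h}(q_0,p_1)=p(h)q(h)-\int_0^h\big(p(t)\dot q(t)-H(q(t),p(t))\big)\,dt,$$ $$\phi^E_{d,h}(q_0,p_1)(\delta q_0,\delta p_1)=\int_0^h\phi(q(t),p(t))\big(T_{(q_0,p_1)}\mathbf F^{\mathcal M}_{h,t}(\delta q_0,\delta p_1)\big)\,dt;$$ for $h=0$, $H^E_{d,0}(q_0,p_1)=p_1q_0$ and $\phi^E_{d,0}=0$. **Quadrature.** Fix a Gaussian quadrature formula, with nodes $c_jh$ and weights $b_j$, $j=0,\dots,n$, that for functions $f:[0,h]\to\mathbb R$ is accurate to order $a$, i.e. satisfies the first displayed condition of the claim. **Integrator.** Fix a numerical integrator $\Phi_h:T^*Q\to T^*Q$ for the forced Hamilton equations that is accurate to order $b$, i.e. satisfies $\Phi_h(q,p)=\mathbf F^{\mathcal M}_h(q,p)+\mathcal O(h^{b+1})$. ($\Phi_h$ is taken to be $C^1$, so that the derivatives of $q^j$ below are well defined.) **Shooting construction.** Given $(q_0,p_1)$, let $\tilde p_0\in Q^*$ be such that the $Q^*$-component of $\Phi_h(q_0,\tilde p_0)$ equals $p_1$. Put $(q^j,p^j)=\Phi_{c_jh}(q_0,\tilde p_0)$ and $v^j=D_2H(q^j,p^j)$ for $j=0,\dots,n$; by construction these are functions of $(q_0,p_1)$. Define $$H_{d,h}(q_0,p_1)=p^nq^n-\sum_{j=0}^nb_j\big(p^jv^j-H(q^j,p^j)\big),$$ $$\phi_{d,h}(q_0,p_1)(\delta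 q_0,\delta p_1)=\sum_{j=0}^nb_j\,\check\phi(q^j,p^j)\big(T_{(q_0,p_1)}q^j(\delta q_0,\delta p_1)\big).$$ **Meaning of $\mathcal O$ for maps.** For smooth maps $f_1,f_2$ defined on open neighborhoods of $X\times\{0\}$ in $X\times\mathbb R$ ($X,Y$ finite-dimensional real vector spaces) with values in $Y$, $f_2=f_1+\mathcal O(h^{s+1})$ means that there are an open set $U\supset X\times\{0\}$, contained in both domains, and a continuous $\delta f:U\to Y$ with $f_2(x,h)-f_1(x,h)=h^{s+1}\delta f(x,h)$ on $U$.
   Formalization: The formal theorem assumes that the last node is the endpoint (c_n = 1; otherwise p^n q^n is not p(h)q(h) to order and the claim fails), that Φ_h is smooth jointly in (q,p,h) (C^1 is too weak for the force claim), and that the shooting root p̃_0 is continuous in (q_0,p_1,h). *)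

theory Defs
  imports "HOL-Analysis.Analysis"
begin

section \<open>Smooth maps\<close>

text \<open>
  \<open>C_on k S f\<close>: \<open>f\<close> is of class \<open>C\<^sup>k\<close> on the open set \<open>S\<close>.  Higher derivatives are taken
  direction by direction, so that all of them have the same type as \<open>f\<close>; on
  finite-dimensional spaces this is the usual notion.
\<close>

primrec C_on :: "nat \<Rightarrow> 'x::real_normed_vector set \<Rightarrow> ('x \<Rightarrow> 'y::real_normed_vector) \<Rightarrow> bool" where
  "C_on 0 S f \<longleftrightarrow> continuous_on S f"
| "C_on (Suc k) S f \<longleftrightarrow>
     (\<forall>x\<in>S. f differentiable (at x)) \<and> (\<forall>v. C_on k S (\<lambda>x. frechet_derivative f (at x) v))"

definition smooth_on :: "'x::real_normed_vector set \<Rightarrow> ('x \<Rightarrow> 'y::real_normed_vector) \<Rightarrow> bool" where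
  "smooth_on S f \<longleftrightarrow> (\<forall>k. C_on k S f)"

text \<open>
  \<open>eq_upto_O A2 f2 A1 f1 r\<close> is \<open>f2 = f1 + O(h\<^sup>r)\<close> for maps \<open>f1\<close>, \<open>f2\<close> of \<open>(x, h)\<close> whose domains
  are \<open>A1\<close>, \<open>A2\<close>.
\<close>

definition eq_upto_O :: "('x::real_normed_vector \<times> real) set \<Rightarrow> ('x \<times> real \<Rightarrow> 'y::real_normed_vector)
    \<Rightarrow> ('x \<times> real) set \<Rightarrow> ('x \<times> real \<Rightarrow> 'y) \<Rightarrow> nat \<Rightarrow> bool" where
  "eq_upto_O A2 f2 A1 f1 r \<longleftrightarrow>
     (\<exists>U \<delta>. open U \<and> UNIV \<times> {0} \<subseteq> U \<and> U \<subseteq> A1 \<inter> A2 \<and> continuous_on U \<delta> \<and>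
        (\<forall>(x, h)\<in>U. f2 (x, h) - f1 (x, h) = h ^ r *\<^sub>R \<delta> (x, h)))"


section \<open>Forced Hamiltonian systems\<close>

text \<open>\<open>T\<^sup>*Q = Q \<times> Q\<^sup>*\<close>; the inner product of the type \<open>'q\<close> is never used.\<close>

type_synonym 'q cotangent = "'q \<times> ('q \<Rightarrow>\<^sub>L real)"

definition D1 :: "('q::euclidean_space cotangent \<Rightarrow> real) \<Rightarrow> 'q cotangent \<Rightarrow> ('q \<Rightarrow>\<^sub>L real)" where
  "D1 H z = Blinfun (frechet_derivative (\<lambda>q. H (q, snd z)) (at (fst z)))"

text \<open>The partial derivative in \<open>p\<close> lies in \<open>Q\<^sup>*\<^sup>*\<close>; \<open>D2\<close> is the vector of \<open>Q\<close> that represents it.\<close>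

definition D2 :: "('q::euclidean_space cotangent \<Rightarrow> real) \<Rightarrow> 'q cotangent \<Rightarrow> 'q" where
  "D2 H z = (THE v. \<forall>\<pi>. frechet_derivative (\<lambda>p. H (fst z, p)) (at (snd z)) \<pi> = blinfun_apply \<pi> v)"

text \<open>A 1-form on \<open>T\<^sup>*Q\<close> is a map into the dual space of \<open>Q \<times> Q\<^sup>*\<close>.\<close>

definition horizontal :: "('q::euclidean_space cotangent \<Rightarrow> ('q cotangent \<Rightarrow>\<^sub>L real)) \<Rightarrow> bool" where
  "horizontal \<phi> \<longleftrightarrow> (\<forall>z \<delta>p. blinfun_apply (\<phi> z) (0, \<delta>p) = 0)"

definition base_force :: "('q::euclidean_space cotangent \<Rightarrow> ('q cotangent \<Rightarrow>\<^sub>L real)) \<Rightarrow>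
    'q cotangent \<Rightarrow> ('q \<Rightarrow>\<^sub>L real)" where
  "base_force \<phi> z = Blinfun (\<lambda>\<delta>q. blinfun_apply (\<phi> z) (\<delta>q, 0))"

definition forced_hamiltonian_system ::
    "('q::euclidean_space cotangent \<Rightarrow> real) \<Rightarrow> ('q cotangent \<Rightarrow> ('q cotangent \<Rightarrow>\<^sub>L real)) \<Rightarrow> bool" where
  "forced_hamiltonian_system H \<phi> \<longleftrightarrow> smooth_on UNIV H \<and> smooth_on UNIV \<phi> \<and> horizontal \<phi>"

text \<open>
  Solutions of the forced Hamilton equations on the time interval between \<open>0\<close> and \<open>h\<close>, for \<open>h\<close>
  of either sign.  For \<open>h = 0\<close> the equations impose no condition.
\<close>

definition trajectory :: "('q::euclidean_space cotangent \<Rightarrow> real) \<Rightarrow>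
    ('q cotangent \<Rightarrow> ('q cotangent \<Rightarrow>\<^sub>L real)) \<Rightarrow> real \<Rightarrow> (real \<Rightarrow> 'q cotangent) \<Rightarrow> bool" where
  "trajectory H \<phi> h \<gamma> \<longleftrightarrow>
     (\<forall>t\<in>closed_segment 0 h.
        (\<gamma> has_vector_derivative (D2 H (\<gamma> t), - D1 H (\<gamma> t) + base_force \<phi> (\<gamma> t)))
          (at t within closed_segment 0 h))"

definition ivp_domain :: "('q::euclidean_space cotangent \<Rightarrow> real) \<Rightarrow>
    ('q cotangent \<Rightarrow> ('q cotangent \<Rightarrow>\<^sub>L real)) \<Rightarrow> ('q cotangent \<times> real) set" where
  "ivp_domain H \<phi> = {(z, h). \<exists>\<gamma>. trajectory H \<phi> h \<gamma> \<and> \<gamma> 0 = z}"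

definition ivp_flow :: "('q::euclidean_space cotangent \<Rightarrow> real) \<Rightarrow>
    ('q cotangent \<Rightarrow> ('q cotangent \<Rightarrow>\<^sub>L real)) \<Rightarrow> real \<Rightarrow> 'q cotangent \<Rightarrow> 'q cotangent" where
  "ivp_flow H \<phi> h z = (THE w. \<exists>\<gamma>. trajectory H \<phi> h \<gamma> \<and> \<gamma> 0 = z \<and> \<gamma> h = w)"

text \<open>Boundary data \<open>x = (q0, p1)\<close>: position at time \<open>0\<close>, momentum at time \<open>h\<close>.\<close>

definition bvp_trajectory :: "('q::euclidean_space cotangent \<Rightarrow> real) \<Rightarrow>
    ('q cotangent \<Rightarrow> ('q cotangent \<Rightarrow>\<^sub>L real)) \<Rightarrow> real \<Rightarrow> 'q cotangent \<Rightarrow> (real \<Rightarrow> 'q cotangent) \<Rightarrow> bool" where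
  "bvp_trajectory H \<phi> h x \<gamma> \<longleftrightarrow> trajectory H \<phi> h \<gamma> \<and> fst (\<gamma> 0) = fst x \<and> snd (\<gamma> h) = snd x"

definition bvp_flow :: "('q::euclidean_space cotangent \<Rightarrow> real) \<Rightarrow>
    ('q cotangent \<Rightarrow> ('q cotangent \<Rightarrow>\<^sub>L real)) \<Rightarrow> real \<Rightarrow> real \<Rightarrow> 'q cotangent \<Rightarrow> 'q cotangent" where
  "bvp_flow H \<phi> h t x = (THE z. \<exists>\<gamma>. bvp_trajectory H \<phi> h x \<gamma> \<and> \<gamma> t = z)"

text \<open>
  For \<open>(x, h)\<close> in a neighborhood \<open>W\<close> of \<open>h = 0\<close> the boundary value problem has exactly one solution
  on the time interval between \<open>0\<close> and \<open>h\<close>, and it depends smoothly on \<open>(x, h, t)\<close>.  The triples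
  with \<open>t\<close> in this closed interval do not form an open set, hence smoothness is expressed, as usual,
  by a smooth extension to an open set.
\<close>

definition bvp_well_posed :: "('q::euclidean_space cotangent \<Rightarrow> real) \<Rightarrow>
    ('q cotangent \<Rightarrow> ('q cotangent \<Rightarrow>\<^sub>L real)) \<Rightarrow> ('q cotangent \<times> real) set \<Rightarrow> bool" where
  "bvp_well_posed H \<phi> W \<longleftrightarrow>
     open W \<and> UNIV \<times> {0} \<subseteq> W \<and>
     (\<forall>(x, h)\<in>W. (\<exists>\<gamma>. bvp_trajectory H \<phi> h x \<gamma>) \<and>
        (\<forall>\<gamma> \<gamma>'. bvp_trajectory H \<phi> h x \<gamma> \<longrightarrow> bvp_trajectory H \<phi> h x \<gamma>' \<longrightarrow>
           (\<forall>t\<in>closed_segment 0 h. \<gamma> t = \<gamma>' t))) \<and>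
     (\<exists>V F. open V \<and> smooth_on V F \<and>
        (\<forall>(x, h)\<in>W. \<forall>t\<in>closed_segment 0 h. (x, h, t) \<in> V \<and> F (x, h, t) = bvp_flow H \<phi> h t x))"


section \<open>The exact discretization\<close>

definition exact_H :: "('q::euclidean_space cotangent \<Rightarrow> real) \<Rightarrow>
    ('q cotangent \<Rightarrow> ('q cotangent \<Rightarrow>\<^sub>L real)) \<Rightarrow> real \<Rightarrow> 'q cotangent \<Rightarrow> real" where
  "exact_H H \<phi> h x =
     (if h = 0 then blinfun_apply (snd x) (fst x)
      else
        let q = (\<lambda>t. fst (bvp_flow H \<phi> h t x)); p = (\<lambda>t. snd (bvp_flow H \<phi> h t x))
        in blinfun_apply (p h) (q h) -
           (LBINT t=ereal 0..ereal h.
              blinfun_apply (p t) (vector_derivative q (at t)) - H (q t, p t)))"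

definition exact_force :: "('q::euclidean_space cotangent \<Rightarrow> real) \<Rightarrow>
    ('q cotangent \<Rightarrow> ('q cotangent \<Rightarrow>\<^sub>L real)) \<Rightarrow> real \<Rightarrow> 'q cotangent \<Rightarrow> ('q cotangent \<Rightarrow>\<^sub>L real)" where
  "exact_force H \<phi> h x =
     (if h = 0 then 0
      else Blinfun (\<lambda>\<delta>x. LBINT t=ereal 0..ereal h.
        blinfun_apply (\<phi> (bvp_flow H \<phi> h t x)) (frechet_derivative (bvp_flow H \<phi> h t) (at x) \<delta>x)))"


section \<open>The shooting construction\<close>

text \<open>
  The quadrature formula on the interval between \<open>0\<close> and \<open>h\<close> has nodes \<open>c j * h\<close> and weights
  \<open>h * w j\<close>: the formula with nodes \<open>c j\<close> and weights \<open>w j\<close> for the unit interval, rescaled.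
\<close>

definition quadrature_order :: "nat \<Rightarrow> (nat \<Rightarrow> real) \<Rightarrow> (nat \<Rightarrow> real) \<Rightarrow> nat \<Rightarrow> bool" where
  "quadrature_order n c w a \<longleftrightarrow>
     (\<forall>f::real \<Rightarrow> real. smooth_on UNIV f \<longrightarrow>
        (\<exists>U \<delta>. open U \<and> 0 \<in> U \<and> continuous_on U \<delta> \<and>
           (\<forall>h\<in>U. (\<Sum>j=0..n. (h * w j) * f (c j * h)) - (LBINT x=ereal 0..ereal h. f x)
              = h ^ (a + 1) * \<delta> h)))"

text \<open>
  \<open>\<Phi> h z\<close> is meaningful for \<open>(z, h) \<in> D\<close>, and \<open>p0 h (q0, p1)\<close> is the initial momentum found by
  shooting, for \<open>((q0, p1), h) \<in> S\<close>.  The equation may have several solutions; continuity in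
  \<open>(q0, p1, h)\<close> singles out the branch with \<open>p0 0 (q0, p1) = p1\<close> and keeps it from jumping to
  another one for \<open>h\<close> near \<open>0\<close>.
\<close>

definition shooting_momentum :: "nat \<Rightarrow> (nat \<Rightarrow> real) \<Rightarrow> ('q::euclidean_space cotangent \<times> real) set \<Rightarrow>
    (real \<Rightarrow> 'q cotangent \<Rightarrow> 'q cotangent) \<Rightarrow> ('q cotangent \<times> real) set \<Rightarrow>
    (real \<Rightarrow> 'q cotangent \<Rightarrow> ('q \<Rightarrow>\<^sub>L real)) \<Rightarrow> bool" where
  "shooting_momentum n c D \<Phi> S p0 \<longleftrightarrow>
     open S \<and> UNIV \<times> {0} \<subseteq> S \<and> continuous_on S (\<lambda>(x, h). p0 h x) \<and>
     (\<forall>(x, h)\<in>S.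
        ((fst x, p0 h x), h) \<in> D \<and> snd (\<Phi> h (fst x, p0 h x)) = snd x \<and>
        (\<forall>j\<le>n. ((fst x, p0 h x), c j * h) \<in> D))"

definition shooting_node :: "(nat \<Rightarrow> real) \<Rightarrow> (real \<Rightarrow> 'q::euclidean_space cotangent \<Rightarrow> 'q cotangent) \<Rightarrow>
    (real \<Rightarrow> 'q cotangent \<Rightarrow> ('q \<Rightarrow>\<^sub>L real)) \<Rightarrow> real \<Rightarrow> nat \<Rightarrow> 'q cotangent \<Rightarrow> 'q cotangent" where
  "shooting_node c \<Phi> p0 h j x = \<Phi> (c j * h) (fst x, p0 h x)"

text \<open>
  The boundary term \<open>p\<^sup>n q\<^sup>n\<close> replaces \<open>p(h) q(h)\<close>, so the construction is used for formulas whose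
  last node is the right endpoint, \<open>c n = 1\<close>.
\<close>

definition shooting_H :: "('q::euclidean_space cotangent \<Rightarrow> real) \<Rightarrow> nat \<Rightarrow> (nat \<Rightarrow> real) \<Rightarrow> (nat \<Rightarrow> real) \<Rightarrow>
    (real \<Rightarrow> 'q cotangent \<Rightarrow> 'q cotangent) \<Rightarrow> (real \<Rightarrow> 'q cotangent \<Rightarrow> ('q \<Rightarrow>\<^sub>L real)) \<Rightarrow>
    real \<Rightarrow> 'q cotangent \<Rightarrow> real" where
  "shooting_H H n c w \<Phi> p0 h x =
     (let q = (\<lambda>j. fst (shooting_node c \<Phi> p0 h j x)); p = (\<lambda>j. snd (shooting_node c \<Phi> p0 h j x));
          v = (\<lambda>j. D2 H (q j, p j))
      in blinfun_apply (p n) (q n) -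
         (\<Sum>j=0..n. (h * w j) * (blinfun_apply (p j) (v j) - H (q j, p j))))"

definition shooting_force :: "('q::euclidean_space cotangent \<Rightarrow> ('q cotangent \<Rightarrow>\<^sub>L real)) \<Rightarrow>
    nat \<Rightarrow> (nat \<Rightarrow> real) \<Rightarrow> (nat \<Rightarrow> real) \<Rightarrow>
    (real \<Rightarrow> 'q cotangent \<Rightarrow> 'q cotangent) \<Rightarrow> (real \<Rightarrow> 'q cotangent \<Rightarrow> ('q \<Rightarrow>\<^sub>L real)) \<Rightarrow>
    real \<Rightarrow> 'q cotangent \<Rightarrow> ('q cotangent \<Rightarrow>\<^sub>L real)" where
  "shooting_force \<phi> n c w \<Phi> p0 h x =
     Blinfun (\<lambda>\<delta>x. \<Sum>j=0..n. (h * w j) *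
       blinfun_apply (base_force \<phi> (shooting_node c \<Phi> p0 h j x))
         (frechet_derivative (\<lambda>y. fst (shooting_node c \<Phi> p0 h j y)) (at x) \<delta>x))"

end

theory Submission
  imports Defs
begin

text \<open>
  Let \<open>F (x, h, t)\<close> be the boundary value flow and \<open>P (x, h) = F (x, h, 0)\<close> the exact initial point, so
  that \<open>F (x, h, t)\<close> is the initial value flow of \<open>P (x, h)\<close>.  For each node the defect
  \<open>\<Phi>\<^bsub>c h\<^esub> (P (x, h)) - F (x, h, c h)\<close> is a smooth function of \<open>(x, h)\<close> that is \<open>h\<^bsup>b+1\<^esup>\<close> times a
  continuous one; being smooth, its derivatives in \<open>x\<close> are divisible by \<open>h\<^bsup>b+1\<^esup>\<close> too.  No smoothness
  of the initial value flow is needed for this.  The shooting map, which sends \<open>(q, p)\<close> to \<open>q\<close> paired with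
  the momentum component of \<open>\<Phi>\<^sub>h (q, p)\<close>, is the identity for \<open>h = 0\<close>, and its values at the shooting solution and at \<open>P (x, h)\<close> differ by
  such a defect, hence so do these two points and, by implicit differentiation, their
  derivatives in \<open>x\<close>.  Replacing the shooting nodes by the exact ones therefore costs \<open>O(h\<^bsup>b+1\<^esup>)\<close>.
  The quadrature formula is exact on polynomials of degree less than \<open>a\<close>, so a Taylor expansion
  in time bounds the remaining error uniformly in the parameters by \<open>O(h\<^bsup>a+1\<^esup>)\<close>.

  Continuity of the quotients is only at stake at \<open>h = 0\<close>; it is reduced to the existence
  of the limit of \<open>h\<^bsup>-r\<^esup> (f2 - f1)\<close> at every point \<open>(x, 0)\<close>.
\<close>

text \<open>The obstacle is that the force contains derivatives in x, whereas the order of the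
  integrator is a statement about values only. Divisibility passes to space derivatives for smooth
  functions, so it is applied to the defects, which are built from \<open>integrator\<close> and
  \<open>F\<close>. It cannot be applied to the shooting error \<open>start - exact 0\<close>,
  because \<open>p0\<close> is assumed merely continuous. The derivative of \<open>start\<close> is
  therefore obtained and compared through the equation
  \<open>shoot (start y, snd y) = fst y\<close>, in the region where the z-derivative of
  \<open>shoot\<close> differs from the identity by at most 1/2. All limits let x move together with
  h -> 0, since the quotients have to be continuous jointly in (x, h). A recurring difficulty is
  that \<open>C_on\<close> speaks about derivatives in fixed directions while the chain rule
  produces moving ones; finite coordinates reduce the latter to the former.\<close>

section \<open>Finite-dimensional normed spaces\<close>

text \<open>The dual space type is not an instance of \<^class>\<open>euclidean_space\<close>, which
  asks for an inner product inducing the norm; having finitely many coordinate functionals is all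
  that is needed, and this passes to spaces of linear maps.\<close>

class fin_dim = real_normed_vector +
  assumes fin_dim_coords': "\<exists>B (c :: 'a \<Rightarrow> 'a \<Rightarrow> real). finite B \<and>
    (\<forall>b x y. c b (x + y) = c b x + c b y) \<and> (\<forall>b r x. c b (r *\<^sub>R x) = r * c b x) \<and>
    (\<forall>b. \<exists>K. \<forall>x. \<bar>c b x\<bar> \<le> norm x * K) \<and> (\<forall>x. (\<Sum>b\<in>B. c b x *\<^sub>R b) = x)"

lemma fin_dimI:
  assumes "\<exists>B (c :: 'a \<Rightarrow> 'a \<Rightarrow> real). finite B \<and> (\<forall>b. bounded_linear (c b)) \<and>
    (\<forall>x. (\<Sum>b\<in>B. c b x *\<^sub>R b) = x)"
  shows "OFCLASS('a :: real_normed_vector, fin_dim_class)"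
proof
  show "\<exists>B (c :: 'a \<Rightarrow> 'a \<Rightarrow> real). finite B \<and>
    (\<forall>b x y. c b (x + y) = c b x + c b y) \<and> (\<forall>b r x. c b (r *\<^sub>R x) = r * c b x) \<and>
    (\<forall>b. \<exists>K. \<forall>x. \<bar>c b x\<bar> \<le> norm x * K) \<and> (\<forall>x. (\<Sum>b\<in>B. c b x *\<^sub>R b) = x)"
    using assms by (simp add: bounded_linear_def bounded_linear_axioms_def linear_iff all_conj_distrib)
qed

lemma fin_dim_coords:
  "\<exists>B (c :: 'a :: fin_dim \<Rightarrow> 'a \<Rightarrow> real). finite B \<and> (\<forall>b. bounded_linear (c b)) \<and>
    (\<forall>x. (\<Sum>b\<in>B. c b x *\<^sub>R b) = x)"
  using fin_dim_coords' by (simp add: bounded_linear_def bounded_linear_axioms_def linear_iff all_conj_distrib)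

instance euclidean_space \<subseteq> fin_dim
  by (intro fin_dimI exI[of _ Basis] exI[of _ "\<lambda>b x. x \<bullet> b"])
    (auto simp: euclidean_representation bounded_linear_inner_left)

lemma fin_dim_coordsE:
  obtains B and c :: "'a :: fin_dim \<Rightarrow> 'a \<Rightarrow> real"
  where "finite B" "\<And>b. bounded_linear (c b)" "\<And>x. (\<Sum>b\<in>B. c b x *\<^sub>R b) = x"
  using fin_dim_coords by blast

lemma fin_dim_indexed:
  fixes I :: "'i set" and e :: "'i \<Rightarrow> 'a :: real_normed_vector"
  assumes "finite I" "\<And>i. i \<in> I \<Longrightarrow> bounded_linear (c i)" "\<And>x. (\<Sum>i\<in>I. c i x *\<^sub>R e i) = x"
  shows "\<exists>B (c :: 'a \<Rightarrow> 'a \<Rightarrow> real). finite B \<and> (\<forall>b. bounded_linear (c b)) \<and> (\<forall>x. (\<Sum>b\<in>B. c b x *\<^sub>R b) = x)"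
proof (intro exI[of _ "e ` I"] exI[of _ "\<lambda>b x. \<Sum>i | i \<in> I \<and> e i = b. c i x"] conjI allI)
  show "bounded_linear (\<lambda>x. \<Sum>i | i \<in> I \<and> e i = b. c i x)" for b
    using assms(2) by (intro bounded_linear_sum) auto
  fix x
  have "(\<Sum>b\<in>e ` I. (\<Sum>i | i \<in> I \<and> e i = b. c i x) *\<^sub>R b) = (\<Sum>b\<in>e ` I. \<Sum>i | i \<in> I \<and> e i = b. c i x *\<^sub>R e i)"
    by (intro sum.cong) (auto simp: scaleR_sum_left)
  also have "\<dots> = (\<Sum>i\<in>I. c i x *\<^sub>R e i)"
    by (rule sum.image_gen[symmetric]) fact
  finally show "(\<Sum>b\<in>e ` I. (\<Sum>i | i \<in> I \<and> e i = b. c i x) *\<^sub>R b) = x"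
    by (simp add: assms(3))
qed (use assms in auto)

instance prod :: (fin_dim, fin_dim) fin_dim
proof (rule fin_dimI)
  obtain B :: "'a set" and c where B: "finite B" "\<And>b. bounded_linear (c b)" "\<And>x. (\<Sum>b\<in>B. c b x *\<^sub>R b) = x"
    using fin_dim_coordsE by blast
  obtain B' :: "'b set" and c' where B': "finite B'" "\<And>b. bounded_linear (c' b)" "\<And>x. (\<Sum>b\<in>B'. c' b x *\<^sub>R b) = x"
    using fin_dim_coordsE by blast
  define d :: "'a + 'b \<Rightarrow> 'a \<times> 'b \<Rightarrow> real" where "d i z = (case i of Inl b \<Rightarrow> c b (fst z) | Inr b \<Rightarrow> c' b (snd z))" for i z
  define e :: "'a + 'b \<Rightarrow> 'a \<times> 'b" where "e i = (case i of Inl b \<Rightarrow> (b, 0) | Inr b \<Rightarrow> (0, b))" for i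
  have "bounded_linear (d i)" for i
    using bounded_linear_compose[OF B(2) bounded_linear_fst] bounded_linear_compose[OF B'(2) bounded_linear_snd]
    by (cases i) (auto simp: d_def[abs_def])
  moreover have "(\<Sum>i\<in>B <+> B'. d i z *\<^sub>R e i) = z" for z
  proof -
    have "(\<Sum>i\<in>B <+> B'. d i z *\<^sub>R e i) = (\<Sum>b\<in>B. c b (fst z) *\<^sub>R (b, 0)) + (\<Sum>b\<in>B'. c' b (snd z) *\<^sub>R (0, b))"
      using B(1) B'(1) by (subst sum.Plus) (auto simp: d_def e_def)
    also have "\<dots> = ((\<Sum>b\<in>B. c b (fst z) *\<^sub>R b), (\<Sum>b\<in>B'. c' b (snd z) *\<^sub>R b))"
      by (simp add: prod_eq_iff fst_sum snd_sum)
    finally show ?thesis by (simp add: B(3) B'(3))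
  qed
  ultimately show "\<exists>B (c :: 'a \<times> 'b \<Rightarrow> 'a \<times> 'b \<Rightarrow> real). finite B \<and> (\<forall>b. bounded_linear (c b)) \<and> (\<forall>x. (\<Sum>b\<in>B. c b x *\<^sub>R b) = x)"
    using B(1) B'(1) by (intro fin_dim_indexed[of "B <+> B'" d e]) auto
qed

instance blinfun :: (fin_dim, fin_dim) fin_dim
proof (rule fin_dimI)
  obtain B :: "'a set" and c where B: "finite B" "\<And>b. bounded_linear (c b)" "\<And>x. (\<Sum>b\<in>B. c b x *\<^sub>R b) = x"
    using fin_dim_coordsE by blast
  obtain B' :: "'b set" and c' where B': "finite B'" "\<And>b. bounded_linear (c' b)" "\<And>x. (\<Sum>b\<in>B'. c' b x *\<^sub>R b) = x"
    using fin_dim_coordsE by blast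
  \<comment> \<open>Matrix entries of \<open>\<psi>\<close> are its coordinates with respect to the
    rank-one maps x -> c_b(x) b'.\<close>
  define d :: "'a \<times> 'b \<Rightarrow> ('a \<Rightarrow>\<^sub>L 'b) \<Rightarrow> real" where "d i \<psi> = c' (snd i) (blinfun_apply \<psi> (fst i))" for i \<psi>
  define e :: "'a \<times> 'b \<Rightarrow> ('a \<Rightarrow>\<^sub>L 'b)" where "e i = Blinfun (\<lambda>x. c (fst i) x *\<^sub>R snd i)" for i
  have e: "blinfun_apply (e i) x = c (fst i) x *\<^sub>R snd i" for i x
    unfolding e_def by (subst bounded_linear_Blinfun_apply) (auto intro: bounded_linear_scaleR_const B)
  have "bounded_linear (d i)" for i
    unfolding d_def[abs_def] by (intro bounded_linear_compose[OF B'(2)] blinfun.bounded_linear_left)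
  moreover have "(\<Sum>i\<in>B \<times> B'. d i \<psi> *\<^sub>R e i) = \<psi>" for \<psi>
  proof (rule blinfun_eqI)
    fix x
    have "blinfun_apply (\<Sum>i\<in>B \<times> B'. d i \<psi> *\<^sub>R e i) x = (\<Sum>b\<in>B. c b x *\<^sub>R (\<Sum>b'\<in>B'. c' b' (blinfun_apply \<psi> b) *\<^sub>R b'))"
      by (simp add: blinfun.sum_left blinfun.scaleR_left e d_def sum.cartesian_product' scaleR_sum_right mult.commute)
    also have "\<dots> = blinfun_apply \<psi> (\<Sum>b\<in>B. c b x *\<^sub>R b)"
      by (simp add: B'(3) blinfun.sum_right blinfun.scaleR_right)
    finally show "blinfun_apply (\<Sum>i\<in>B \<times> B'. d i \<psi> *\<^sub>R e i) x = blinfun_apply \<psi> x"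
      by (simp add: B(3))
  qed
  ultimately show "\<exists>B (c :: ('a \<Rightarrow>\<^sub>L 'b) \<Rightarrow> ('a \<Rightarrow>\<^sub>L 'b) \<Rightarrow> real). finite B \<and> (\<forall>b. bounded_linear (c b)) \<and> (\<forall>x. (\<Sum>b\<in>B. c b x *\<^sub>R b) = x)"
    using B(1) B'(1) by (intro fin_dim_indexed[of "B \<times> B'" d e]) auto
qed

section \<open>Linear maps in coordinates\<close>

lemma linear_fin_dim_expand:
  fixes A :: "'a :: fin_dim \<Rightarrow> 'b :: real_normed_vector"
  assumes "linear A" "\<And>x. (\<Sum>b\<in>B. c b x *\<^sub>R b) = x"
  shows "A x = (\<Sum>b\<in>B. c b x *\<^sub>R A b)"
proof -
  have "A x = A (\<Sum>b\<in>B. c b x *\<^sub>R b)" by (simp add: assms)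
  also have "\<dots> = (\<Sum>b\<in>B. c b x *\<^sub>R A b)"
    by (simp add: linear_sum[OF assms(1)] linear_scale[OF assms(1)])
  finally show ?thesis .
qed

lemma linear_fin_dim_bounded:
  fixes A :: "'a :: fin_dim \<Rightarrow> 'b :: real_normed_vector"
  assumes "linear A"
  shows "bounded_linear A"
proof -
  obtain B and c :: "'a \<Rightarrow> 'a \<Rightarrow> real" where B: "finite B" "\<And>b. bounded_linear (c b)" "\<And>x. (\<Sum>b\<in>B. c b x *\<^sub>R b) = x"
    using fin_dim_coordsE by blast
  have "A = (\<lambda>x. \<Sum>b\<in>B. c b x *\<^sub>R A b)"
    using linear_fin_dim_expand[OF assms B(3)] by blast
  moreover have "bounded_linear (\<lambda>x. \<Sum>b\<in>B. c b x *\<^sub>R A b)"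
    by (intro bounded_linear_sum bounded_linear_scaleR_const B)
  ultimately show ?thesis by simp
qed

text \<open>A map A is the finite sum of the rank-one maps \<open>T b (A b)\<close>, which depend
  continuously on the values A b. Hence pointwise convergence is convergence in norm, and the forces
  can be treated one vector at a time.\<close>

lemma tendsto_blinfunI:
  fixes A :: "'i \<Rightarrow> 'a :: fin_dim \<Rightarrow>\<^sub>L 'b :: fin_dim"
  assumes "\<And>v. ((\<lambda>i. blinfun_apply (A i) v) \<longlongrightarrow> blinfun_apply L v) F"
  shows "(A \<longlongrightarrow> L) F"
proof -
  obtain B and c :: "'a \<Rightarrow> 'a \<Rightarrow> real" where B: "finite B" "\<And>b. bounded_linear (c b)" "\<And>x. (\<Sum>b\<in>B. c b x *\<^sub>R b) = x"
    using fin_dim_coordsE by blast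
  define T :: "'a \<Rightarrow> 'b \<Rightarrow> 'a \<Rightarrow>\<^sub>L 'b" where "T b y = Blinfun (\<lambda>x. c b x *\<^sub>R y)" for b y
  have T: "blinfun_apply (T b y) x = c b x *\<^sub>R y" for b y x
    unfolding T_def by (subst bounded_linear_Blinfun_apply) (auto intro: bounded_linear_scaleR_const B)
  have T_linear: "bounded_linear (T b)" for b
    by (rule linear_fin_dim_bounded, rule linearI) (auto intro!: blinfun_eqI simp: T blinfun.bilinear_simps scaleR_add_right)
  have "((\<lambda>i. \<Sum>b\<in>B. T b (blinfun_apply (A i) b)) \<longlongrightarrow> (\<Sum>b\<in>B. T b (blinfun_apply L b))) F"
    by (intro tendsto_sum bounded_linear.tendsto[OF T_linear] assms)
  moreover have "(\<Sum>b\<in>B. T b (blinfun_apply M b)) = M" for M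
  proof (rule blinfun_eqI)
    fix x show "blinfun_apply (\<Sum>b\<in>B. T b (blinfun_apply M b)) x = blinfun_apply M x"
      using linear_fin_dim_expand[OF bounded_linear.linear[OF blinfun.bounded_linear_right] B(3), of M x]
      by (simp add: blinfun.sum_left T)
  qed
  ultimately show ?thesis by simp
qed

section \<open>Calculus of smooth maps\<close>

lemma C_on_cong:
  assumes "open S" "\<And>x. x \<in> S \<Longrightarrow> f x = g x"
  shows "C_on k S f \<longleftrightarrow> C_on k S g"
  using assms(2)
proof (induction k arbitrary: f g)
  case 0 then show ?case by (auto cong: continuous_on_cong)
next
  case (Suc k)
  have der: "(f has_derivative D) (at x) \<longleftrightarrow> (g has_derivative D) (at x)" if "x \<in> S" for x D
    using has_derivative_transform_within_open[OF _ assms(1) that] Suc.prems by metis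
  have "frechet_derivative f (at x) = frechet_derivative g (at x)" if "x \<in> S" for x
    using der[OF that] by (simp add: frechet_derivative_def)
  then have "C_on k S (\<lambda>x. frechet_derivative f (at x) v) \<longleftrightarrow> C_on k S (\<lambda>x. frechet_derivative g (at x) v)" for v
    by (intro Suc.IH) simp
  moreover have "(\<forall>x\<in>S. f differentiable (at x)) \<longleftrightarrow> (\<forall>x\<in>S. g differentiable (at x))"
    using der unfolding differentiable_def by blast
  ultimately show ?case by simp
qed

lemma C_on_subset: "C_on k S f \<Longrightarrow> T \<subseteq> S \<Longrightarrow> C_on k T f"
  by (induction k arbitrary: f) (auto intro: continuous_on_subset)

lemma C_on_imp_continuous_on: "C_on k S f \<Longrightarrow> continuous_on S f"
  by (cases k) (auto intro!: continuous_at_imp_continuous_on differentiable_imp_continuous_within)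

lemma C_on_Suc_imp: "C_on (Suc k) S f \<Longrightarrow> C_on k S f"
proof (induction k arbitrary: f)
  case 0 then show ?case by (metis C_on_imp_continuous_on C_on.simps(1)) 
next
  case (Suc k) then show ?case by (metis C_on.simps(2))
qed

lemma C_on_Suc_I:
  assumes "open S" "\<And>x. x \<in> S \<Longrightarrow> (f has_derivative D x) (at x)" "\<And>v. C_on k S (\<lambda>x. D x v)"
  shows "C_on (Suc k) S f"
proof -
  have "frechet_derivative f (at x) v = D x v" if "x \<in> S" for x v
    using frechet_derivative_at[OF assms(2)[OF that]] by simp
  then have "C_on k S (\<lambda>x. frechet_derivative f (at x) v)" for v
    using C_on_cong[OF assms(1), of "\<lambda>x. frechet_derivative f (at x) v" "\<lambda>x. D x v" k] assms(3) by metis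
  moreover have "\<forall>x\<in>S. f differentiable (at x)"
    using assms(2) differentiableI by metis
  ultimately show ?thesis by simp
qed

lemma C_on_const [simp]: "C_on k S (\<lambda>x. c)"
  by (induction k arbitrary: c) (auto simp: frechet_derivative_const)

lemma C_on_bounded_linear:
  assumes "open S" "bounded_linear L" shows "C_on k S L"
proof (cases k)
  case (Suc m) then show ?thesis
    using assms by (auto intro!: C_on_Suc_I[where D="\<lambda>_. L"] bounded_linear_imp_has_derivative simp del: C_on.simps)
qed (use assms in \<open>auto intro: linear_continuous_on\<close>)

lemma C_on_SucD:
  assumes "C_on (Suc k) S f" "x \<in> S"
  shows "(f has_derivative frechet_derivative f (at x)) (at x)"
  using assms frechet_derivative_works by auto

lemma C_on_add:
  assumes "open S" "C_on k S f" "C_on k S g" shows "C_on k S (\<lambda>x. f x + g x)"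
  using assms(2,3)
proof (induction k arbitrary: f g)
  case (Suc k)
  show ?case
  proof (rule C_on_Suc_I[OF assms(1)])
    show "((\<lambda>x. f x + g x) has_derivative (\<lambda>v. frechet_derivative f (at x) v + frechet_derivative g (at x) v)) (at x)"
      if "x \<in> S" for x
      by (intro has_derivative_add C_on_SucD[OF Suc.prems(1) that] C_on_SucD[OF Suc.prems(2) that])
    show "C_on k S (\<lambda>x. frechet_derivative f (at x) v + frechet_derivative g (at x) v)" for v
      using Suc.prems by (intro Suc.IH) auto
  qed
qed (auto intro: continuous_intros)

lemma C_on_sum:
  assumes "open S" "\<And>i. i \<in> I \<Longrightarrow> C_on k S (f i)" shows "C_on k S (\<lambda>x. \<Sum>i\<in>I. f i x)"
  using assms(2) by (induction I rule: infinite_finite_induct) (auto intro: C_on_add[OF assms(1)])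

lemma (in bounded_bilinear) C_on:
  assumes "open S" "C_on k S f" "C_on k S g" shows "C_on k S (\<lambda>x. prod (f x) (g x))"
  using assms(2,3)
proof (induction k arbitrary: f g)
  case (Suc k)
  show ?case
  proof (rule C_on_Suc_I[OF assms(1)])
    show "((\<lambda>x. prod (f x) (g x)) has_derivative
        (\<lambda>v. prod (f x) (frechet_derivative g (at x) v) + prod (frechet_derivative f (at x) v) (g x))) (at x)"
      if "x \<in> S" for x
      by (intro FDERIV C_on_SucD[OF Suc.prems(1) that] C_on_SucD[OF Suc.prems(2) that])
    have "C_on k S f" "C_on k S g" using Suc.prems C_on_Suc_imp by blast+
    then show "C_on k S (\<lambda>x. prod (f x) (frechet_derivative g (at x) v) + prod (frechet_derivative f (at x) v) (g x))" for v
      using Suc.prems by (intro C_on_add assms(1) Suc.IH) auto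
  qed
qed (auto intro: continuous_on)

text \<open>By the chain rule the derivative in direction v is Dg(f x) applied to Df(x) v, a
  direction that moves with x. Expanding it in coordinates leaves products of scalar functions with
  derivatives of g in fixed directions, to which the induction hypothesis applies.\<close>

lemma C_on_compose:
  fixes f :: "'x :: real_normed_vector \<Rightarrow> 'y :: fin_dim" and g :: "'y \<Rightarrow> 'z :: real_normed_vector"
  assumes "open S" "open T" "C_on k S f" "C_on k T g" "\<And>x. x \<in> S \<Longrightarrow> f x \<in> T"
  shows "C_on k S (\<lambda>x. g (f x))"
  using assms(3,4)
proof (induction k arbitrary: g)
  case 0 then show ?case
    using continuous_on_compose2[of T g S f] assms(5) by auto
next
  case (Suc k)
  obtain B and c :: "'y \<Rightarrow> 'y \<Rightarrow> real" where B: "finite B" "\<And>b. bounded_linear (c b)" "\<And>x. (\<Sum>b\<in>B. c b x *\<^sub>R b) = x"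
    using fin_dim_coordsE by blast
  \<comment> \<open>The coordinates of Df(x) v require the special case of an outer linear
    functional. Its own induction is simple because no direction moves there.\<close>
  have lin: "C_on j S (\<lambda>x. L (F x))" if "bounded_linear L" "C_on j S F" for j and F :: "'x \<Rightarrow> 'y" and L :: "'y \<Rightarrow> real"
    using that(2)
  proof (induction j arbitrary: F)
    case 0 then show ?case by (simp add: bounded_linear.continuous_on[OF that(1)])
  next
    case (Suc j)
    show ?case
    proof (rule C_on_Suc_I[OF assms(1)])
      show "((\<lambda>x. L (F x)) has_derivative (\<lambda>v. L (frechet_derivative F (at x) v))) (at x)" if "x \<in> S" for x
        by (rule bounded_linear.has_derivative[OF \<open>bounded_linear L\<close> C_on_SucD[OF Suc.prems that]])
      show "C_on j S (\<lambda>x. L (frechet_derivative F (at x) v))" for v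
        using Suc.prems by (intro Suc.IH) auto
    qed
  qed
  show ?case
  proof (rule C_on_Suc_I[OF assms(1)])
    fix x assume x: "x \<in> S"
    have g: "(g has_derivative frechet_derivative g (at (f x))) (at (f x))"
      using C_on_SucD[OF Suc.prems(2)] assms(5) x by auto
    have "frechet_derivative g (at (f x)) = (\<lambda>u. \<Sum>b\<in>B. c b u *\<^sub>R frechet_derivative g (at (f x)) b)"
      by (rule ext, rule linear_fin_dim_expand[OF has_derivative_linear[OF g] B(3)])
    then have "(g has_derivative (\<lambda>u. \<Sum>b\<in>B. c b u *\<^sub>R frechet_derivative g (at (f x)) b)) (at (f x))"
      by (rule has_derivative_eq_rhs[OF g])
    from has_derivative_compose[OF C_on_SucD[OF Suc.prems(1) x] this]
    show "((\<lambda>x. g (f x)) has_derivative (\<lambda>v. \<Sum>b\<in>B. c b (frechet_derivative f (at x) v) *\<^sub>R frechet_derivative g (at (f x)) b)) (at x)" .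
  next
    fix v
    show "C_on k S (\<lambda>x. \<Sum>b\<in>B. c b (frechet_derivative f (at x) v) *\<^sub>R frechet_derivative g (at (f x)) b)"
      using Suc.prems C_on_Suc_imp[OF Suc.prems(1)]
      by (intro C_on_sum assms bounded_bilinear.C_on[OF bounded_bilinear_scaleR] lin B Suc.IH) auto
  qed
qed

lemma C_on_bounded_linear_compose:
  fixes f :: "'x :: real_normed_vector \<Rightarrow> 'y :: fin_dim"
  assumes "open S" "bounded_linear L" "C_on k S f" shows "C_on k S (\<lambda>x. L (f x))"
  by (rule C_on_compose[OF assms(1) open_UNIV assms(3) C_on_bounded_linear[OF open_UNIV assms(2)]]) auto

lemma bounded_linear_Pair_0: "bounded_linear (\<lambda>x. (x, 0))" "bounded_linear (\<lambda>x. (0, x))"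
  by (intro bounded_linear_Pair bounded_linear_ident bounded_linear_zero)+

lemma C_on_Pair:
  fixes f :: "'x :: real_normed_vector \<Rightarrow> 'y :: fin_dim" and g :: "'x \<Rightarrow> 'z :: fin_dim"
  assumes "open S" "C_on k S f" "C_on k S g" shows "C_on k S (\<lambda>x. (f x, g x))"
  using C_on_add[OF assms(1) C_on_bounded_linear_compose[OF assms(1) bounded_linear_Pair_0(1) assms(2)]
    C_on_bounded_linear_compose[OF assms(1) bounded_linear_Pair_0(2) assms(3)]] by simp

section \<open>Closure properties of smooth maps, and strict differentiability\<close>

lemma smooth_on_C_on: "smooth_on S f \<Longrightarrow> C_on k S f"
  by (simp add: smooth_on_def)

lemma smooth_on_differentiable:
  assumes "smooth_on S f" "x \<in> S" shows "(f has_derivative frechet_derivative f (at x)) (at x)"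
  using C_on_SucD[OF smooth_on_C_on[OF assms(1), of 1, simplified One_nat_def] assms(2)] .

lemma smooth_on_frechet_derivative: "smooth_on S f \<Longrightarrow> smooth_on S (\<lambda>x. frechet_derivative f (at x) v)"
  unfolding smooth_on_def by (metis C_on.simps(2))

lemma smooth_on_imp_continuous_on: "smooth_on S f \<Longrightarrow> continuous_on S f"
  by (rule C_on_imp_continuous_on[OF smooth_on_C_on[of _ _ 0]])

lemma smooth_on_isCont: "smooth_on S f \<Longrightarrow> open S \<Longrightarrow> x \<in> S \<Longrightarrow> isCont f x"
  using smooth_on_imp_continuous_on continuous_on_eq_continuous_at by blast

lemma smooth_on_subset: "smooth_on S f \<Longrightarrow> T \<subseteq> S \<Longrightarrow> smooth_on T f"
  unfolding smooth_on_def using C_on_subset by blast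

lemma smooth_on_const: "smooth_on S (\<lambda>x. c)"
  by (simp add: smooth_on_def)

lemma smooth_on_bounded_linear: "open S \<Longrightarrow> bounded_linear L \<Longrightarrow> smooth_on S L"
  by (simp add: smooth_on_def C_on_bounded_linear)

lemma smooth_on_add: "open S \<Longrightarrow> smooth_on S f \<Longrightarrow> smooth_on S g \<Longrightarrow> smooth_on S (\<lambda>x. f x + g x)"
  by (simp add: smooth_on_def C_on_add)

lemma smooth_on_sum: "open S \<Longrightarrow> (\<And>i. i \<in> I \<Longrightarrow> smooth_on S (f i)) \<Longrightarrow> smooth_on S (\<lambda>x. \<Sum>i\<in>I. f i x)"
  by (simp add: smooth_on_def C_on_sum)

lemma (in bounded_bilinear) smooth_on:
  "open S \<Longrightarrow> smooth_on S f \<Longrightarrow> smooth_on S g \<Longrightarrow> smooth_on S (\<lambda>x. prod (f x) (g x))"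
  by (simp add: smooth_on_def C_on)

lemma smooth_on_compose:
  fixes f :: "'x :: real_normed_vector \<Rightarrow> 'y :: fin_dim"
  shows "open S \<Longrightarrow> open T \<Longrightarrow> smooth_on S f \<Longrightarrow> smooth_on T g \<Longrightarrow> (\<And>x. x \<in> S \<Longrightarrow> f x \<in> T)
    \<Longrightarrow> smooth_on S (\<lambda>x. g (f x))"
  unfolding smooth_on_def using C_on_compose by blast

lemma smooth_on_bounded_linear_compose:
  fixes f :: "'x :: real_normed_vector \<Rightarrow> 'y :: fin_dim"
  shows "open S \<Longrightarrow> bounded_linear L \<Longrightarrow> smooth_on S f \<Longrightarrow> smooth_on S (\<lambda>x. L (f x))"
  by (simp add: smooth_on_def C_on_bounded_linear_compose)

lemma smooth_on_diff:
  fixes f :: "'x :: real_normed_vector \<Rightarrow> 'y :: fin_dim"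
  assumes "open S" "smooth_on S f" "smooth_on S g" shows "smooth_on S (\<lambda>x. f x - g x)"
  using smooth_on_add[OF assms(1,2) smooth_on_bounded_linear_compose[OF assms(1) bounded_linear_minus[OF bounded_linear_ident] assms(3)]]
  by simp

lemma smooth_on_Pair:
  fixes f :: "'x :: real_normed_vector \<Rightarrow> 'y :: fin_dim" and g :: "'x \<Rightarrow> 'z :: fin_dim"
  shows "open S \<Longrightarrow> smooth_on S f \<Longrightarrow> smooth_on S g \<Longrightarrow> smooth_on S (\<lambda>x. (f x, g x))"
  by (simp add: smooth_on_def C_on_Pair)

text \<open>Smoothness gives continuity of each directional derivative separately. Summing the
  differences over the finite spanning set, weighted by the norms of the coordinate functionals,
  gives a bound \<open>s y\<close> of the operator norm that tends to 0 at y0.\<close>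

lemma smooth_on_derivative_near:
  fixes f :: "'x :: fin_dim \<Rightarrow> 'y :: real_normed_vector"
  assumes "open S" "smooth_on S f" "y0 \<in> S" "0 < \<epsilon>"
  shows "\<forall>\<^sub>F y in nhds y0. y \<in> S \<and>
    (\<forall>u. norm (frechet_derivative f (at y) u - frechet_derivative f (at y0) u) \<le> \<epsilon> * norm u)"
proof -
  obtain B and c :: "'x \<Rightarrow> 'x \<Rightarrow> real" where B: "finite B" "\<And>b. bounded_linear (c b)" "\<And>x. (\<Sum>b\<in>B. c b x *\<^sub>R b) = x"
    using fin_dim_coordsE by blast
  let ?D = "\<lambda>y. frechet_derivative f (at y)"
  define s where "s y = (\<Sum>b\<in>B. onorm (c b) * norm (?D y b - ?D y0 b))" for y
  have lin: "linear (\<lambda>u. ?D y u - ?D y0 u)" if "y \<in> S" for y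
    by (intro linear_compose_sub has_derivative_linear[OF smooth_on_differentiable[OF assms(2)]] that assms(3))
  have bound: "norm (?D y u - ?D y0 u) \<le> s y * norm u" if "y \<in> S" for y u
  proof -
    have "norm (?D y u - ?D y0 u) = norm (\<Sum>b\<in>B. c b u *\<^sub>R (?D y b - ?D y0 b))"
      by (subst linear_fin_dim_expand[OF lin[OF that] B(3)]) simp
    also have "\<dots> \<le> (\<Sum>b\<in>B. \<bar>c b u\<bar> * norm (?D y b - ?D y0 b))"
      by (rule order_trans[OF norm_sum]) simp
    also have "\<dots> \<le> (\<Sum>b\<in>B. (onorm (c b) * norm u) * norm (?D y b - ?D y0 b))"
      using onorm[OF B(2)] by (intro sum_mono mult_right_mono) auto
    finally show ?thesis by (simp add: s_def sum_distrib_left mult_ac)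
  qed
  have "isCont s y0"
    unfolding s_def using smooth_on_isCont[OF smooth_on_frechet_derivative[OF assms(2)] assms(1,3)]
    by (intro continuous_intros) auto
  then have "(s \<longlongrightarrow> 0) (nhds y0)"
    by (simp add: isCont_def tendsto_at_iff_tendsto_nhds) (simp add: s_def)
  then have "\<forall>\<^sub>F y in nhds y0. s y < \<epsilon> \<and> y \<in> S"
    using assms order_tendstoD(2) eventually_nhds_in_open by (intro eventually_conj) auto
  then show ?thesis
  proof eventually_elim
    case (elim y)
    then show ?case
      using order_trans[OF bound mult_right_mono[of "s y" \<epsilon>]] by auto
  qed
qed

text \<open>f minus its linearization at y0 has a small derivative on a small ball, so the mean
  value inequality makes it Lipschitz with a small constant there. Both points may move, as the
  shooting solution and the exact one do.\<close>

lemma smooth_on_strict: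
  fixes f :: "'x :: fin_dim \<Rightarrow> 'y :: real_normed_vector"
  assumes "open S" "smooth_on S f" "y0 \<in> S" "0 < \<epsilon>"
  obtains d where "0 < d"
    "\<And>y z. y \<in> ball y0 d \<Longrightarrow> z \<in> ball y0 d \<Longrightarrow>
      norm (f y - f z - frechet_derivative f (at y0) (y - z)) \<le> \<epsilon> * norm (y - z)"
proof -
  let ?D = "\<lambda>y. frechet_derivative f (at y)"
  have D: "(f has_derivative ?D y) (at y)" if "y \<in> S" for y
    using smooth_on_differentiable[OF assms(2) that] .
  obtain d where d: "d > 0" "\<And>y. y \<in> ball y0 d \<Longrightarrow> y \<in> S"
      "\<And>y u. y \<in> ball y0 d \<Longrightarrow> norm (?D y u - ?D y0 u) \<le> \<epsilon> * norm u"
    using smooth_on_derivative_near[OF assms] unfolding eventually_nhds_metric by (auto simp: dist_commute)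
  show thesis
  proof (rule that[OF d(1)])
    fix y z assume yz: "y \<in> ball y0 d" "z \<in> ball y0 d"
    have "norm ((f y - ?D y0 y) - (f z - ?D y0 z)) \<le> \<epsilon> * norm (y - z)"
    proof (rule differentiable_bound[OF convex_ball _ _ yz])
      fix w assume w: "w \<in> ball y0 d"
      have "((\<lambda>y. f y - ?D y0 y) has_derivative (\<lambda>u. ?D w u - ?D y0 u)) (at w)"
        using D[of w] D[OF assms(3)] d(2)[OF w]
        by (intro has_derivative_diff bounded_linear_imp_has_derivative) (auto dest: has_derivative_bounded_linear)
      then show "((\<lambda>y. f y - ?D y0 y) has_derivative (\<lambda>u. ?D w u - ?D y0 u)) (at w within ball y0 d)"
        by (rule has_derivative_at_withinI)
      show "onorm (\<lambda>u. ?D w u - ?D y0 u) \<le> \<epsilon>"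
        using d(3)[OF w] assms(4) by (intro onorm_bound) auto
    qed
    moreover have "?D y0 (y - z) = ?D y0 y - ?D y0 z"
      using D[OF assms(3)] by (intro linear_diff has_derivative_linear)
    then have "f y - f z - ?D y0 (y - z) = (f y - ?D y0 y) - (f z - ?D y0 z)" by simp
    ultimately show "norm (f y - f z - ?D y0 (y - z)) \<le> \<epsilon> * norm (y - z)"
      by (simp only:)
  qed
qed

section \<open>Divisibility by powers of the step size\<close>

text \<open>The first component moves as well. Limits along this filter, unlike limits in h for
  fixed x, are what a continuous extension of a quotient to h = 0 requires.\<close>

definition hfilter :: "'x :: real_normed_vector \<Rightarrow> ('x \<times> real) filter" where
  "hfilter x = at (x, 0) within {y. snd y \<noteq> 0}"

definition hlim :: "nat \<Rightarrow> ('x :: real_normed_vector \<times> real \<Rightarrow> 'y :: real_normed_vector) \<Rightarrow> 'x \<Rightarrow> 'y \<Rightarrow> bool" where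
  "hlim r f x l \<longleftrightarrow> ((\<lambda>y. inverse (snd y ^ r) *\<^sub>R f y) \<longlongrightarrow> l) (hfilter x)"

definition hcong :: "nat \<Rightarrow> 'x :: real_normed_vector \<Rightarrow> ('x \<times> real \<Rightarrow> 'y :: real_normed_vector) \<Rightarrow> ('x \<times> real \<Rightarrow> 'y) \<Rightarrow> bool" where
  "hcong r x f g \<longleftrightarrow> (\<exists>l. hlim r (\<lambda>y. f y - g y) x l)"

lemma hfilter_nontrivial [simp]: "hfilter x \<noteq> bot"
  unfolding hfilter_def trivial_limit_within islimpt_approachable not_not
proof (intro allI impI)
  fix e :: real assume "0 < e"
  then show "\<exists>x'\<in>{y. snd y \<noteq> 0}. x' \<noteq> (x, 0 :: real) \<and> dist x' (x, 0) < e"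
    by (intro bexI[where x="(x, e / 2)"]) (auto simp: dist_Pair_Pair)
qed

lemma eventually_hfilterI: "\<forall>\<^sub>F y in nhds (x, 0). snd y \<noteq> 0 \<longrightarrow> P y \<Longrightarrow> \<forall>\<^sub>F y in hfilter x. P y"
  unfolding hfilter_def eventually_at_filter by (auto elim: eventually_mono)

lemma eventually_hfilter_nonzero: "\<forall>\<^sub>F y in hfilter x. snd y \<noteq> 0"
  by (rule eventually_hfilterI) auto

lemma eventually_hfilter_in_open: "open U \<Longrightarrow> (x, 0) \<in> U \<Longrightarrow> \<forall>\<^sub>F y in hfilter x. y \<in> U"
  by (rule eventually_hfilterI) (auto simp: eventually_nhds)

lemma isCont_tendsto_hfilter: "isCont f (x, 0) \<Longrightarrow> (f \<longlongrightarrow> f (x, 0)) (hfilter x)"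
  unfolding isCont_def hfilter_def by (rule tendsto_within_subset[where S=UNIV]) auto

lemma snd_tendsto_hfilter: "(snd \<longlongrightarrow> (0 :: real)) (hfilter x)"
  unfolding hfilter_def by (auto intro!: tendsto_eq_intros)

lemma hlim_cong:
  assumes "\<forall>\<^sub>F y in hfilter x. f y = g y" "hlim r f x l" shows "hlim r g x l"
  using assms(2) unfolding hlim_def
  by (rule Lim_transform_eventually) (use assms(1) in \<open>auto elim: eventually_mono\<close>)

lemma hlim_bounded_linear:
  assumes "bounded_linear L" "hlim r f x l" shows "hlim r (\<lambda>y. L (f y)) x (L l)"
  using bounded_linear.tendsto[OF assms(1) assms(2)[unfolded hlim_def]]
  by (simp add: hlim_def linear_scale[OF bounded_linear.linear[OF assms(1)]])

lemma hlim_zero: "hlim r (\<lambda>y. 0) x 0"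
  by (simp add: hlim_def)

lemma hlim_add: "hlim r f x l \<Longrightarrow> hlim r g x m \<Longrightarrow> hlim r (\<lambda>y. f y + g y) x (l + m)"
  unfolding hlim_def scaleR_add_right by (rule tendsto_add)

lemma hlim_uminus: "hlim r f x l \<Longrightarrow> hlim r (\<lambda>y. - f y) x (- l)"
  unfolding hlim_def scaleR_minus_right by (rule tendsto_minus)

lemma hlim_diff: "hlim r f x l \<Longrightarrow> hlim r g x m \<Longrightarrow> hlim r (\<lambda>y. f y - g y) x (l - m)"
  unfolding hlim_def scaleR_diff_right by (rule tendsto_diff)

lemma (in bounded_bilinear) hlim_left:
  assumes "hlim r f x l" "(g \<longlongrightarrow> B) (hfilter x)" shows "hlim r (\<lambda>y. prod (f y) (g y)) x (prod l B)"
  using tendsto[OF assms[unfolded hlim_def]] by (simp add: hlim_def scaleR_left)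

lemma (in bounded_bilinear) hlim_right:
  assumes "(f \<longlongrightarrow> A) (hfilter x)" "hlim r g x l" shows "hlim r (\<lambda>y. prod (f y) (g y)) x (prod A l)"
  using tendsto[OF assms[unfolded hlim_def]] by (simp add: hlim_def scaleR_right)

lemma hlim_power_tendsto: "hlim r f x l \<Longrightarrow> (f \<longlongrightarrow> 0 ^ r *\<^sub>R l) (hfilter x)"
  unfolding hlim_def
  by (rule Lim_transform_eventually[OF tendsto_scaleR[OF tendsto_power[OF snd_tendsto_hfilter]]],
      assumption, rule eventually_mono[OF eventually_hfilter_nonzero]) auto

lemma hlim_mono:
  assumes "hlim s f x l" "r \<le> s" shows "hlim r f x (0 ^ (s - r) *\<^sub>R l)"
proof -
  have "((\<lambda>y. snd y ^ (s - r) *\<^sub>R (inverse (snd y ^ s) *\<^sub>R f y)) \<longlongrightarrow> 0 ^ (s - r) *\<^sub>R l) (hfilter x)"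
    using assms(1) unfolding hlim_def by (intro tendsto_intros snd_tendsto_hfilter)
  then show ?thesis
    unfolding hlim_def
  proof (rule Lim_transform_eventually, intro eventually_mono[OF eventually_hfilter_nonzero])
    fix y :: "'a \<times> real" assume "snd y \<noteq> 0"
    then show "snd y ^ (s - r) *\<^sub>R inverse (snd y ^ s) *\<^sub>R f y = inverse (snd y ^ r) *\<^sub>R f y"
      using assms(2) by (simp add: power_diff field_simps)
  qed
qed

text \<open>If f = o(u) and u = O(h^r), then f = o(h^r). Only a bound on the quotient of u is asked
  for, so the rule also serves where the limit of that quotient is still to be found.\<close>

lemma hlim_small:
  assumes "\<And>\<epsilon>. 0 < \<epsilon> \<Longrightarrow> \<forall>\<^sub>F y in hfilter x. norm (f y) \<le> \<epsilon> * norm (u y)"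
    and "\<forall>\<^sub>F y in hfilter x. norm (inverse (snd y ^ r) *\<^sub>R u y) \<le> K"
  shows "hlim r f x 0"
  unfolding hlim_def tendsto_iff dist_0_norm dist_norm diff_zero
proof (intro allI impI)
  fix e :: real assume "0 < e"
  \<comment> \<open>K is an arbitrary real number; |K| + 1 makes the denominator positive.\<close>
  define \<epsilon> where "\<epsilon> = e / (\<bar>K\<bar> + 1)"
  have \<epsilon>: "0 < \<epsilon>" "\<epsilon> * K < e"
  proof -
    show "0 < \<epsilon>" using \<open>0 < e\<close> by (simp add: \<epsilon>_def)
    then have "\<epsilon> * K < \<epsilon> * (\<bar>K\<bar> + 1)" by (intro mult_strict_left_mono) auto
    then show "\<epsilon> * K < e" by (simp add: \<epsilon>_def)
  qed
  show "\<forall>\<^sub>F y in hfilter x. norm (inverse (snd y ^ r) *\<^sub>R f y) < e"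
    using assms(1)[OF \<epsilon>(1)] assms(2)
  proof eventually_elim
    case (elim y)
    have "norm (inverse (snd y ^ r) *\<^sub>R f y) \<le> \<bar>inverse (snd y ^ r)\<bar> * (\<epsilon> * norm (u y))"
      unfolding norm_scaleR by (intro mult_left_mono elim) auto
    also have "\<dots> = \<epsilon> * norm (inverse (snd y ^ r) *\<^sub>R u y)" by simp
    also have "\<dots> \<le> \<epsilon> * K" using elim \<epsilon>(1) by (intro mult_left_mono) auto
    finally show ?case using \<epsilon>(2) by simp
  qed
qed

lemma hlim_imp_bounded:
  assumes "hlim r u x l" shows "\<forall>\<^sub>F y in hfilter x. norm (inverse (snd y ^ r) *\<^sub>R u y) \<le> norm l + 1"
  using order_tendstoD(2)[OF tendsto_norm[OF assms[unfolded hlim_def]], of "norm l + 1"]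
  by (auto elim: eventually_mono)

text \<open>Here R = u + o(u). Taking 1/2 for the relative error, the norm of u is at most twice
  that of R, so u has the order of R; then R - u is o(h^r) and the two quotients have the same
  limit. This plays the role of inverting a linear map that tends to the identity.\<close>

lemma hlim_near_identity:
  assumes "\<And>\<epsilon>. 0 < \<epsilon> \<Longrightarrow> \<forall>\<^sub>F y in hfilter x. norm (R y - u y) \<le> \<epsilon> * norm (u y)" "hlim r R x l"
  shows "hlim r u x l"
proof -
  have "\<forall>\<^sub>F y in hfilter x. norm (inverse (snd y ^ r) *\<^sub>R u y) \<le> 2 * (norm l + 1)"
    using assms(1)[of "1/2", simplified] hlim_imp_bounded[OF assms(2)]
  proof eventually_elim
    case (elim y)
    have "norm (u y) \<le> 2 * norm (R y)"
      using norm_triangle_ineq2[of "u y" "R y"] elim(1) by (simp add: norm_minus_commute)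
    then have "norm (inverse (snd y ^ r) *\<^sub>R u y) \<le> \<bar>inverse (snd y ^ r)\<bar> * (2 * norm (R y))"
      unfolding norm_scaleR by (intro mult_left_mono) auto
    then show ?case using elim(2) by simp
  qed
  from hlim_small[OF assms(1) this] have "hlim r (\<lambda>y. R y - u y) x 0" by simp
  from hlim_diff[OF assms(2) this] show ?thesis by simp
qed

lemma hlim_strict:
  fixes \<Psi> :: "'y :: fin_dim \<Rightarrow> 'z :: real_normed_vector"
  assumes "open S" "smooth_on S \<Psi>" "y0 \<in> S"
    and "(f \<longlongrightarrow> y0) (hfilter x)" "(g \<longlongrightarrow> y0) (hfilter x)" "hlim r (\<lambda>y. f y - g y) x l"
  shows "hlim r (\<lambda>y. \<Psi> (f y) - \<Psi> (g y)) x (frechet_derivative \<Psi> (at y0) l)"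
proof -
  let ?D = "frechet_derivative \<Psi> (at y0)"
  have D: "bounded_linear ?D"
    using smooth_on_differentiable[OF assms(2,3)] by (rule has_derivative_bounded_linear)
  have "hlim r (\<lambda>y. \<Psi> (f y) - \<Psi> (g y) - ?D (f y - g y)) x 0"
  proof (rule hlim_small[OF _ hlim_imp_bounded[OF assms(6)]])
    fix \<epsilon> :: real assume "0 < \<epsilon>"
    then obtain d where d: "0 < d" "\<And>y z. y \<in> ball y0 d \<Longrightarrow> z \<in> ball y0 d \<Longrightarrow>
        norm (\<Psi> y - \<Psi> z - ?D (y - z)) \<le> \<epsilon> * norm (y - z)"
      using smooth_on_strict[OF assms(1-3)] by metis
    show "\<forall>\<^sub>F y in hfilter x. norm (\<Psi> (f y) - \<Psi> (g y) - ?D (f y - g y)) \<le> \<epsilon> * norm (f y - g y)"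
      using tendstoD[OF assms(4) d(1)] tendstoD[OF assms(5) d(1)]
      by eventually_elim (auto intro!: d(2) simp: dist_commute)
  qed
  from hlim_add[OF this hlim_bounded_linear[OF D assms(6)]] show ?thesis by simp
qed

section \<open>Congruence modulo a power of h\<close>

lemma hcong_refl [simp]: "hcong r x f f"
  unfolding hcong_def using hlim_zero by auto

lemma hcong_sym: "hcong r x f g \<Longrightarrow> hcong r x g f"
  unfolding hcong_def using hlim_uminus[of r "\<lambda>y. f y - g y" x] by fastforce

lemma hcong_trans [trans]: "hcong r x f g \<Longrightarrow> hcong r x g k \<Longrightarrow> hcong r x f k"
  unfolding hcong_def using hlim_add[of r "\<lambda>y. f y - g y" x _ "\<lambda>y. g y - k y"] by fastforce

lemma hcong_mono: "hcong s x f g \<Longrightarrow> r \<le> s \<Longrightarrow> hcong r x f g"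
  unfolding hcong_def using hlim_mono by blast

lemma hcong_cong:
  assumes "hcong r x f g" "\<forall>\<^sub>F y in hfilter x. f y = f' y" "\<forall>\<^sub>F y in hfilter x. g y = g' y"
  shows "hcong r x f' g'"
proof -
  obtain l where "hlim r (\<lambda>y. f y - g y) x l" using assms(1) hcong_def by blast
  then have "hlim r (\<lambda>y. f' y - g' y) x l"
    by (rule hlim_cong[rotated]) (use assms(2,3) in eventually_elim, simp)
  then show ?thesis unfolding hcong_def by blast
qed

lemma hcong_add: "hcong r x f g \<Longrightarrow> hcong r x f' g' \<Longrightarrow> hcong r x (\<lambda>y. f y + f' y) (\<lambda>y. g y + g' y)"
  unfolding hcong_def using hlim_add[of r "\<lambda>y. f y - g y" x _ "\<lambda>y. f' y - g' y"]
  by (fastforce simp: algebra_simps)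

lemma hcong_diff: "hcong r x f g \<Longrightarrow> hcong r x f' g' \<Longrightarrow> hcong r x (\<lambda>y. f y - f' y) (\<lambda>y. g y - g' y)"
  unfolding hcong_def using hlim_diff[of r "\<lambda>y. f y - g y" x _ "\<lambda>y. f' y - g' y"]
  by (fastforce simp: algebra_simps)

lemma hcong_sum: "(\<And>i. i \<in> I \<Longrightarrow> hcong r x (f i) (g i)) \<Longrightarrow> hcong r x (\<lambda>y. \<Sum>i\<in>I. f i y) (\<lambda>y. \<Sum>i\<in>I. g i y)"
  by (induction I rule: infinite_finite_induct) (auto intro: hcong_add)

lemma hcong_bounded_linear:
  assumes "bounded_linear L" "hcong r x f g" shows "hcong r x (\<lambda>y. L (f y)) (\<lambda>y. L (g y))"
proof -
  obtain l where "hlim r (\<lambda>y. f y - g y) x l" using assms(2) hcong_def by blast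
  from hlim_bounded_linear[OF assms(1) this] show ?thesis
    unfolding hcong_def linear_diff[OF bounded_linear.linear[OF assms(1)]] by blast
qed

lemma hcong_tendsto:
  assumes "hcong r x f g" "(g \<longlongrightarrow> A) (hfilter x)" "0 < r" shows "(f \<longlongrightarrow> A) (hfilter x)"
proof -
  obtain l where "hlim r (\<lambda>y. f y - g y) x l" using assms(1) hcong_def by blast
  from tendsto_add[OF hlim_power_tendsto[OF this] assms(2)] show ?thesis using assms(3) by (simp add: zero_power)
qed

text \<open>From fg - f'g' = f(g - g') + (f - f')g', where only f and g' have to converge.\<close>

lemma (in bounded_bilinear) hcong:
  assumes "hcong r x f f'" "hcong r x g g'" "(f \<longlongrightarrow> A) (hfilter x)" "(g' \<longlongrightarrow> B) (hfilter x)"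
  shows "hcong r x (\<lambda>y. prod (f y) (g y)) (\<lambda>y. prod (f' y) (g' y))"
proof -
  obtain l m where "hlim r (\<lambda>y. f y - f' y) x l" "hlim r (\<lambda>y. g y - g' y) x m"
    using assms(1,2) unfolding hcong_def by blast
  from hlim_add[OF hlim_right[OF assms(3) this(2)] hlim_left[OF this(1) assms(4)]]
  show ?thesis unfolding hcong_def by (intro exI) (auto simp: diff_left diff_right)
qed

lemma hcong_compose:
  fixes \<Psi> :: "'y :: fin_dim \<Rightarrow> 'z :: real_normed_vector"
  assumes "open S" "smooth_on S \<Psi>" "y0 \<in> S"
    and "(f \<longlongrightarrow> y0) (hfilter x)" "(g \<longlongrightarrow> y0) (hfilter x)" "hcong r x f g"
  shows "hcong r x (\<lambda>y. \<Psi> (f y)) (\<lambda>y. \<Psi> (g y))"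
  using assms(6) hlim_strict[OF assms(1-5)] unfolding hcong_def by blast

text \<open>The limits for the single vectors are linear in the vector because limits along
  \<open>hfilter\<close> are unique, hence they form a bounded map; pointwise convergence to it is
  convergence in norm.\<close>

lemma hcong_blinfunI:
  fixes A B :: "'x :: real_normed_vector \<times> real \<Rightarrow> 'a :: fin_dim \<Rightarrow>\<^sub>L 'b :: fin_dim"
  assumes "\<And>v. hcong r x (\<lambda>y. blinfun_apply (A y) v) (\<lambda>y. blinfun_apply (B y) v)"
  shows "hcong r x A B"
proof -
  obtain l where l: "\<And>v. hlim r (\<lambda>y. blinfun_apply (A y - B y) v) x (l v)"
    using assms unfolding hcong_def blinfun.diff_left by metis
  have uniq: "a = b" if "hlim r f x a" "hlim r f x b" for f :: "'x \<times> real \<Rightarrow> 'b" and a b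
    using tendsto_unique[OF hfilter_nontrivial] that unfolding hlim_def by blast
  have "linear l"
  proof (rule linearI)
    show "l (u + v) = l u + l v" for u v
      using uniq[OF l[of "u + v"]] hlim_add[OF l[of u] l[of v]] by (simp add: blinfun.add_right)
    show "l (c *\<^sub>R v) = c *\<^sub>R l v" for c v
      using uniq[OF l[of "c *\<^sub>R v"]] hlim_bounded_linear[OF bounded_linear_scaleR_right l[of v]]
      by (simp add: blinfun.scaleR_right)
  qed
  then have "blinfun_apply (Blinfun l) = l"
    by (intro bounded_linear_Blinfun_apply linear_fin_dim_bounded)
  then have "hlim r (\<lambda>y. A y - B y) x (Blinfun l)"
    using l unfolding hlim_def by (intro tendsto_blinfunI) (simp add: blinfun.scaleR_left)
  then show ?thesis unfolding hcong_def by blast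
qed

text \<open>The quotient is extended to h = 0 by its limits. Nothing is assumed about how these
  depend on x: continuity of the extension follows from the limits being taken with x
  moving.\<close>

lemma eq_upto_O_I:
  fixes f1 f2 :: "'x :: real_normed_vector \<times> real \<Rightarrow> 'y :: real_normed_vector"
  assumes "\<And>x. \<forall>\<^sub>F y in nhds (x, 0). y \<in> A1 \<inter> A2"
    and "\<And>x. \<forall>\<^sub>F y in nhds (x, 0). snd y \<noteq> 0 \<longrightarrow> isCont f1 y \<and> isCont f2 y"
    and "\<And>x. f2 (x, 0) = f1 (x, 0)" "\<And>x. hcong r x f2 f1" "0 < r"
  shows "eq_upto_O A2 f2 A1 f1 r"
proof -
  define q where "q y = inverse (snd y ^ r) *\<^sub>R (f2 y - f1 y)" for y
  obtain l where l: "\<And>x. (q \<longlongrightarrow> l x) (hfilter x)"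
    using assms(4) unfolding hcong_def hlim_def q_def[abs_def] by metis
  define \<delta> where "\<delta> y = (if snd y = 0 then l (fst y) else q y)" for y
  define G where "G = {y. y \<in> A1 \<inter> A2 \<and> (snd y \<noteq> 0 \<longrightarrow> isCont f1 y \<and> isCont f2 y)}"
  \<comment> \<open>\<open>G\<close> need not be open, but it is a neighborhood of every (x, 0), so
    its interior is a domain as required.\<close>
  define U where "U = interior G"
  have "(x, 0) \<in> U" for x
    using eventually_conj[OF assms(1,2), of x] unfolding U_def interior_def G_def eventually_nhds by auto
  moreover have "isCont \<delta> y" if "y \<in> U" for y
  proof (cases "snd y = 0")
    case False
    have "y \<in> G" using that interior_subset U_def by blast
    then have "isCont f1 y" "isCont f2 y" using False by (auto simp: G_def)
    then have "isCont q y"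
      unfolding q_def using False by (intro continuous_intros) auto
    moreover have "\<forall>\<^sub>F z in nhds y. \<delta> z = q z"
    proof -
      have "open {z :: 'x \<times> real. snd z \<noteq> 0}"
        by (intro open_Collect_neq continuous_intros)
      then show ?thesis
        using False eventually_nhds_in_open[of "{z :: 'x \<times> real. snd z \<noteq> 0}" y] by (auto elim!: eventually_mono simp: \<delta>_def)
    qed
    ultimately show ?thesis using isCont_cong by blast
  next
    case True
    then obtain x where y: "y = (x, 0)" by (cases y) auto
    show ?thesis unfolding isCont_def tendsto_iff
    proof (intro allI impI)
      fix e :: real assume e: "0 < e"
      have "\<forall>\<^sub>F z in hfilter x. dist (q z) (l x) < e / 2" by (rule tendstoD[OF l]) (use e in simp)
      then have "\<forall>\<^sub>F z in nhds y. snd z \<noteq> 0 \<longrightarrow> dist (q z) (l x) < e / 2"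
        unfolding hfilter_def y eventually_at_filter by (rule eventually_mono) auto
      then obtain V where V: "open V" "y \<in> V" "\<And>z. z \<in> V \<Longrightarrow> snd z \<noteq> 0 \<Longrightarrow> dist (q z) (l x) < e / 2"
        unfolding eventually_nhds by blast
      have "dist (\<delta> z) (l x) < e" if z: "z \<in> V" for z
      proof (cases "snd z = 0")
        case False then show ?thesis using V(3)[OF z] e by (simp add: \<delta>_def)
      next
        case True
        \<comment> \<open>Points off h = 0 near (x', 0) lie in \<open>V\<close>, so their quotients
          are within e / 2 of \<open>l x\<close>. The non-strict bound survives in the limit
          \<open>l x'\<close>.\<close>
        then obtain x' where x': "z = (x', 0)" by (cases z) auto
        have "\<forall>\<^sub>F z in hfilter x'. z \<in> V" using V(1) z x' by (intro eventually_hfilter_in_open) auto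
        then have "\<forall>\<^sub>F z in hfilter x'. dist (q z) (l x) \<le> e / 2"
          using eventually_hfilter_nonzero by eventually_elim (use V(3) in force)
        then have "dist (l x') (l x) \<le> e / 2"
          by (intro tendsto_upperbound[OF tendsto_dist[OF l tendsto_const]]) auto
        then show ?thesis using e x' by (simp add: \<delta>_def)
      qed
      moreover have "\<delta> y = l x" by (simp add: \<delta>_def y)
      ultimately show "\<forall>\<^sub>F z in at y. dist (\<delta> z) (\<delta> y) < e"
        using V(1,2) unfolding eventually_at_topological by metis
    qed
  qed
  moreover have "f2 (x, h) - f1 (x, h) = h ^ r *\<^sub>R \<delta> (x, h)" for x h
    using assms(3,5) by (cases "h = 0") (auto simp: \<delta>_def q_def)
  moreover have "U \<subseteq> A1 \<inter> A2" using interior_subset[of G] by (auto simp: U_def G_def)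
  ultimately show ?thesis
    unfolding eq_upto_O_def
    by (intro exI[of _ U] exI[of _ \<delta>]) (auto simp: U_def intro!: continuous_at_imp_continuous_on)
qed

section \<open>Derivatives in h and Taylor coefficients at h = 0\<close>

definition dir_deriv :: "'a :: real_normed_vector \<Rightarrow> ('a \<Rightarrow> 'b :: real_normed_vector) \<Rightarrow> 'a \<Rightarrow> 'b" where
  "dir_deriv v f y = frechet_derivative f (at y) v"

lemma smooth_on_dir_deriv: "smooth_on S f \<Longrightarrow> smooth_on S (dir_deriv v f)"
  using smooth_on_frechet_derivative[of S f v] by (simp add: dir_deriv_def[abs_def])

lemma smooth_on_dir_deriv_funpow: "smooth_on S f \<Longrightarrow> smooth_on S ((dir_deriv v ^^ k) f)"
  by (induction k) (auto intro: smooth_on_dir_deriv)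

lemma smooth_on_along_line:
  assumes "smooth_on S f" "y + t *\<^sub>R v \<in> S"
  shows "((\<lambda>t. f (y + t *\<^sub>R v)) has_vector_derivative dir_deriv v f (y + t *\<^sub>R v)) (at t)"
proof -
  have D: "(f has_derivative frechet_derivative f (at (y + t *\<^sub>R v))) (at (y + t *\<^sub>R v))"
    using smooth_on_differentiable[OF assms] .
  have "((\<lambda>t. y + t *\<^sub>R v) has_derivative (\<lambda>s. s *\<^sub>R v)) (at t)"
    by (auto intro!: derivative_eq_intros)
  from has_derivative_compose[OF this D] show ?thesis
    unfolding has_vector_derivative_def dir_deriv_def
    by (simp add: linear_scale[OF has_derivative_linear[OF D]])
qed

text \<open>The mean value inequality, with the bound asked for inside the segment only: the later
  estimates divide by powers of s h and say nothing at s = 0.\<close>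

lemma norm_segment_bound:
  fixes f :: "real \<Rightarrow> 'a :: real_normed_vector"
  assumes "0 < s" "\<And>u. 0 \<le> u \<Longrightarrow> u \<le> s \<Longrightarrow> (f has_vector_derivative f' u) (at u)"
    and "\<And>u. 0 < u \<Longrightarrow> u < s \<Longrightarrow> norm (f' u) \<le> K"
  shows "norm (f s - f 0) \<le> s * K"
proof -
  have "norm (f s - f 0) \<le> K * s - K * 0"
  proof (rule differentiable_bound_general[OF assms(1)])
    show "continuous_on {0..s} f"
      using assms(2) by (intro continuous_at_imp_continuous_on) (force intro: has_vector_derivative_continuous)
    show "(f has_vector_derivative f' x) (at x)" if "0 < x" "x < s" for x using assms(2) that by simp
    show "((*) K has_vector_derivative K) (at x)" for x
      by (auto intro!: derivative_eq_intros simp: has_real_derivative_iff_has_vector_derivative[symmetric])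
  qed (auto intro!: continuous_intros assms(3))
  then show ?thesis by (simp add: mult.commute)
qed

lemma eventually_hfilterE:
  assumes "\<forall>\<^sub>F y in hfilter x. P y" "open N" "(x, 0) \<in> N"
  obtains d where "0 < d" "\<And>x' h. dist x' x < d \<Longrightarrow> \<bar>h\<bar> < d \<Longrightarrow> (x', h) \<in> N"
    "\<And>x' h. dist x' x < d \<Longrightarrow> \<bar>h\<bar> < d \<Longrightarrow> h \<noteq> 0 \<Longrightarrow> P (x', h)"
proof -
  have "\<forall>\<^sub>F y in nhds (x, 0). (snd y \<noteq> 0 \<longrightarrow> P y) \<and> y \<in> N"
    using assms(1) eventually_nhds_in_open[OF assms(2,3)] unfolding hfilter_def eventually_at_filter
    by eventually_elim auto
  then obtain d where d: "0 < d" "\<And>y. dist y (x, 0) < d \<Longrightarrow> (snd y \<noteq> 0 \<longrightarrow> P y) \<and> y \<in> N"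
    unfolding eventually_nhds_metric by blast
  have "dist (x', h) (x, 0) < d" if "dist x' x < d / 2" "\<bar>h\<bar> < d / 2" for x' and h :: real
    using norm_Pair_le[of "x' - x" h] that by (simp add: dist_norm)
  note near = this
  show thesis
  proof (rule that[of "d / 2"])
    show "(x', h) \<in> N" if "dist x' x < d / 2" "\<bar>h\<bar> < d / 2" for x' h
      using d(2)[OF near[OF that]] by simp
    show "P (x', h)" if "dist x' x < d / 2" "\<bar>h\<bar> < d / 2" "h \<noteq> 0" for x' h
      using d(2)[OF near[OF that(1,2)]] that(3) by simp
  qed (use d(1) in simp)
qed

lemma eventually_hfilter_dist:
  assumes "0 < d" shows "\<forall>\<^sub>F y in hfilter x. dist (fst y) x < d \<and> \<bar>snd y\<bar> < d \<and> snd y \<noteq> 0"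
proof -
  have "\<forall>\<^sub>F y in hfilter x. y \<in> ball x d \<times> ball 0 d"
    using assms by (intro eventually_hfilter_in_open open_Times) auto
  then show ?thesis
    using eventually_hfilter_nonzero by eventually_elim (auto simp: dist_commute)
qed

text \<open>Integrating h^k (l + o(1)) from 0 gives h^(k+1) (l/(k+1) + o(1)). Instead of an
  integral, the mean value inequality is applied to g minus the antiderivative \<open>P\<close>,
  along s -> s h with s in [0, 1], which covers both signs of h.\<close>

lemma hlim_antiderivative:
  fixes g :: "'x :: real_normed_vector \<times> real \<Rightarrow> 'y :: real_normed_vector"
  assumes "open N" "(x, 0) \<in> N" "smooth_on N g" "\<And>x. g (x, 0) = 0"
    and lim: "hlim k (dir_deriv (0, 1) g) x l"
  shows "hlim (Suc k) g x (inverse (real (Suc k)) *\<^sub>R l)"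
proof -
  define P where "P h = (h ^ Suc k / real (Suc k)) *\<^sub>R l" for h
  have P: "(P has_vector_derivative h ^ k *\<^sub>R l) (at h)" for h
  proof -
    have "((\<lambda>h. h ^ Suc k / real (Suc k)) has_real_derivative h ^ k) (at h)"
      using DERIV_cdivide[OF DERIV_pow[of "Suc k" h], where c="real (Suc k)"] by simp
    then show ?thesis
      unfolding P_def has_real_derivative_iff_has_vector_derivative
      by (rule bounded_linear.has_vector_derivative[OF bounded_linear_scaleR_left])
  qed
  have "hlim (Suc k) (\<lambda>y. g y - P (snd y)) x 0"
  proof (rule hlim_small[where u="\<lambda>y. snd y ^ Suc k" and K=1])
    show "\<forall>\<^sub>F y in hfilter x. norm (inverse (snd y ^ Suc k) *\<^sub>R snd y ^ Suc k) \<le> 1"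
      using eventually_hfilter_nonzero by eventually_elim (auto simp: field_simps)
    fix \<epsilon> :: real assume \<epsilon>: "0 < \<epsilon>"
    let ?q = "\<lambda>y. inverse (snd y ^ k) *\<^sub>R dir_deriv (0, 1) g y"
    have ev: "\<forall>\<^sub>F y in hfilter x. dist (?q y) l < \<epsilon>"
      using tendstoD[OF lim[unfolded hlim_def] \<epsilon>] .
    obtain d where d: "0 < d" "\<And>x' h. dist x' x < d \<Longrightarrow> \<bar>h\<bar> < d \<Longrightarrow> (x', h) \<in> N"
      "\<And>x' h. dist x' x < d \<Longrightarrow> \<bar>h\<bar> < d \<Longrightarrow> h \<noteq> 0 \<Longrightarrow> dist (?q (x', h)) l < \<epsilon>"
      using eventually_hfilterE[OF ev assms(1,2)] by blast
    show "\<forall>\<^sub>F y in hfilter x. norm (g y - P (snd y)) \<le> \<epsilon> * norm (snd y ^ Suc k)"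
      using eventually_hfilter_dist[OF d(1)]
    proof eventually_elim
      case (elim y)
      obtain x' h where y: "y = (x', h)" by (cases y) auto
      have x': "dist x' x < d" and h: "\<bar>h\<bar> < d" "h \<noteq> 0" using elim y by auto
      have sh: "\<bar>s * h\<bar> < d" if "0 \<le> s" "s \<le> 1" for s
      proof -
        have "\<bar>s * h\<bar> \<le> \<bar>h\<bar>" using that by (simp add: abs_mult mult_left_le_one_le)
        then show ?thesis using h by simp
      qed
      have "norm ((g (x', 1 * h) - P (1 * h)) - (g (x', 0 * h) - P (0 * h))) \<le> 1 * (\<epsilon> * \<bar>h\<bar> ^ Suc k)"
      proof (rule norm_segment_bound)
        fix s :: real assume s: "0 \<le> s" "s \<le> 1"
        have "((\<lambda>t. g ((x', 0) + t *\<^sub>R (0, 1))) has_vector_derivative dir_deriv (0, 1) g ((x', 0) + (s * h) *\<^sub>R (0, 1))) (at (s * h))"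
          using d(2)[OF x' sh[OF s]] by (intro smooth_on_along_line[OF assms(3)]) simp
        then have D: "((\<lambda>t. g (x', t) - P t) has_vector_derivative dir_deriv (0, 1) g (x', s * h) - (s * h) ^ k *\<^sub>R l) (at (s * h))"
          by (intro has_vector_derivative_diff P) simp
        have "((\<lambda>s. s * h) has_vector_derivative h) (at s)"
          by (auto simp: has_real_derivative_iff_has_vector_derivative[symmetric] intro!: derivative_eq_intros)
        from vector_diff_chain_at[where f="\<lambda>s. s * h", OF this D]
        show "((\<lambda>s. g (x', s * h) - P (s * h)) has_vector_derivative
            h *\<^sub>R (dir_deriv (0, 1) g (x', s * h) - (s * h) ^ k *\<^sub>R l)) (at s)"
          by (simp add: o_def)
      next
        fix s :: real assume s: "0 < s" "s < 1"
        define v where "v = dir_deriv (0, 1) g (x', s * h)"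
        have "dist (inverse ((s * h) ^ k) *\<^sub>R v) l < \<epsilon>"
          using d(3)[OF x' sh, of s] s h by (simp add: v_def)
        moreover have "v - (s * h) ^ k *\<^sub>R l = (s * h) ^ k *\<^sub>R (inverse ((s * h) ^ k) *\<^sub>R v - l)"
          using s h by (simp add: scaleR_diff_right)
        ultimately have "norm (v - (s * h) ^ k *\<^sub>R l) \<le> \<bar>s * h\<bar> ^ k * \<epsilon>"
          by (simp add: dist_norm power_abs mult_left_mono)
        also have "\<dots> \<le> \<bar>h\<bar> ^ k * \<epsilon>"
          using s \<epsilon> by (intro mult_right_mono power_mono) (auto simp: abs_mult mult_left_le_one_le)
        finally have "\<bar>h\<bar> * norm (v - (s * h) ^ k *\<^sub>R l) \<le> \<bar>h\<bar> * (\<bar>h\<bar> ^ k * \<epsilon>)"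
          by (intro mult_left_mono) auto
        then show "norm (h *\<^sub>R (dir_deriv (0, 1) g (x', s * h) - (s * h) ^ k *\<^sub>R l)) \<le> \<epsilon> * \<bar>h\<bar> ^ Suc k"
          by (simp add: v_def mult_ac)
      qed simp
      then show ?case
        using assms(4) by (simp add: y P_def power_abs abs_mult)
    qed
  qed
  moreover have "hlim (Suc k) (\<lambda>y. P (snd y)) x (inverse (real (Suc k)) *\<^sub>R l)"
    unfolding hlim_def
  proof (rule tendsto_eventually)
    show "\<forall>\<^sub>F y in hfilter x. inverse (snd y ^ Suc k) *\<^sub>R P (snd y) = inverse (real (Suc k)) *\<^sub>R l"
      using eventually_hfilter_nonzero by eventually_elim (simp add: P_def field_simps)
  qed
  ultimately show ?thesis
    using hlim_add by fastforce
qed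

text \<open>Repeated integration in h, each step contributing one factor of the factorial. The lower
  coefficients must vanish at all x, since the integration starts at points (x', 0) near the given
  one.\<close>

lemma hlim_taylor:
  fixes g :: "'x :: real_normed_vector \<times> real \<Rightarrow> 'y :: real_normed_vector"
  assumes "open N" "(x, 0) \<in> N" "smooth_on N g" "\<And>i x. i < k \<Longrightarrow> (dir_deriv (0, 1) ^^ i) g (x, 0) = 0"
  shows "hlim k g x (inverse (fact k) *\<^sub>R (dir_deriv (0, 1) ^^ k) g (x, 0))"
  using assms(3,4)
proof (induction k arbitrary: g)
  case 0 then show ?case
    using isCont_tendsto_hfilter[OF smooth_on_isCont[OF _ assms(1,2)]] by (simp add: hlim_def)
next
  case (Suc k)
  have "hlim k (dir_deriv (0, 1) g) x (inverse (fact k) *\<^sub>R (dir_deriv (0, 1) ^^ k) (dir_deriv (0, 1) g) (x, 0))"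
    using Suc.prems(2)[of "Suc i" for i] by (intro Suc.IH smooth_on_dir_deriv Suc.prems(1)) (simp add: funpow_swap1)
  from hlim_antiderivative[OF assms(1,2) Suc.prems(1) _ this] show ?case
    using Suc.prems(2)[of 0] by (simp add: funpow_swap1)
qed

lemma filterlim_Pair_hfilter: "filterlim (\<lambda>h. (x, h)) (hfilter x) (at 0)"
  unfolding hfilter_def filterlim_at
  by (intro conjI tendsto_intros) (auto simp: eventually_at_filter)

text \<open>If \<open>e = h\<^sup>r \<delta>\<close> with \<open>\<delta>\<close> merely continuous, then \<open>e\<close> being smooth makes its space derivatives
  divisible by \<open>h\<^sup>r\<close> as well: were the Taylor coefficient of order \<open>k < r\<close> of a space derivative
  nonzero somewhere, integrating it along a short segment would contradict \<open>e = o(h\<^sup>k)\<close>.\<close>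

lemma hlim_space_derivative:
  fixes e :: "'x :: real_normed_vector \<times> real \<Rightarrow> 'y :: real_normed_vector"
  assumes "open N" "UNIV \<times> {0} \<subseteq> N" "smooth_on N e" "\<And>x. \<exists>l. hlim r e x l"
  shows "\<exists>l. hlim r (dir_deriv (v, 0) e) x l"
proof -
  define g where "g = dir_deriv (v, 0) e"
  have N: "(x, 0) \<in> N" for x using assms(2) by auto
  have g: "smooth_on N g" unfolding g_def by (rule smooth_on_dir_deriv) fact
  have "\<forall>i<k. \<forall>x. (dir_deriv (0, 1) ^^ i) g (x, 0) = 0" if "k \<le> r" for k
    using that
  proof (induction k)
    case (Suc k)
    have "(dir_deriv (0, 1) ^^ k) g (x, 0) = 0" for x
    proof -
      \<comment> \<open>The first Taylor coefficient of \<open>g\<close> in h not yet known to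
        vanish.\<close>
      define m where "m = inverse (fact k) *\<^sub>R (dir_deriv (0, 1) ^^ k) g (x, 0)"
      have lim: "hlim k g x m"
        unfolding m_def using Suc by (intro hlim_taylor[OF assms(1) N g]) auto
      have "norm m \<le> \<eta>" if \<eta>: "0 < \<eta>" for \<eta>
      proof -
        have ev: "\<forall>\<^sub>F y in hfilter x. dist (inverse (snd y ^ k) *\<^sub>R g y) m < \<eta>"
          using tendstoD[OF lim[unfolded hlim_def] \<eta>] .
        obtain d where d: "0 < d" "\<And>x' h. dist x' x < d \<Longrightarrow> \<bar>h\<bar> < d \<Longrightarrow> (x', h) \<in> N"
          "\<And>x' h. dist x' x < d \<Longrightarrow> \<bar>h\<bar> < d \<Longrightarrow> h \<noteq> 0 \<Longrightarrow> dist (inverse (snd (x', h) ^ k) *\<^sub>R g (x', h)) m < \<eta>"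
          using eventually_hfilterE[OF ev assms(1) N] by blast
        \<comment> \<open>Short enough for the segment from x to x + s v to stay in the ball; the
          summand 1 covers v = 0.\<close>
        define s where "s = d / (norm v + 1)"
        have nv: "0 < norm v + 1" by (simp add: add_nonneg_pos)
        have s: "0 < s" using d(1) nv by (simp add: s_def)
        have "s * norm v < s * (norm v + 1)" using s by simp
        also have "s * (norm v + 1) = d" using nv by (simp add: s_def)
        finally have sv: "s * norm v < d" .
        have near: "dist (x + u *\<^sub>R v) x < d" if "0 \<le> u" "u \<le> s" for u
          using mult_right_mono[OF that(2), of "norm v"] sv that(1) by (simp add: dist_norm)
        \<comment> \<open>By the mean value inequality along the segment \<open>?E h\<close> is
          bounded by s \<eta>. As k < r, both quotients of \<open>e\<close> tend to 0, so
          \<open>?E h\<close> tends to - s m, and the norm of m is at most \<eta>.\<close>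
        let ?E = "\<lambda>h. inverse (h ^ k) *\<^sub>R e (x + s *\<^sub>R v, h) - inverse (h ^ k) *\<^sub>R e (x, h) - s *\<^sub>R m"
        have bound: "norm (?E h) \<le> s * \<eta>" if h: "\<bar>h\<bar> < d" "h \<noteq> 0" for h
        proof -
          define f where "f u = inverse (h ^ k) *\<^sub>R e (x + u *\<^sub>R v, h) - u *\<^sub>R m" for u
          have "norm (f s - f 0) \<le> s * \<eta>"
          proof (rule norm_segment_bound[OF s])
            fix u :: real assume u: "0 \<le> u" "u \<le> s"
            have "((\<lambda>t. e ((x, h) + t *\<^sub>R (v, 0))) has_vector_derivative dir_deriv (v, 0) e ((x, h) + u *\<^sub>R (v, 0))) (at u)"
              using d(2)[OF near[OF u] h(1)] by (intro smooth_on_along_line[OF assms(3)]) simp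
            then have "((\<lambda>t. e (x + t *\<^sub>R v, h)) has_vector_derivative g (x + u *\<^sub>R v, h)) (at u)"
              by (simp add: g_def)
            then show "(f has_vector_derivative (inverse (h ^ k) *\<^sub>R g (x + u *\<^sub>R v, h) - m)) (at u)"
              unfolding f_def by (auto intro!: derivative_eq_intros)
          next
            fix u assume "0 < u" "u < s"
            then show "norm (inverse (h ^ k) *\<^sub>R g (x + u *\<^sub>R v, h) - m) \<le> \<eta>"
              using d(3)[OF near h, of u] by (simp add: dist_norm)
          qed
          then show ?thesis by (simp add: f_def algebra_simps)
        qed
        have lim0: "((\<lambda>h. inverse (h ^ k) *\<^sub>R e (x', h)) \<longlongrightarrow> 0) (at 0)" for x'
        proof -
          obtain l where "hlim r e x' l" using assms(4) by blast
          from hlim_mono[OF this, of k] have "hlim k e x' 0" using Suc.prems by (simp add: zero_power)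
          then show ?thesis
            unfolding hlim_def using filterlim_compose[OF _ filterlim_Pair_hfilter] by fastforce
        qed
        have "((\<lambda>h. norm (?E h)) \<longlongrightarrow> norm (0 - 0 - s *\<^sub>R m)) (at 0)"
          by (intro tendsto_intros lim0)
        moreover have "\<forall>\<^sub>F h in at 0. norm (?E h) \<le> s * \<eta>"
          unfolding eventually_at using d(1) bound by (intro exI[of _ d]) auto
        ultimately have "norm (0 - 0 - s *\<^sub>R m) \<le> s * \<eta>"
          by (rule tendsto_upperbound) simp
        then show ?thesis using s by simp
      qed
      then have "norm m \<le> 0" by - (rule field_le_epsilon, simp)
      then have "m = 0" by simp
      then show ?thesis by (simp add: m_def)
    qed
    with Suc show ?case by (auto simp: less_Suc_eq)
  qed simp
  then have "hlim r g x (inverse (fact r) *\<^sub>R (dir_deriv (0, 1) ^^ r) g (x, 0))"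
    by (intro hlim_taylor[OF assms(1) N g]) auto
  then show ?thesis unfolding g_def by blast
qed

section \<open>Quadrature with parameters\<close>

text \<open>The substitution t = s h works for either sign of h and for h = 0. It moves the
  parameter from the limits of the integral into the integrand.\<close>

lemma interval_integral_rescale:
  fixes f :: "real \<Rightarrow> real"
  assumes "continuous_on (closed_segment 0 h) f"
  shows "(LBINT t=ereal 0..ereal h. f t) = h * integral {0..1} (\<lambda>s. f (s * h))"
proof -
  have img: "(\<lambda>s. s * h) ` {0..1} = closed_segment 0 h"
    by (auto simp: closed_segment_def)
  have cont: "continuous_on {0..1} (\<lambda>s. f (s * h))"
    by (rule continuous_on_compose2[OF assms]) (auto simp: img[symmetric] intro!: continuous_intros)
  have "(LBINT t=ereal (0 * h)..ereal (1 * h). f t) = (LBINT s=ereal 0..ereal 1. h *\<^sub>R f (s * h))"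
    by (rule interval_integral_substitution_finite[symmetric])
      (use assms img in \<open>auto intro!: derivative_eq_intros continuous_intros\<close>)
  also have "\<dots> = integral {0..1} (\<lambda>s. h *\<^sub>R f (s * h))"
    by (rule interval_integral_eq_integral)
      (auto intro!: borel_integrable_atLeastAtMost' continuous_intros cont)
  finally show ?thesis by simp
qed

lemma smooth_on_power: "smooth_on UNIV (\<lambda>x :: real. x ^ k)"
proof (induction k)
  case (Suc k)
  then show ?case
    using bounded_bilinear.smooth_on[OF bounded_bilinear_mult open_UNIV smooth_on_bounded_linear[OF open_UNIV bounded_linear_ident]]
    by simp
qed (simp add: smooth_on_const)

lemma integral_power_unit: "integral {0..1} (\<lambda>s :: real. s ^ k) = 1 / (real k + 1)"
  using integral_unique[OF fundamental_theorem_of_calculus[of 0 1 "\<lambda>s. s ^ Suc k / real (Suc k)" "\<lambda>s. s ^ k"]]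
    DERIV_cdivide[OF DERIV_pow[of "Suc k"], where c="real (Suc k)"]
  by (simp add: has_real_derivative_iff_has_vector_derivative[symmetric] add.commute)

text \<open>For the monomial x^k the quadrature error is exactly h^(k+1) \<sigma> with \<sigma>
  independent of h. Divisibility by h^(a+1) yields \<sigma> = h^(a-k) \<delta>(h), which tends to 0.
  An asymptotic condition on one function at a time thus becomes a set of identities that can be
  used with parameters.\<close>

lemma quadrature_order_exact:
  assumes "quadrature_order n c w a" "k < a"
  shows "(\<Sum>j=0..n. w j * c j ^ k) = 1 / (real k + 1)"
proof -
  define \<sigma> where "\<sigma> = (\<Sum>j=0..n. w j * c j ^ k) - 1 / (real k + 1)"
  obtain U \<delta> where U: "open U" "0 \<in> U" "continuous_on U \<delta>"
    "\<And>h. h \<in> U \<Longrightarrow> (\<Sum>j=0..n. (h * w j) * (c j * h) ^ k) - (LBINT x=ereal 0..ereal h. x ^ k) = h ^ (a + 1) * \<delta> h"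
    using assms(1)[unfolded quadrature_order_def, rule_format, OF smooth_on_power[of k]] by blast
  have eq: "\<sigma> = h ^ (a - k) * \<delta> h" if h: "h \<in> U" "h \<noteq> 0" for h
  proof -
    have "(LBINT x=ereal 0..ereal h. x ^ k) = h * integral {0..1} (\<lambda>s. (s * h) ^ k)"
      by (intro interval_integral_rescale continuous_intros)
    also have "\<dots> = h ^ Suc k * (1 / (real k + 1))"
      by (simp add: power_mult_distrib integral_power_unit)
    finally have "h ^ Suc k * \<sigma> = h ^ (a + 1) * \<delta> h"
      using U(4)[OF h(1)] by (simp add: \<sigma>_def right_diff_distrib sum_distrib_left power_mult_distrib mult_ac)
    also have "h ^ (a + 1) = h ^ Suc k * h ^ (a - k)"
      using assms(2) by (simp add: power_add[symmetric])
    finally show ?thesis using h(2) by simp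
  qed
  have "((\<lambda>h. h ^ (a - k) * \<delta> h) \<longlongrightarrow> 0 ^ (a - k) * \<delta> 0) (at 0)"
    using U(1-3) continuous_on_eq_continuous_at isCont_def by (intro tendsto_intros) blast
  moreover have "\<forall>\<^sub>F h in at 0. h ^ (a - k) * \<delta> h = \<sigma>"
    using eventually_at_in_open[OF U(1,2)] by eventually_elim (use eq in auto)
  ultimately have "((\<lambda>_. \<sigma>) \<longlongrightarrow> 0) (at (0 :: real))"
    using assms(2) Lim_transform_eventually by (fastforce simp: zero_power)
  then have "\<sigma> = 0" by (simp add: tendsto_const_iff)
  then show ?thesis by (simp add: \<sigma>_def)
qed

text \<open>Taylor expansion of g in time about t = 0. The formula integrates the terms below degree
  a exactly. The coefficient of degree a is frozen at (x, 0, 0), so that it contributes the constant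
  \<open>L\<close>; continuity of the a-th derivative makes the rest o(h^(a+1)), uniformly in the
  parameters.\<close>

lemma quadrature_hcong:
  fixes g :: "'x :: real_normed_vector \<times> real \<times> real \<Rightarrow> real"
  assumes quad: "quadrature_order n c w a" and nodes: "\<forall>j\<le>n. 0 \<le> c j \<and> c j \<le> 1"
    and V: "open V" "smooth_on V g" "(x, 0, 0) \<in> V"
  shows "hcong (a + 1) x (\<lambda>y. \<Sum>j=0..n. (snd y * w j) * g (fst y, snd y, c j * snd y))
    (\<lambda>y. snd y * integral {0..1} (\<lambda>s. g (fst y, snd y, s * snd y)))"
proof -
  define G where "G k = (dir_deriv (0, 0, 1) ^^ k) g" for k
  have G: "smooth_on V (G k)" for k
    unfolding G_def by (rule smooth_on_dir_deriv_funpow) fact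
  define l where "l = G a (x, 0, 0) / fact a"
  define L where "L = l * ((\<Sum>j=0..n. w j * c j ^ a) - 1 / (real a + 1))"
  \<comment> \<open>Bounds quadrature sum and integral together: the weights contribute the sum of
    their absolute values, the unit interval contributes 1.\<close>
  define K where "K = (\<Sum>j=0..n. \<bar>w j\<bar>) + 1"
  have K: "0 < K" unfolding K_def by (intro add_nonneg_pos sum_nonneg) auto
  let ?d = "\<lambda>y. (\<Sum>j=0..n. (snd y * w j) * g (fst y, snd y, c j * snd y)) -
    snd y * integral {0..1} (\<lambda>s. g (fst y, snd y, s * snd y))"
  have "hlim (a + 1) (\<lambda>y. ?d y - snd y ^ (a + 1) * L) x 0"
  proof (rule hlim_small[where u="\<lambda>y. snd y ^ (a + 1)" and K=1])
    show "\<forall>\<^sub>F y in hfilter x. norm (inverse (snd y ^ (a + 1)) *\<^sub>R snd y ^ (a + 1)) \<le> 1"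
      using eventually_hfilter_nonzero by eventually_elim (auto simp: field_simps)
    fix \<epsilon> :: real assume \<epsilon>: "0 < \<epsilon>"
    define \<eta> where "\<eta> = \<epsilon> / K"
    have \<eta>: "0 < \<eta>" using \<epsilon> K by (simp add: \<eta>_def)
    have "(G a \<longlongrightarrow> G a (x, 0, 0)) (nhds (x, 0, 0))"
      using smooth_on_isCont[OF G V(1,3)] by (simp add: isCont_def tendsto_at_iff_tendsto_nhds)
    then have "\<forall>\<^sub>F z in nhds (x, 0, 0). dist (G a z) (G a (x, 0, 0)) < \<eta> \<and> z \<in> V"
      using tendstoD[OF _ \<eta>] eventually_nhds_in_open[OF V(1,3)] by (intro eventually_conj) auto
    then obtain d where d: "0 < d" "\<And>z. dist z (x, 0, 0) < d \<Longrightarrow> dist (G a z) (G a (x, 0, 0)) < \<eta> \<and> z \<in> V"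
      unfolding eventually_nhds_metric by blast
    \<comment> \<open>One third for each of the components x, h and t.\<close>
    have "0 < d / 3" using d(1) by simp
    from eventually_hfilter_dist[OF this, of x]
    show "\<forall>\<^sub>F y in hfilter x. norm (?d y - snd y ^ (a + 1) * L) \<le> \<epsilon> * norm (snd y ^ (a + 1))"
    proof eventually_elim
      case (elim y)
      obtain x' h where y: "y = (x', h)" by (cases y) auto
      have near: "dist (x', h, t) (x, 0, 0) < d" if "\<bar>t\<bar> \<le> \<bar>h\<bar>" for t
        using norm_Pair_le[of "x' - x" "(h, t)"] norm_Pair_le[of h t] elim that by (simp add: dist_norm y)
      define f where "f s = g (x', h, s * h)" for s
      define A where "A m = G m (x', h, 0) / fact m" for m
      define P where "P s = (\<Sum>m<a. (A m * h ^ m) * s ^ m) + (l * h ^ a) * s ^ a" for s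
      have sh: "\<bar>s * h\<bar> \<le> \<bar>h\<bar>" if "0 \<le> s" "s \<le> 1" for s
        using that by (simp add: abs_mult mult_left_le_one_le)
      have rem: "\<bar>f s - P s\<bar> \<le> \<eta> * \<bar>h\<bar> ^ a" if s: "0 \<le> s" "s \<le> 1" for s
      proof -
        have "\<exists>\<xi>. \<bar>\<xi>\<bar> \<le> \<bar>s * h\<bar> \<and> g (x', h, s * h) =
          (\<Sum>m<a. G m (x', h, 0) / fact m * (s * h) ^ m) + G a (x', h, \<xi>) / fact a * (s * h) ^ a"
        proof (rule Maclaurin_bi_le[where diff="\<lambda>m t. G m (x', h, t)"], simp add: G_def, intro allI impI)
          fix m t assume "m < a \<and> \<bar>t\<bar> \<le> \<bar>s * h\<bar>"
          then have "(x', h, t) \<in> V" using d(2)[OF near, of t] sh[OF s] by simp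
          then show "DERIV (\<lambda>t. G m (x', h, t)) t :> G (Suc m) (x', h, t)"
            using smooth_on_along_line[OF G, of "(x', h, 0)" t "(0, 0, 1)" m]
            by (simp add: has_real_derivative_iff_has_vector_derivative) (simp add: G_def)
        qed
        then obtain \<xi> where \<xi>: "\<bar>\<xi>\<bar> \<le> \<bar>s * h\<bar>" and eq: "g (x', h, s * h) =
          (\<Sum>m<a. G m (x', h, 0) / fact m * (s * h) ^ m) + G a (x', h, \<xi>) / fact a * (s * h) ^ a"
          by blast
        have "f s - P s = (G a (x', h, \<xi>) - G a (x, 0, 0)) / fact a * (s * h) ^ a"
          unfolding f_def P_def eq A_def l_def
          by (simp add: power_mult_distrib diff_divide_distrib algebra_simps)
        then have "\<bar>f s - P s\<bar> = \<bar>G a (x', h, \<xi>) - G a (x, 0, 0)\<bar> / fact a * \<bar>s * h\<bar> ^ a"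
          by (simp add: abs_mult power_abs)
        also have "\<dots> \<le> \<eta> * \<bar>h\<bar> ^ a"
        proof (intro mult_mono power_mono)
          have "\<bar>G a (x', h, \<xi>) - G a (x, 0, 0)\<bar> < \<eta>"
            using d(2)[OF near, of \<xi>] \<xi> sh[OF s] by (simp add: dist_norm)
          moreover have "\<bar>G a (x', h, \<xi>) - G a (x, 0, 0)\<bar> / fact a \<le> \<bar>G a (x', h, \<xi>) - G a (x, 0, 0)\<bar> / 1"
            by (intro divide_left_mono) auto
          ultimately show "\<bar>G a (x', h, \<xi>) - G a (x, 0, 0)\<bar> / fact a \<le> \<eta>" by simp
        qed (use \<eta> sh[OF s] in auto)
        finally show ?thesis .
      qed
      have contf: "continuous_on {0..1} f"
        unfolding f_def
      proof (rule continuous_on_compose2[OF smooth_on_imp_continuous_on[OF V(2)]])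
        show "(\<lambda>s. (x', h, s * h)) ` {0..1} \<subseteq> V" using d(2)[OF near] sh by auto
      qed (intro continuous_intros)
      have contP: "continuous_on {0..1} P" unfolding P_def by (intro continuous_intros)
      have "integral {0..1} P = (\<Sum>m<a. (A m * h ^ m) * (1 / (real m + 1))) + (l * h ^ a) * (1 / (real a + 1))"
      proof -
        have "integral {0..1} P = integral {0..1} (\<lambda>s. \<Sum>m<a. (A m * h ^ m) * s ^ m) + integral {0..1} (\<lambda>s. (l * h ^ a) * s ^ a)"
          unfolding P_def by (intro integral_add integrable_continuous_interval continuous_intros)
        also have "integral {0..1} (\<lambda>s. \<Sum>m<a. (A m * h ^ m) * s ^ m) = (\<Sum>m<a. integral {0..1} (\<lambda>s. (A m * h ^ m) * s ^ m))"
          by (intro integral_sum integrable_continuous_interval continuous_intros) auto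
        finally show ?thesis by (simp add: integral_power_unit)
      qed
      moreover have "(\<Sum>j=0..n. w j * P (c j)) = (\<Sum>m<a. (A m * h ^ m) * (\<Sum>j=0..n. w j * c j ^ m)) + (l * h ^ a) * (\<Sum>j=0..n. w j * c j ^ a)"
        unfolding P_def by (simp add: distrib_left sum.distrib sum_distrib_left sum.swap[of _ "{0..n}"] mult_ac)
      ultimately have P: "(\<Sum>j=0..n. w j * P (c j)) - integral {0..1} P = h ^ a * L"
        using quadrature_order_exact[OF quad] by (simp add: L_def algebra_simps)
      have "?d y - h ^ (a + 1) * L = h * ((\<Sum>j=0..n. w j * f (c j)) - integral {0..1} f - h ^ a * L)"
        by (simp add: y f_def[abs_def] right_diff_distrib sum_distrib_left mult_ac)
      also have "(\<Sum>j=0..n. w j * f (c j)) - integral {0..1} f - h ^ a * L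
        = (\<Sum>j=0..n. w j * (f (c j) - P (c j))) - integral {0..1} (\<lambda>s. f s - P s)"
        unfolding P[symmetric] using contf contP
        by (simp add: right_diff_distrib sum_subtractf integral_diff integrable_continuous_interval)
      finally have "\<bar>?d y - h ^ (a + 1) * L\<bar> = \<bar>h\<bar> * \<bar>(\<Sum>j=0..n. w j * (f (c j) - P (c j))) - integral {0..1} (\<lambda>s. f s - P s)\<bar>"
        by (simp add: abs_mult)
      also have "\<dots> \<le> \<bar>h\<bar> * ((\<Sum>j=0..n. \<bar>w j\<bar>) * (\<eta> * \<bar>h\<bar> ^ a) + \<eta> * \<bar>h\<bar> ^ a)"
      proof (intro mult_left_mono order_trans[OF abs_triangle_ineq4] add_mono)
        show "\<bar>\<Sum>j=0..n. w j * (f (c j) - P (c j))\<bar> \<le> (\<Sum>j=0..n. \<bar>w j\<bar>) * (\<eta> * \<bar>h\<bar> ^ a)"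
          unfolding sum_distrib_right using nodes rem
          by (intro order_trans[OF sum_abs] sum_mono) (auto simp: abs_mult intro!: mult_left_mono)
        have "norm (integral {0..1} (\<lambda>s. f s - P s)) \<le> \<eta> * \<bar>h\<bar> ^ a * (1 - 0)"
          using rem by (intro integral_bound continuous_intros contf contP) auto
        then show "\<bar>integral {0..1} (\<lambda>s. f s - P s)\<bar> \<le> \<eta> * \<bar>h\<bar> ^ a" by simp
      qed auto
      also have "\<dots> = K * \<eta> * \<bar>h\<bar> ^ (a + 1)" by (simp add: K_def algebra_simps)
      also have "K * \<eta> = \<epsilon>" using K by (simp add: \<eta>_def)
      finally show ?case by (simp add: y power_abs abs_mult)
    qed
  qed
  moreover have "hlim (a + 1) (\<lambda>y. snd y ^ (a + 1) * L) x L"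
    unfolding hlim_def
    by (rule tendsto_eventually) (rule eventually_mono[OF eventually_hfilter_nonzero], simp add: field_simps)
  ultimately have "hlim (a + 1) (\<lambda>y. ?d y - snd y ^ (a + 1) * L + snd y ^ (a + 1) * L) x (0 + L)"
    by (rule hlim_add)
  then show ?thesis unfolding hcong_def by auto
qed

section \<open>Derivatives at moving points, and linear maps near the identity\<close>

lemma hcong_derivative_apply:
  fixes \<Psi> :: "'y :: fin_dim \<Rightarrow> 'z :: real_normed_vector"
  assumes "open S" "smooth_on S \<Psi>" "y0 \<in> S"
    and "(f \<longlongrightarrow> y0) (hfilter x)" "(g \<longlongrightarrow> y0) (hfilter x)" "hcong r x f g"
    and "(v' \<longlongrightarrow> v0) (hfilter x)" "hcong r x v v'"
  shows "hcong r x (\<lambda>y. frechet_derivative \<Psi> (at (f y)) (v y)) (\<lambda>y. frechet_derivative \<Psi> (at (g y)) (v' y))"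
proof -
  obtain B and c :: "'y \<Rightarrow> 'y \<Rightarrow> real" where B: "finite B" "\<And>b. bounded_linear (c b)" "\<And>x. (\<Sum>b\<in>B. c b x *\<^sub>R b) = x"
    using fin_dim_coordsE by blast
  let ?D = "\<lambda>y. frechet_derivative \<Psi> (at y)"
  \<comment> \<open>The direction moves along with the base point; in coordinates it turns into
    scalar factors of derivatives in fixed directions.\<close>
  have exp: "?D y u = (\<Sum>b\<in>B. c b u *\<^sub>R ?D y b)" if "y \<in> S" for y u
    by (rule linear_fin_dim_expand[OF has_derivative_linear[OF smooth_on_differentiable[OF assms(2) that]] B(3)])
  have D: "smooth_on S (\<lambda>y. ?D y b)" for b using smooth_on_frechet_derivative[OF assms(2)] .
  have tD: "((\<lambda>y. ?D (f y) b) \<longlongrightarrow> ?D y0 b) (hfilter x)" for b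
    by (rule isCont_tendsto_compose[OF smooth_on_isCont[OF D assms(1,3)] assms(4)])
  have comm: "bounded_bilinear (\<lambda>(u :: 'z) (t :: real). t *\<^sub>R u)"
    by (rule bounded_bilinear.flip[OF bounded_bilinear_scaleR])
  have "hcong r x (\<lambda>y. \<Sum>b\<in>B. c b (v y) *\<^sub>R ?D (f y) b) (\<lambda>y. \<Sum>b\<in>B. c b (v' y) *\<^sub>R ?D (g y) b)"
  proof (rule hcong_sum)
    fix b
    show "hcong r x (\<lambda>y. c b (v y) *\<^sub>R ?D (f y) b) (\<lambda>y. c b (v' y) *\<^sub>R ?D (g y) b)"
      by (rule bounded_bilinear.hcong[OF comm hcong_compose[OF assms(1) D assms(3-6)]
            hcong_bounded_linear[OF B(2) assms(8)] tD bounded_linear.tendsto[OF B(2) assms(7)]])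
  qed
  moreover have "\<forall>\<^sub>F y in hfilter x. (\<Sum>b\<in>B. c b (v y) *\<^sub>R ?D (f y) b) = ?D (f y) (v y)"
    using topological_tendstoD[OF assms(4) assms(1,3)] by (rule eventually_mono) (rule exp[symmetric])
  moreover have "\<forall>\<^sub>F y in hfilter x. (\<Sum>b\<in>B. c b (v' y) *\<^sub>R ?D (g y) b) = ?D (g y) (v' y)"
    using topological_tendstoD[OF assms(5) assms(1,3)] by (rule eventually_mono) (rule exp[symmetric])
  ultimately show ?thesis by (rule hcong_cong)
qed

lemma isCont_eventually_eq:
  assumes "isCont f x" "\<forall>\<^sub>F y in nhds x. g y = f y" shows "isCont g x"
  using isCont_cong[OF assms(2)] assms(1) by simp

lemma isCont_blinfunI:
  fixes A :: "'z :: t2_space \<Rightarrow> 'a :: fin_dim \<Rightarrow>\<^sub>L 'b :: fin_dim"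
  assumes "\<And>v. isCont (\<lambda>y. blinfun_apply (A y) v) y" shows "isCont A y"
  using assms unfolding isCont_def by (rule tendsto_blinfunI)

text \<open>A solution of A u = v is a fixed point of u -> v - (A u - u), a contraction with
  constant 1/2. The triangle inequality gives injectivity and the bound 2 for the inverse.\<close>

lemma near_identity_inverse:
  fixes A :: "'a :: banach \<Rightarrow> 'a"
  assumes A: "bounded_linear A" "\<And>u. norm (A u - u) \<le> 1 / 2 * norm u"
  obtains B where "bounded_linear B" "\<And>v. A (B v) = v" "\<And>u. B (A u) = u" "\<And>u. norm u \<le> 2 * norm (A u)"
proof -
  interpret A: bounded_linear A by fact
  have lower: "norm u \<le> 2 * norm (A u)" for u
    using norm_triangle_ineq2[of u "A u"] A(2)[of u] by (simp add: norm_minus_commute)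
  have "\<exists>!u. v - (A u - u) = u" for v
  proof (rule banach_fix_type[of "1 / 2"])
    show "\<forall>x y. dist (v - (A x - x)) (v - (A y - y)) \<le> 1 / 2 * dist x y"
      using A(2)[of "y - x" for x y] by (auto simp: dist_norm A.diff algebra_simps norm_minus_commute)
  qed auto
  then have "\<exists>u. A u = v" for v by (metis add_diff_cancel_left' diff_add_cancel diff_diff_eq2)
  then obtain B where B: "\<And>v. A (B v) = v" by metis
  have inj: "u = v" if "A u = A v" for u v
    using lower[of "u - v"] that by (simp add: A.diff)
  have "bounded_linear B"
  proof (rule bounded_linear_intro[where K=2])
    show "B (x + y) = B x + B y" for x y by (rule inj) (simp add: B A.add)
    show "B (r *\<^sub>R x) = r *\<^sub>R B x" for r x by (rule inj) (simp add: B A.scale)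
    show "norm (B x) \<le> norm x * 2" for x using lower[of "B x"] by (simp add: B)
  qed
  with B inj lower show thesis by (intro that) auto
qed

section \<open>Uniqueness for ordinary differential equations\<close>

text \<open>Strict differentiability with error 1 bounds difference quotients near y by 1 +
  \<open>onorm ?D\<close>. The time set is a single point because the field is autonomous.\<close>

lemma smooth_local_lipschitz:
  fixes X :: "'a :: fin_dim \<Rightarrow> 'b :: real_normed_vector"
  assumes "smooth_on UNIV X"
  shows "local_lipschitz {0 :: real} Y (\<lambda>_. X)"
  unfolding local_lipschitz_def
proof (intro ballI)
  fix y and t :: real assume "y \<in> Y"
  let ?D = "frechet_derivative X (at y)"
  have D: "bounded_linear ?D"
    using smooth_on_differentiable[OF assms] by (auto intro: has_derivative_bounded_linear)
  obtain d where d: "0 < d" "\<And>u z. u \<in> ball y d \<Longrightarrow> z \<in> ball y d \<Longrightarrow> norm (X u - X z - ?D (u - z)) \<le> 1 * norm (u - z)"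
    using smooth_on_strict[OF open_UNIV assms, of y 1] by auto
  have "(1 + onorm ?D)-lipschitz_on (cball y (d / 2) \<inter> Y) X"
  proof (rule lipschitz_onI)
    fix u z assume "u \<in> cball y (d / 2) \<inter> Y" "z \<in> cball y (d / 2) \<inter> Y"
    then have "norm (X u - X z - ?D (u - z)) \<le> 1 * norm (u - z)" using d by (intro d(2)) auto
    then show "dist (X u) (X z) \<le> (1 + onorm ?D) * dist u z"
      using norm_triangle_ineq[of "X u - X z - ?D (u - z)" "?D (u - z)"] onorm[OF D, of "u - z"]
      by (simp add: dist_norm distrib_right)
  qed (use onorm_pos_le[OF D] in simp)
  then show "\<exists>u>0. \<exists>L. \<forall>t\<in>cball t u \<inter> {0}. L-lipschitz_on (cball y u \<inter> Y) X"
    using d(1) by (intro exI[of _ "d / 2"]) auto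
qed

text \<open>Gronwall's inequality is replaced by maximizing \<open>exp (-2Ks) * norm (\<alpha> s - \<beta> s)\<close>, with
  \<open>K\<close> a Lipschitz constant along the two solutions: at the maximum the mean value inequality
  bounds the norm by half of itself.\<close>

lemma ode_unique_unit:
  fixes X :: "'a :: fin_dim \<Rightarrow> 'a"
  assumes X: "smooth_on UNIV X"
    and \<alpha>: "\<And>s. s \<in> {0..1} \<Longrightarrow> (\<alpha> has_vector_derivative h *\<^sub>R X (\<alpha> s)) (at s within {0..1})"
    and \<beta>: "\<And>s. s \<in> {0..1} \<Longrightarrow> (\<beta> has_vector_derivative h *\<^sub>R X (\<beta> s)) (at s within {0..1})"
    and "\<alpha> 0 = \<beta> 0" "s \<in> {0..1 :: real}"
  shows "\<alpha> s = \<beta> s"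
proof -
  have cont: "continuous_on {0..1} \<alpha>" "continuous_on {0..1} \<beta>"
    unfolding continuous_on_eq_continuous_within
    using has_vector_derivative_continuous[OF \<alpha>] has_vector_derivative_continuous[OF \<beta>] by blast+
  define Y where "Y = \<alpha> ` {0..1} \<union> \<beta> ` {0..1}"
  have "compact Y" unfolding Y_def by (intro compact_Un compact_continuous_image cont compact_Icc)
  then obtain L where L: "L-lipschitz_on Y X"
    using local_lipschitz_compact_implies_lipschitz[OF smooth_local_lipschitz[OF X], of Y] by auto
  \<comment> \<open>The summand 1 makes K positive even if h or L is 0.\<close>
  define K where "K = \<bar>h\<bar> * L + 1"
  have L0: "0 \<le> L" using lipschitz_on_nonneg[OF L] .
  have K: "0 < K" using L0 by (simp add: K_def add_nonneg_pos)
  define d where "d s = \<alpha> s - \<beta> s" for s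
  define N where "N s = exp (- (2 * K * s)) * norm (d s)" for s
  have contd: "continuous_on {0..1} d" unfolding d_def by (intro continuous_intros cont)
  have "continuous_on {0..1} N" unfolding N_def by (intro continuous_intros contd)
  then obtain s0 where s0: "s0 \<in> {0..1}" "\<And>s. s \<in> {0..1} \<Longrightarrow> N s \<le> N s0"
    using continuous_attains_sup[of "{0..1}" N] by auto
  define m where "m = N s0"
  have m: "norm (d s) \<le> m * exp (2 * K * s)" if "s \<in> {0..1}" for s
  proof -
    have "norm (d s) = N s * exp (2 * K * s)" by (simp add: N_def exp_minus)
    also have "\<dots> \<le> m * exp (2 * K * s)" unfolding m_def by (intro mult_right_mono s0(2) that) auto
    finally show ?thesis .
  qed
  have ms0: "norm (d s0) = m * exp (2 * K * s0)" by (simp add: m_def N_def exp_minus)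
  have "norm (d s0) \<le> norm (d s0) / 2"
  proof (cases "s0 = 0")
    case True then show ?thesis using assms(4) by (simp add: d_def)
  next
    case False
    \<comment> \<open>Thanks to the 2 in the exponent the comparison function has derivative K m
      exp(2Ks), which dominates the derivative of d. Its increment up to s0 is at most half of m
      exp(2K s0), that is, of \<open>norm (d s0)\<close>.\<close>
    have "norm (d s0 - d 0) \<le> m / 2 * exp (2 * K * s0) - m / 2 * exp (2 * K * 0)"
    proof (rule differentiable_bound_general)
      show "0 < s0" using False s0(1) by simp
      show "continuous_on {0..s0} d" using contd s0(1) by (auto intro: continuous_on_subset)
      show "continuous_on {0..s0} (\<lambda>s. m / 2 * exp (2 * K * s))" by (intro continuous_intros)
      fix s assume s: "0 < s" "s < s0"
      then have s': "s \<in> {0..1}" "at s within {0..1} = at s" using s0(1) by (auto simp: at_within_Icc_at)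
      show "(d has_vector_derivative h *\<^sub>R (X (\<alpha> s) - X (\<beta> s))) (at s)"
        using has_vector_derivative_diff[OF \<alpha>[OF s'(1)] \<beta>[OF s'(1)]] s'(2)
        unfolding d_def by (simp add: scaleR_diff_right)
      show "((\<lambda>s. m / 2 * exp (2 * K * s)) has_vector_derivative K * (m * exp (2 * K * s))) (at s)"
        unfolding has_real_derivative_iff_has_vector_derivative[symmetric]
        by (auto intro!: derivative_eq_intros)
      have "norm (X (\<alpha> s) - X (\<beta> s)) \<le> L * norm (d s)"
        using lipschitz_onD[OF L, of "\<alpha> s" "\<beta> s"] s'(1) by (simp add: Y_def dist_norm d_def)
      then have "norm (h *\<^sub>R (X (\<alpha> s) - X (\<beta> s))) \<le> \<bar>h\<bar> * (L * norm (d s))"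
        by (simp add: mult_left_mono)
      also have "\<dots> \<le> K * norm (d s)" by (simp add: K_def distrib_right)
      also have "\<dots> \<le> K * (m * exp (2 * K * s))" using m[OF s'(1)] K by (intro mult_left_mono) auto
      finally show "norm (h *\<^sub>R (X (\<alpha> s) - X (\<beta> s))) \<le> K * (m * exp (2 * K * s))" .
    qed
    moreover have "0 \<le> m" by (simp add: m_def N_def)
    moreover have "d 0 = 0" using assms(4) by (simp add: d_def)
    ultimately show ?thesis using ms0 by simp
  qed
  then have "norm (d s0) = 0" by simp
  then have "m = 0" using ms0 by simp
  then show ?thesis using m[OF assms(5)] by (simp add: d_def)
qed

text \<open>The time change t = s h puts solutions for positive and negative h on the same
  interval.\<close>

lemma rescaled_solution:
  assumes "\<And>t. t \<in> closed_segment 0 h \<Longrightarrow> (\<gamma> has_vector_derivative \<gamma>' t) (at t within closed_segment 0 h)" "s \<in> {0..1}"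
  shows "((\<lambda>s. \<gamma> (s * h)) has_vector_derivative h *\<^sub>R \<gamma>' (s * h)) (at s within {0..1 :: real})"
proof -
  have img: "(\<lambda>s. s * h) ` {0..1} = closed_segment 0 h" by (auto simp: closed_segment_def)
  have "((\<lambda>s. s * h) has_vector_derivative h) (at s within {0..1})"
    by (auto simp: has_real_derivative_iff_has_vector_derivative[symmetric] intro!: derivative_eq_intros)
  moreover have "(\<gamma> has_vector_derivative \<gamma>' (s * h)) (at (s * h) within (\<lambda>s. s * h) ` {0..1})"
    unfolding img by (rule assms(1)) (use assms(2) img in blast)
  ultimately show ?thesis
    using vector_diff_chain_within[where f="\<lambda>s. s * h" and g=\<gamma>] by (simp add: o_def)
qed

lemma ode_unique:
  fixes X :: "'a :: fin_dim \<Rightarrow> 'a"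
  assumes "smooth_on UNIV X"
    and "\<And>t. t \<in> closed_segment 0 h \<Longrightarrow> (\<gamma> has_vector_derivative X (\<gamma> t)) (at t within closed_segment 0 h)"
    and "\<And>t. t \<in> closed_segment 0 h \<Longrightarrow> (\<gamma>' has_vector_derivative X (\<gamma>' t)) (at t within closed_segment 0 h)"
    and "\<gamma> 0 = \<gamma>' 0" "t \<in> closed_segment 0 h"
  shows "\<gamma> t = \<gamma>' t"
proof -
  obtain s where s: "t = s * h" "s \<in> {0..1}" using assms(5) by (auto simp: closed_segment_def)
  show ?thesis
    unfolding s(1)
    by (rule ode_unique_unit[OF assms(1) rescaled_solution[OF assms(2)] rescaled_solution[OF assms(3)]])
      (use assms(4) s(2) in auto)
qed

section \<open>The Hamiltonian vector field\<close>

definition ham_field :: "('q::euclidean_space cotangent \<Rightarrow> real) \<Rightarrow> ('q cotangent \<Rightarrow> ('q cotangent \<Rightarrow>\<^sub>L real)) \<Rightarrow>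
    'q cotangent \<Rightarrow> 'q cotangent" where
  "ham_field H \<phi> z = (D2 H z, - D1 H z + base_force \<phi> z)"

lemma trajectory_iff:
  "trajectory H \<phi> h \<gamma> \<longleftrightarrow> (\<forall>t\<in>closed_segment 0 h.
     (\<gamma> has_vector_derivative ham_field H \<phi> (\<gamma> t)) (at t within closed_segment 0 h))"
  by (simp add: trajectory_def ham_field_def)

lemma dual_expand:
  fixes \<pi> :: "'q :: euclidean_space \<Rightarrow>\<^sub>L real"
  shows "(\<Sum>e\<in>Basis. blinfun_apply \<pi> e *\<^sub>R blinfun_inner_left e) = \<pi>"
proof (rule blinfun_eqI)
  fix v
  have "blinfun_apply \<pi> v = (\<Sum>e\<in>Basis. (v \<bullet> e) *\<^sub>R blinfun_apply \<pi> e)"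
    by (rule linear_fin_dim_expand[OF bounded_linear.linear[OF blinfun.bounded_linear_right] euclidean_representation])
  then show "blinfun_apply (\<Sum>e\<in>Basis. blinfun_apply \<pi> e *\<^sub>R blinfun_inner_left e) v = blinfun_apply \<pi> v"
    by (simp add: blinfun.sum_left blinfun.scaleR_left mult.commute)
qed

text \<open>As a finite combination of derivatives of H in fixed directions, \<open>D1 H\<close>
  inherits smoothness from H. Scalar products with the basis vectors serve as dual basis.\<close>

lemma D1_eq:
  assumes "(H has_derivative D) (at z)"
  shows "D1 H z = (\<Sum>e\<in>Basis. D (e, 0) *\<^sub>R blinfun_inner_left e)"
proof -
  have "((\<lambda>q. H (q, snd z)) has_derivative (\<lambda>v. D (v, 0))) (at (fst z))"
    by (rule has_derivative_compose[where f="\<lambda>q. (q, snd z)" and g=H]) (auto intro!: derivative_eq_intros assms)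
  from frechet_derivative_at[OF this] have eq: "D1 H z = Blinfun (\<lambda>v. D (v, 0))" by (simp add: D1_def)
  have "bounded_linear (\<lambda>v. D (v, 0))"
    using bounded_linear_compose[OF has_derivative_bounded_linear[OF assms] bounded_linear_Pair_0(1)] .
  then have "blinfun_apply (D1 H z) v = D (v, 0)" for v
    by (simp add: eq bounded_linear_Blinfun_apply)
  then show ?thesis using dual_expand[of "D1 H z"] by simp
qed

text \<open>The description in \<open>D2\<close> has a solution because in finite dimension every
  functional on the dual space is evaluation at a vector, and only one because the coordinate
  functionals separate vectors.\<close>

lemma D2_eq:
  assumes "(H has_derivative D) (at z)"
  shows "D2 H z = (\<Sum>e\<in>Basis. D (0, blinfun_inner_left e) *\<^sub>R e)"
proof -
  have "((\<lambda>p. H (fst z, p)) has_derivative (\<lambda>v. D (0, v))) (at (snd z))"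
    by (rule has_derivative_compose[where f="\<lambda>p. (fst z, p)" and g=H]) (auto intro!: derivative_eq_intros assms)
  from frechet_derivative_at[OF this] have eq: "frechet_derivative (\<lambda>p. H (fst z, p)) (at (snd z)) = (\<lambda>v. D (0, v))" by simp
  have lin: "linear (\<lambda>v. D (0, v))"
    using bounded_linear_compose[OF has_derivative_bounded_linear[OF assms] bounded_linear_Pair_0(2)]
    by (rule bounded_linear.linear)
  show ?thesis
    unfolding D2_def eq
  proof (rule the_equality)
    show "\<forall>\<pi>. D (0, \<pi>) = blinfun_apply \<pi> (\<Sum>e\<in>Basis. D (0, blinfun_inner_left e) *\<^sub>R e)"
    proof
      fix \<pi> :: "'a \<Rightarrow>\<^sub>L real"
      have "D (0, \<pi>) = (\<Sum>e\<in>Basis. blinfun_apply \<pi> e *\<^sub>R D (0, blinfun_inner_left e))"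
        by (subst dual_expand[symmetric]) (simp only: linear_sum[OF lin] linear_scale[OF lin])
      then show "D (0, \<pi>) = blinfun_apply \<pi> (\<Sum>e\<in>Basis. D (0, blinfun_inner_left e) *\<^sub>R e)"
        by (simp add: blinfun.sum_right blinfun.scaleR_right mult.commute)
    qed
    fix v assume v: "\<forall>\<pi>. D (0, \<pi>) = blinfun_apply \<pi> v"
    have "v = (\<Sum>e\<in>Basis. (v \<bullet> e) *\<^sub>R e)" by (simp add: euclidean_representation)
    also have "\<dots> = (\<Sum>e\<in>Basis. D (0, blinfun_inner_left e) *\<^sub>R e)" using v by simp
    finally show "v = (\<Sum>e\<in>Basis. D (0, blinfun_inner_left e) *\<^sub>R e)" .
  qed
qed

lemma smooth_on_D1:
  assumes "smooth_on UNIV H" shows "smooth_on UNIV (D1 H)"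
proof -
  have "smooth_on UNIV (\<lambda>z. \<Sum>e\<in>Basis. frechet_derivative H (at z) (e, 0) *\<^sub>R blinfun_inner_left e)"
    by (intro smooth_on_sum open_UNIV smooth_on_bounded_linear_compose[OF open_UNIV bounded_linear_scaleR_left]
        smooth_on_frechet_derivative assms)
  moreover have "D1 H = (\<lambda>z. \<Sum>e\<in>Basis. frechet_derivative H (at z) (e, 0) *\<^sub>R blinfun_inner_left e)"
    by (rule ext, rule D1_eq, rule smooth_on_differentiable[OF assms UNIV_I])
  ultimately show ?thesis by simp
qed

lemma smooth_on_D2:
  assumes "smooth_on UNIV H" shows "smooth_on UNIV (D2 H)"
proof -
  have "smooth_on UNIV (\<lambda>z. \<Sum>e\<in>Basis. frechet_derivative H (at z) (0, blinfun_inner_left e) *\<^sub>R e)"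
    by (intro smooth_on_sum open_UNIV smooth_on_bounded_linear_compose[OF open_UNIV bounded_linear_scaleR_left]
        smooth_on_frechet_derivative assms)
  moreover have "D2 H = (\<lambda>z. \<Sum>e\<in>Basis. frechet_derivative H (at z) (0, blinfun_inner_left e) *\<^sub>R e)"
    by (rule ext, rule D2_eq, rule smooth_on_differentiable[OF assms UNIV_I])
  ultimately show ?thesis by simp
qed

lemma base_force_apply: "blinfun_apply (base_force \<phi> z) v = blinfun_apply (\<phi> z) (v, 0)"
  unfolding base_force_def
  by (subst bounded_linear_Blinfun_apply)
    (auto intro: bounded_linear_compose[OF blinfun.bounded_linear_right bounded_linear_Pair_0(1)])

lemma horizontal_apply:
  assumes "horizontal \<phi>" shows "blinfun_apply (\<phi> z) u = blinfun_apply (base_force \<phi> z) (fst u)"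
proof -
  have "blinfun_apply (\<phi> z) u = blinfun_apply (\<phi> z) ((fst u, 0) + (0, snd u))" by simp
  also have "\<dots> = blinfun_apply (\<phi> z) (fst u, 0)"
    unfolding blinfun.add_right using assms[unfolded horizontal_def, rule_format, of z "snd u"] by simp
  finally show ?thesis by (simp add: base_force_apply)
qed

lemma smooth_on_base_force:
  assumes "smooth_on UNIV \<phi>" shows "smooth_on UNIV (base_force \<phi>)"
proof -
  \<comment> \<open>For a constant form \<open>base_force\<close> does not depend on the point, so
    evaluating it at any point, here \<open>undefined\<close>, describes restriction to the first
    factor as a linear map.\<close>
  define R :: "('a cotangent \<Rightarrow>\<^sub>L real) \<Rightarrow> ('a \<Rightarrow>\<^sub>L real)" where "R \<psi> = base_force (\<lambda>_. \<psi>) undefined" for \<psi>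
  have R: "blinfun_apply (R \<psi>) v = blinfun_apply \<psi> (v, 0)" for \<psi> v
    unfolding R_def by (rule base_force_apply)
  have "bounded_linear R"
    by (rule linear_fin_dim_bounded, rule linearI)
      (auto intro!: blinfun_eqI simp: R blinfun.add_left blinfun.scaleR_left)
  from smooth_on_bounded_linear_compose[OF open_UNIV this assms]
  have "smooth_on UNIV (\<lambda>z. R (\<phi> z))" .
  moreover have "base_force \<phi> = (\<lambda>z. R (\<phi> z))"
    by (rule ext, rule blinfun_eqI) (simp add: R base_force_apply)
  ultimately show ?thesis by simp
qed

lemma smooth_on_ham_field:
  assumes "forced_hamiltonian_system H \<phi>" shows "smooth_on UNIV (ham_field H \<phi>)"
proof -
  have "smooth_on UNIV (\<lambda>z. (D2 H z, base_force \<phi> z - D1 H z))"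
    using assms unfolding forced_hamiltonian_system_def
    by (intro smooth_on_Pair smooth_on_diff open_UNIV smooth_on_D1 smooth_on_D2 smooth_on_base_force) auto
  then show ?thesis by (simp add: ham_field_def[abs_def])
qed

lemma ivp_flow_eq:
  assumes "forced_hamiltonian_system H \<phi>" "trajectory H \<phi> h \<gamma>"
  shows "ivp_flow H \<phi> h (\<gamma> 0) = \<gamma> h"
  unfolding ivp_flow_def
proof (rule the_equality)
  show "\<exists>\<gamma>'. trajectory H \<phi> h \<gamma>' \<and> \<gamma>' 0 = \<gamma> 0 \<and> \<gamma>' h = \<gamma> h" using assms(2) by blast
  fix w assume "\<exists>\<gamma>'. trajectory H \<phi> h \<gamma>' \<and> \<gamma>' 0 = \<gamma> 0 \<and> \<gamma>' h = w"
  then obtain \<gamma>' where \<gamma>': "trajectory H \<phi> h \<gamma>'" "\<gamma>' 0 = \<gamma> 0" "\<gamma>' h = w" by blast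
  have "\<gamma>' h = \<gamma> h"
    by (rule ode_unique[OF smooth_on_ham_field[OF assms(1)]])
      (use assms(2) \<gamma>'(1,2) in \<open>auto simp: trajectory_iff\<close>)
  then show "w = \<gamma> h" using \<gamma>'(3) by simp
qed

lemma trajectory_restrict:
  assumes "trajectory H \<phi> h \<gamma>" "t \<in> closed_segment 0 h" shows "trajectory H \<phi> t \<gamma>"
proof -
  have "closed_segment 0 t \<subseteq> closed_segment 0 h" using assms(2) by (simp add: subset_closed_segment)
  then show ?thesis
    using assms(1) has_vector_derivative_within_subset unfolding trajectory_iff by blast
qed

section \<open>Shooting against the exact boundary value flow\<close>

text \<open>The smooth extension \<open>F\<close> of the boundary value flow is fixed along with the
  data. It agrees with that flow only for t between 0 and h, but being smooth on an open set it can
  be differentiated at the ends of this interval too.\<close>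

locale shooting_scheme =
  fixes H :: "'q::euclidean_space cotangent \<Rightarrow> real"
    and \<phi> :: "'q cotangent \<Rightarrow> ('q cotangent \<Rightarrow>\<^sub>L real)"
    and \<Phi> :: "real \<Rightarrow> 'q cotangent \<Rightarrow> 'q cotangent"
    and p0 :: "real \<Rightarrow> 'q cotangent \<Rightarrow> ('q \<Rightarrow>\<^sub>L real)"
    and W D S :: "('q cotangent \<times> real) set"
    and c w :: "nat \<Rightarrow> real"
    and n a b :: nat
    and V :: "('q cotangent \<times> real \<times> real) set"
    and F :: "'q cotangent \<times> real \<times> real \<Rightarrow> 'q cotangent"
  assumes system: "forced_hamiltonian_system H \<phi>"
    and open_W: "open W" and zero_W: "(x, 0) \<in> W"
    and bvp_exists: "(x, h) \<in> W \<Longrightarrow> \<exists>\<gamma>. bvp_trajectory H \<phi> h x \<gamma>"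
    and bvp_unique: "(x, h) \<in> W \<Longrightarrow> bvp_trajectory H \<phi> h x \<gamma> \<Longrightarrow> bvp_trajectory H \<phi> h x \<gamma>' \<Longrightarrow>
      t \<in> closed_segment 0 h \<Longrightarrow> \<gamma> t = \<gamma>' t"
    and open_V: "open V" and smooth_F: "smooth_on V F"
    and in_V: "(x, h) \<in> W \<Longrightarrow> t \<in> closed_segment 0 h \<Longrightarrow> (x, h, t) \<in> V"
    and F_eq: "(x, h) \<in> W \<Longrightarrow> t \<in> closed_segment 0 h \<Longrightarrow> F (x, h, t) = bvp_flow H \<phi> h t x"
    and nodes: "j \<le> n \<Longrightarrow> 0 \<le> c j \<and> c j \<le> 1"
    and last_node: "c n = 1"
    and quadrature: "quadrature_order n c w a"
    and open_D: "open D" and zero_D: "(x, 0) \<in> D"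
    and integrator_smooth: "smooth_on D (\<lambda>(z, h). \<Phi> h z)"
    and integrator_order:
      "eq_upto_O D (\<lambda>(z, h). \<Phi> h z) (ivp_domain H \<phi>) (\<lambda>(z, h). ivp_flow H \<phi> h z) (b + 1)"
    and shooting: "shooting_momentum n c D \<Phi> S p0"
begin

definition integrator :: "'q cotangent \<times> real \<Rightarrow> 'q cotangent" where
  "integrator y = \<Phi> (snd y) (fst y)"

text \<open>\<open>exact k (x, h)\<close> is the point at time \<open>k h\<close> of the exact trajectory with boundary data \<open>x\<close>;
  in particular \<open>exact 0\<close> is the exact solution of the shooting problem.\<close>

definition exact :: "real \<Rightarrow> 'q cotangent \<times> real \<Rightarrow> 'q cotangent" where
  "exact k y = F (fst y, snd y, k * snd y)"

definition start :: "'q cotangent \<times> real \<Rightarrow> 'q cotangent" where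
  "start y = (fst (fst y), p0 (snd y) (fst y))"

definition defect :: "real \<Rightarrow> 'q cotangent \<times> real \<Rightarrow> 'q cotangent" where
  "defect k y = integrator (exact 0 y, k * snd y) - exact k y"

text \<open>Shooting solves \<open>shoot (z, h) = x\<close> for \<open>z\<close>.\<close>

definition shoot :: "'q cotangent \<times> real \<Rightarrow> 'q cotangent" where
  "shoot y = (fst (fst y), snd (integrator y))"

section \<open>The exact trajectory and the defects of the integrator\<close>

lemma smooth_integrator: "smooth_on D integrator"
  using integrator_smooth by (simp add: integrator_def[abs_def] case_prod_unfold)

lemma scaled_in_segment: "0 \<le> k \<Longrightarrow> k \<le> 1 \<Longrightarrow> k * h \<in> closed_segment 0 (h :: real)"
  by (auto simp: closed_segment_def)

lemma exact_in_V: "y \<in> W \<Longrightarrow> 0 \<le> k \<Longrightarrow> k \<le> 1 \<Longrightarrow> (fst y, snd y, k * snd y) \<in> V"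
  using in_V[of "fst y" "snd y"] scaled_in_segment by auto

lemma F_trajectory:
  assumes "(x, h) \<in> W" shows "bvp_trajectory H \<phi> h x (\<lambda>t. F (x, h, t))"
proof -
  obtain \<gamma> where \<gamma>: "bvp_trajectory H \<phi> h x \<gamma>" using bvp_exists[OF assms] by blast
  have eq: "F (x, h, t) = \<gamma> t" if "t \<in> closed_segment 0 h" for t
    unfolding F_eq[OF assms that] bvp_flow_def
    by (rule the_equality) (use \<gamma> bvp_unique[OF assms _ \<gamma> that] in blast)+
  have "((\<lambda>t. F (x, h, t)) has_vector_derivative ham_field H \<phi> (F (x, h, t))) (at t within closed_segment 0 h)"
    if "t \<in> closed_segment 0 h" for t
    using \<gamma> that unfolding bvp_trajectory_def trajectory_iff eq[OF that]
    by (intro has_vector_derivative_transform[OF that eq]) auto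
  then show ?thesis
    using \<gamma> by (simp add: bvp_trajectory_def trajectory_iff eq)
qed

lemma F_initial: "(x, h) \<in> W \<Longrightarrow> fst (F (x, h, 0)) = fst x"
  and F_final: "(x, h) \<in> W \<Longrightarrow> snd (F (x, h, h)) = snd x"
  using F_trajectory by (auto simp: bvp_trajectory_def)

text \<open>A boundary value trajectory solves the initial value problem from its own starting
  point, up to every intermediate time; uniqueness of solutions identifies the two flows along
  it.\<close>

lemma ivp_flow_F:
  assumes "(x, h) \<in> W" "t \<in> closed_segment 0 h" shows "ivp_flow H \<phi> t (F (x, h, 0)) = F (x, h, t)"
  using ivp_flow_eq[OF system trajectory_restrict[OF _ assms(2)], of "\<lambda>t. F (x, h, t)"] F_trajectory[OF assms(1)]
  by (simp add: bvp_trajectory_def)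

text \<open>For h = 0 the trajectory starts and ends at the same time, so the two boundary
  conditions fix the whole point.\<close>

lemma exact_zero [simp]: "exact k (x, 0) = x"
  using F_initial[OF zero_W] F_final[OF zero_W] by (simp add: exact_def prod_eq_iff)

lemma bounded_linear_time: "bounded_linear (\<lambda>y :: 'q cotangent \<times> real. (fst y, snd y, k * snd y))"
  by (intro bounded_linear_Pair bounded_linear_fst bounded_linear_snd bounded_linear_const_mult)

lemma smooth_exact:
  assumes "0 \<le> k" "k \<le> 1" shows "smooth_on W (exact k)"
  unfolding exact_def[abs_def]
  by (rule smooth_on_compose[OF open_W open_V smooth_on_bounded_linear[OF open_W bounded_linear_time] smooth_F])
    (rule exact_in_V[OF _ assms])

lemma isCont_exact: "0 \<le> k \<Longrightarrow> k \<le> 1 \<Longrightarrow> y \<in> W \<Longrightarrow> isCont (exact k) y"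
  by (rule smooth_on_isCont[OF smooth_exact open_W])

lemma exact_tendsto: "0 \<le> k \<Longrightarrow> k \<le> 1 \<Longrightarrow> (exact k \<longlongrightarrow> x) (hfilter x)"
  using isCont_tendsto_hfilter[OF isCont_exact[OF _ _ zero_W]] by simp

text \<open>Moving x alone keeps h and with it the time k h, so only the first component of the
  argument of \<open>F\<close> varies.\<close>

lemma dir_deriv_exact:
  assumes "0 \<le> k" "k \<le> 1" "y \<in> W"
  shows "dir_deriv (v, 0) (exact k) y = dir_deriv (v, 0, 0) F (fst y, snd y, k * snd y)"
proof -
  let ?z = "(fst y, snd y, k * snd y)"
  have "((\<lambda>y. (fst y, snd y, k * snd y)) has_derivative (\<lambda>u. (fst u, snd u, k * snd u))) (at y)"
    by (rule bounded_linear_imp_has_derivative[OF bounded_linear_time])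
  from has_derivative_compose[OF this smooth_on_differentiable[OF smooth_F exact_in_V[OF assms(3,1,2)]]]
  have "(exact k has_derivative (\<lambda>u. frechet_derivative F (at ?z) (fst u, snd u, k * snd u))) (at y)"
    unfolding exact_def[abs_def] .
  from frechet_derivative_at[OF this, symmetric] show ?thesis by (simp add: dir_deriv_def)
qed

lemma eventually_W: "\<forall>\<^sub>F y in hfilter x. y \<in> W"
  by (rule eventually_hfilter_in_open[OF open_W zero_W])

lemma time_tendsto: "((\<lambda>y. k * snd y) \<longlongrightarrow> 0) (hfilter x)"
  using tendsto_mult_right_zero[OF snd_tendsto_hfilter] .

text \<open>The integrator makes a step of size k h, so its error is (k h)^(b+1) times the
  continuous quotient at a point that tends to (x, 0).\<close>

lemma defect_hlim:
  assumes k: "0 \<le> k" "k \<le> 1" shows "\<exists>l. hlim (b + 1) (defect k) x l"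
proof -
  obtain U \<delta> where U: "open U" "UNIV \<times> {0} \<subseteq> U" "continuous_on U \<delta>"
    and eq: "\<forall>(x, h)\<in>U. (\<lambda>(z, h). \<Phi> h z) (x, h) - (\<lambda>(z, h). ivp_flow H \<phi> h z) (x, h) = h ^ (b + 1) *\<^sub>R \<delta> (x, h)"
    using integrator_order unfolding eq_upto_O_def by blast
  have U_eq: "\<Phi> h z - ivp_flow H \<phi> h z = h ^ (b + 1) *\<^sub>R \<delta> (z, h)" if "(z, h) \<in> U" for z h
    using bspec[OF eq that] by simp
  have x0: "(x, 0) \<in> U" using U(2) by auto
  let ?z = "\<lambda>y. (exact 0 y, k * snd y)"
  have t: "(?z \<longlongrightarrow> (x, 0)) (hfilter x)"
    by (intro tendsto_Pair exact_tendsto time_tendsto) auto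
  have "isCont \<delta> (x, 0)" using U(1,3) x0 continuous_on_eq_continuous_at by blast
  from isCont_tendsto_compose[OF this t]
  have "((\<lambda>y. k ^ (b + 1) *\<^sub>R \<delta> (?z y)) \<longlongrightarrow> k ^ (b + 1) *\<^sub>R \<delta> (x, 0)) (hfilter x)"
    by (intro tendsto_intros)
  moreover have "\<forall>\<^sub>F y in hfilter x. k ^ (b + 1) *\<^sub>R \<delta> (?z y) = inverse (snd y ^ (b + 1)) *\<^sub>R defect k y"
    using eventually_W eventually_hfilter_nonzero topological_tendstoD[OF t U(1) x0]
  proof eventually_elim
    case (elim y)
    have "defect k y = (k * snd y) ^ (b + 1) *\<^sub>R \<delta> (?z y)"
      using U_eq[OF elim(3)] ivp_flow_F[of "fst y" "snd y" "k * snd y"] scaled_in_segment[OF k] elim(1)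
      by (simp add: defect_def integrator_def exact_def)
    also have "\<dots> = snd y ^ (b + 1) *\<^sub>R k ^ (b + 1) *\<^sub>R \<delta> (?z y)"
      by (simp add: power_mult_distrib mult_ac)
    finally have "inverse (snd y ^ (b + 1)) *\<^sub>R defect k y = k ^ (b + 1) *\<^sub>R \<delta> (?z y)"
      using elim(2) by (simp add: field_simps)
    then show ?case ..
  qed
  ultimately have "hlim (b + 1) (defect k) x (k ^ (b + 1) *\<^sub>R \<delta> (x, 0))"
    unfolding hlim_def by (rule Lim_transform_eventually)
  then show ?thesis by blast
qed

text \<open>A consequence of the order estimate with k = 0: the defect tends to 0, and by continuity
  also to \<open>integrator (x, 0) - x\<close>.\<close>

lemma integrator_zero [simp]: "integrator (x, 0) = x"
proof -
  obtain l where "hlim (b + 1) (defect 0) x l" using defect_hlim[OF order_refl zero_le_one, of x] by blast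
  from hlim_power_tendsto[OF this] have "(defect 0 \<longlongrightarrow> 0) (hfilter x)" by simp
  moreover have "isCont integrator (x, 0)" by (rule smooth_on_isCont[OF smooth_integrator open_D zero_D])
  from isCont_tendsto_compose[OF this tendsto_Pair[OF exact_tendsto[of 0] time_tendsto[of 0]]]
  have "(defect 0 \<longlongrightarrow> integrator (x, 0) - x) (hfilter x)"
    unfolding defect_def[abs_def] by (intro tendsto_diff exact_tendsto) auto
  ultimately show ?thesis using tendsto_unique[OF hfilter_nontrivial] by fastforce
qed

definition defect_domain :: "real \<Rightarrow> ('q cotangent \<times> real) set" where
  "defect_domain k = W \<inter> (\<lambda>y. (exact 0 y, k * snd y)) -` D"

lemma open_defect_domain: "open (defect_domain k)"
  unfolding defect_domain_def
  by (intro continuous_open_preimage open_W open_D continuous_intros smooth_on_imp_continuous_on[OF smooth_exact]) auto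

lemma zero_defect_domain: "(x, 0) \<in> defect_domain k"
  using zero_W zero_D by (simp add: defect_domain_def)

lemma smooth_defect:
  assumes k: "0 \<le> k" "k \<le> 1" shows "smooth_on (defect_domain k) (defect k)"
proof -
  have sub: "defect_domain k \<subseteq> W" by (auto simp: defect_domain_def)
  have lin: "bounded_linear (\<lambda>y :: 'q cotangent \<times> real. k * snd y)"
    by (intro bounded_linear_const_mult bounded_linear_snd)
  have "smooth_on (defect_domain k) (\<lambda>y. (exact 0 y, k * snd y))"
    by (intro smooth_on_Pair open_defect_domain smooth_on_subset[OF smooth_exact sub]
        smooth_on_bounded_linear[OF open_defect_domain lin]) auto
  then have "smooth_on (defect_domain k) (\<lambda>y. integrator (exact 0 y, k * snd y))"
    by (rule smooth_on_compose[OF open_defect_domain open_D _ smooth_integrator]) (auto simp: defect_domain_def)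
  then show ?thesis
    unfolding defect_def[abs_def]
    by (intro smooth_on_diff open_defect_domain smooth_on_subset[OF smooth_exact[OF k] sub])
qed

lemma defect_derivative_hlim:
  assumes "0 \<le> k" "k \<le> 1" shows "\<exists>l. hlim (b + 1) (dir_deriv (v, 0) (defect k)) x l"
  by (rule hlim_space_derivative[OF open_defect_domain _ smooth_defect[OF assms] defect_hlim[OF assms]])
    (auto intro: zero_defect_domain)

lemma exact_has_derivative_x:
  assumes "0 \<le> k" "k \<le> 1" "y \<in> W"
  shows "((\<lambda>x. exact k (x, snd y)) has_derivative (\<lambda>v. dir_deriv (v, 0) (exact k) y)) (at (fst y))"
  unfolding dir_deriv_def
  by (rule has_derivative_compose[where f="\<lambda>x. (x, snd y)"])
    (use smooth_on_differentiable[OF smooth_exact[OF assms(1,2)] assms(3)] in \<open>auto intro!: derivative_eq_intros\<close>)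

lemma defect_derivative:
  assumes k: "0 \<le> k" "k \<le> 1" and y: "y \<in> defect_domain k"
  shows "dir_deriv (v, 0) (defect k) y =
    frechet_derivative integrator (at (exact 0 y, k * snd y)) (dir_deriv (v, 0) (exact 0) y, 0) - dir_deriv (v, 0) (exact k) y"
proof -
  have yW: "y \<in> W" and yD: "(exact 0 y, k * snd y) \<in> D" using y by (auto simp: defect_domain_def)
  have "((\<lambda>x. (exact 0 (x, snd y), k * snd y)) has_derivative (\<lambda>v. (dir_deriv (v, 0) (exact 0) y, 0))) (at (fst y))"
    by (intro has_derivative_Pair exact_has_derivative_x yW has_derivative_const) auto
  from has_derivative_compose[OF this] smooth_on_differentiable[OF smooth_integrator yD]
  have "((\<lambda>x. integrator (exact 0 (x, snd y), k * snd y)) has_derivative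
      (\<lambda>v. frechet_derivative integrator (at (exact 0 y, k * snd y)) (dir_deriv (v, 0) (exact 0) y, 0))) (at (fst y))"
    by simp
  from has_derivative_diff[OF this exact_has_derivative_x[OF k yW]]
  have 1: "((\<lambda>x. defect k (x, snd y)) has_derivative (\<lambda>v. frechet_derivative integrator (at (exact 0 y, k * snd y))
      (dir_deriv (v, 0) (exact 0) y, 0) - dir_deriv (v, 0) (exact k) y)) (at (fst y))"
    by (simp add: defect_def)
  have 2: "((\<lambda>x. defect k (x, snd y)) has_derivative (\<lambda>v. dir_deriv (v, 0) (defect k) y)) (at (fst y))"
    unfolding dir_deriv_def
    by (rule has_derivative_compose[where f="\<lambda>x. (x, snd y)"])
      (use smooth_on_differentiable[OF smooth_defect[OF k] y] in \<open>auto intro!: derivative_eq_intros\<close>)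
  show ?thesis using has_derivative_unique[OF 1 2] by metis
qed

section \<open>The shooting solution\<close>

lemma open_S: "open S" and zero_S: "(x, 0) \<in> S"
  and shooting_D: "y \<in> S \<Longrightarrow> (start y, snd y) \<in> D"
  and shooting_node_D: "y \<in> S \<Longrightarrow> j \<le> n \<Longrightarrow> (start y, c j * snd y) \<in> D"
  and shoot_start: "y \<in> S \<Longrightarrow> shoot (start y, snd y) = fst y"
  using shooting unfolding shooting_momentum_def
  by (auto simp: start_def shoot_def integrator_def case_prod_unfold prod_eq_iff)

lemma isCont_start: "y \<in> S \<Longrightarrow> isCont start y"
proof -
  assume y: "y \<in> S"
  have "continuous_on S (\<lambda>y. p0 (snd y) (fst y))"
    using shooting by (simp add: shooting_momentum_def case_prod_unfold)
  then have "isCont (\<lambda>y. p0 (snd y) (fst y)) y"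
    using open_S y continuous_on_eq_continuous_at by blast
  then show "isCont start y" unfolding start_def[abs_def] by (intro continuous_intros)
qed

text \<open>The integrator is the identity for h = 0, so the shooting equation leaves only one
  momentum there.\<close>

lemma start_zero [simp]: "start (x, 0) = x"
  using shoot_start[OF zero_S, of x] by (simp add: shoot_def prod_eq_iff)

lemma start_tendsto: "(start \<longlongrightarrow> x) (hfilter x)"
  using isCont_tendsto_hfilter[OF isCont_start[OF zero_S]] by simp

lemma smooth_shoot: "smooth_on D shoot"
  unfolding shoot_def[abs_def]
  by (intro smooth_on_Pair open_D smooth_on_bounded_linear smooth_on_bounded_linear_compose[OF _ bounded_linear_snd]
      smooth_integrator bounded_linear_compose[OF bounded_linear_fst] bounded_linear_fst)

text \<open>The exact start has the right position, and the integrator carries it to the prescribed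
  momentum up to the momentum component of the defect over the full step.\<close>

lemma shoot_exact: "y \<in> W \<Longrightarrow> shoot (exact 0 y, snd y) = fst y + (0, snd (defect 1 y))"
  using F_initial[of "fst y" "snd y"] F_final[of "fst y" "snd y"]
  by (simp add: shoot_def defect_def exact_def prod_eq_iff)

lemma shoot_derivative_zero: "frechet_derivative shoot (at (x, 0)) (u, 0) = u"
proof -
  have "((\<lambda>z. shoot (z, 0)) has_derivative (\<lambda>u. frechet_derivative shoot (at (x, 0)) (u, 0))) (at x)"
    by (rule has_derivative_compose[where f="\<lambda>z. (z, 0)"])
      (use smooth_on_differentiable[OF smooth_shoot zero_D] in \<open>auto intro!: derivative_eq_intros\<close>)
  moreover have "(\<lambda>z. shoot (z, 0)) = (\<lambda>z. z)" by (auto simp: shoot_def)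
  ultimately have "(\<lambda>u. frechet_derivative shoot (at (x, 0)) (u, 0)) = (\<lambda>u. u)"
    using has_derivative_unique[OF _ has_derivative_ident[of "at x"]] by metis
  then show ?thesis by metis
qed

text \<open>\<open>shoot\<close> is strictly differentiable at (x, 0), with the identity as its
  derivative in the first argument. The two arguments share the same h, so the difference of the
  values is that of the points up to a small relative error, and \<open>hlim_near_identity\<close>
  applies.\<close>

lemma start_hcong: "hcong (b + 1) x start (exact 0)"
proof -
  let ?R = "\<lambda>y. shoot (start y, snd y) - shoot (exact 0 y, snd y)"
  obtain l where "hlim (b + 1) (defect 1) x l" using defect_hlim[OF zero_le_one order_refl, of x] by blast
  from hlim_uminus[OF hlim_bounded_linear[OF bounded_linear_compose[OF bounded_linear_Pair_0(2) bounded_linear_snd] this]]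
  have l: "hlim (b + 1) (\<lambda>y. - (0, snd (defect 1 y))) x (- (0, snd l))" .
  have R: "hlim (b + 1) ?R x (- (0, snd l))"
    by (rule hlim_cong[OF _ l])
      (use eventually_W eventually_hfilter_in_open[OF open_S zero_S] in \<open>eventually_elim, simp add: shoot_start shoot_exact\<close>)
  have "hlim (b + 1) (\<lambda>y. start y - exact 0 y) x (- (0, snd l))"
  proof (rule hlim_near_identity[OF _ R])
    fix \<epsilon> :: real assume "0 < \<epsilon>"
    then obtain d where d: "0 < d" "\<And>y z. y \<in> ball (x, 0) d \<Longrightarrow> z \<in> ball (x, 0) d \<Longrightarrow>
      norm (shoot y - shoot z - frechet_derivative shoot (at (x, 0)) (y - z)) \<le> \<epsilon> * norm (y - z)"
      using smooth_on_strict[OF open_D smooth_shoot zero_D] by blast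
    have "((\<lambda>y. (start y, snd y)) \<longlongrightarrow> (x, 0)) (hfilter x)" "((\<lambda>y. (exact 0 y, snd y)) \<longlongrightarrow> (x, 0)) (hfilter x)"
      by (intro tendsto_Pair start_tendsto exact_tendsto snd_tendsto_hfilter; simp)+
    from this[THEN tendstoD, OF d(1)]
    show "\<forall>\<^sub>F y in hfilter x. norm (?R y - (start y - exact 0 y)) \<le> \<epsilon> * norm (start y - exact 0 y)"
    proof eventually_elim
      case (elim y)
      have "norm (?R y - frechet_derivative shoot (at (x, 0)) ((start y, snd y) - (exact 0 y, snd y)))
          \<le> \<epsilon> * norm ((start y, snd y) - (exact 0 y, snd y))"
        by (rule d(2)) (use elim in \<open>simp_all add: dist_commute\<close>)
      then show ?case by (simp add: shoot_derivative_zero)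
    qed
  qed
  then show ?thesis unfolding hcong_def by blast
qed

section \<open>Differentiating the shooting solution\<close>

definition shoot_deriv :: "'q cotangent \<times> real \<Rightarrow> 'q cotangent \<Rightarrow> 'q cotangent" where
  "shoot_deriv y u = frechet_derivative shoot (at (start y, snd y)) (u, 0)"

definition start_deriv :: "'q cotangent \<times> real \<Rightarrow> 'q cotangent \<Rightarrow> 'q cotangent" where
  "start_deriv y = frechet_derivative (\<lambda>x. start (x, snd y)) (at (fst y))"

text \<open>The bound 1/2 is the one of \<open>near_identity_inverse\<close>: at such points the
  shooting equation can be differentiated implicitly.\<close>

definition regular :: "'q cotangent \<times> real \<Rightarrow> bool" where
  "regular y \<longleftrightarrow> y \<in> S \<and> (\<forall>u. norm (shoot_deriv y u - u) \<le> 1 / 2 * norm u)"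

lemma shoot_deriv_near:
  assumes "0 < \<epsilon>" shows "\<forall>\<^sub>F y in nhds (x, 0). \<forall>u. norm (shoot_deriv y u - u) \<le> \<epsilon> * norm u"
proof -
  have "isCont (\<lambda>y. (start y, snd y)) (x, 0)"
    by (intro continuous_intros isCont_start zero_S)
  then have "((\<lambda>y. (start y, snd y)) \<longlongrightarrow> (x, 0)) (nhds (x, 0))"
    using tendsto_at_iff_tendsto_nhds[of "\<lambda>y. (start y, snd y)" "(x, 0)"] by (simp add: isCont_def)
  from filterlim_iff[THEN iffD1, OF this, rule_format, OF smooth_on_derivative_near[OF open_D smooth_shoot zero_D assms]]
  show ?thesis
  proof eventually_elim
    case (elim y)
    show ?case
    proof
      fix u
      have "norm (shoot_deriv y u - frechet_derivative shoot (at (x, 0)) (u, 0)) \<le> \<epsilon> * norm (u, 0 :: real)"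
        unfolding shoot_deriv_def using elim by blast
      then show "norm (shoot_deriv y u - u) \<le> \<epsilon> * norm u" by (simp add: shoot_derivative_zero)
    qed
  qed
qed

lemma eventually_regular: "\<forall>\<^sub>F y in nhds (x, 0). regular y"
  unfolding regular_def
  by (intro eventually_conj shoot_deriv_near eventually_nhds_in_open open_S zero_S) simp

lemma bounded_linear_shoot_deriv:
  assumes "y \<in> S" shows "bounded_linear (shoot_deriv y)"
  unfolding shoot_deriv_def[abs_def]
  by (rule bounded_linear_compose[OF has_derivative_bounded_linear bounded_linear_Pair_0(1)])
    (rule smooth_on_differentiable[OF smooth_shoot shooting_D[OF assms]])

text \<open>For fixed h, \<open>start\<close> is a continuous right inverse of \<open>shoot\<close>,
  whose derivative is invertible at regular points; so \<open>start\<close> is differentiable, with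
  the inverse as derivative. The bound 2 is uniform over regular points, on which continuity of the
  derivative relies.\<close>

lemma start_has_derivative:
  assumes "regular y"
  shows "((\<lambda>x. start (x, snd y)) has_derivative start_deriv y) (at (fst y))"
    and "shoot_deriv y (start_deriv y v) = v"
    and "norm u \<le> 2 * norm (shoot_deriv y u)"
proof -
  have y: "y \<in> S" using assms by (simp add: regular_def)
  obtain B where B: "bounded_linear B" "\<And>v. shoot_deriv y (B v) = v" "\<And>u. B (shoot_deriv y u) = u"
    "\<And>u. norm u \<le> 2 * norm (shoot_deriv y u)"
    using near_identity_inverse[OF bounded_linear_shoot_deriv[OF y]] assms unfolding regular_def by blast
  have "((\<lambda>x. start (x, snd y)) has_derivative B) (at (fst y))"
  proof (rule has_derivative_inverse_basic[where f="\<lambda>z. shoot (z, snd y)" and f'="shoot_deriv y"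
        and T="(\<lambda>x. (x, snd y)) -` S"])
    show "((\<lambda>z. shoot (z, snd y)) has_derivative shoot_deriv y) (at (start (fst y, snd y)))"
      unfolding shoot_deriv_def[abs_def]
      by (rule has_derivative_compose[where f="\<lambda>z. (z, snd y)"])
        (use smooth_on_differentiable[OF smooth_shoot shooting_D[OF y]] in \<open>auto intro!: derivative_eq_intros\<close>)
    show "B \<circ> shoot_deriv y = id" using B(3) by auto
    show "continuous (at (fst y)) (\<lambda>x. start (x, snd y))"
      by (rule isCont_o2[where f="\<lambda>x. (x, snd y)"]) (use isCont_start y in \<open>auto intro!: continuous_intros\<close>)
    show "open ((\<lambda>x. (x, snd y)) -` S)" by (intro open_vimage open_S continuous_intros)
    show "shoot (start (z, snd y), snd y) = z" if "z \<in> (\<lambda>x. (x, snd y)) -` S" for z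
      using shoot_start[of "(z, snd y)"] that by simp
  qed (use B(1) y in auto)
  moreover from this have "start_deriv y = B"
    unfolding start_deriv_def by (rule frechet_derivative_at[symmetric])
  ultimately show "((\<lambda>x. start (x, snd y)) has_derivative start_deriv y) (at (fst y))"
    "shoot_deriv y (start_deriv y v) = v" "norm u \<le> 2 * norm (shoot_deriv y u)"
    using B by auto
qed

lemma isCont_shoot_deriv: "y \<in> S \<Longrightarrow> isCont (\<lambda>y. shoot_deriv y u) y"
  unfolding shoot_deriv_def
  by (rule isCont_o2[where f="\<lambda>y. (start y, snd y)" and g="\<lambda>z. frechet_derivative shoot (at z) (u, 0)"])
    (intro continuous_intros isCont_start smooth_on_isCont[OF smooth_on_frechet_derivative[OF smooth_shoot] open_D]
      shooting_D; assumption)+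

text \<open>With A(y) for \<open>shoot_deriv y\<close> and B(y) for its inverse, A(y')(B(y')v -
  B(y)v) = v - A(y')B(y)v. The right-hand side tends to 0 by continuity of A, and the bound 2
  transfers this to B.\<close>

lemma isCont_start_deriv:
  assumes "\<forall>\<^sub>F y' in nhds y. regular y'" shows "isCont (\<lambda>y. start_deriv y v) y"
proof -
  have y: "regular y" using assms by (rule eventually_nhds_x_imp_x)
  then have S: "y \<in> S" by (simp add: regular_def)
  have "isCont (\<lambda>y'. 2 * norm (v - shoot_deriv y' (start_deriv y v))) y"
    by (intro continuous_intros isCont_shoot_deriv S)
  then have "((\<lambda>y'. 2 * norm (v - shoot_deriv y' (start_deriv y v))) \<longlongrightarrow> 0) (at y)"
    unfolding isCont_def by (simp add: start_has_derivative(2)[OF y])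
  moreover have "\<forall>\<^sub>F y' in at y. norm (start_deriv y' v - start_deriv y v) \<le> 2 * norm (v - shoot_deriv y' (start_deriv y v))"
    using assms unfolding eventually_at_filter
  proof (rule eventually_mono, intro impI)
    fix y' assume y': "regular y'"
    then have lin: "linear (shoot_deriv y')"
      by (intro bounded_linear.linear bounded_linear_shoot_deriv) (simp add: regular_def)
    have "norm (start_deriv y' v - start_deriv y v) \<le> 2 * norm (shoot_deriv y' (start_deriv y' v - start_deriv y v))"
      by (rule start_has_derivative(3)[OF y'])
    then show "norm (start_deriv y' v - start_deriv y v) \<le> 2 * norm (v - shoot_deriv y' (start_deriv y v))"
      by (simp add: linear_diff[OF lin] start_has_derivative(2)[OF y'])
  qed
  ultimately have "((\<lambda>y'. start_deriv y' v - start_deriv y v) \<longlongrightarrow> 0) (at y)"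
    by (rule Lim_null_comparison[rotated])
  then show ?thesis unfolding isCont_def by (rule LIM_zero_cancel)
qed

lemma eventually_regular_hfilter: "\<forall>\<^sub>F y in hfilter x. regular y"
  by (rule eventually_hfilterI, rule eventually_mono[OF eventually_regular]) simp

lemma dir_deriv_exact_tendsto:
  assumes "0 \<le> k" "k \<le> 1"
  shows "(dir_deriv (v, 0) (exact k) \<longlongrightarrow> dir_deriv (v, 0) (exact k) (x, 0)) (hfilter x)"
  by (rule isCont_tendsto_hfilter[OF smooth_on_isCont[OF smooth_on_dir_deriv[OF smooth_exact[OF assms]] open_W zero_W]])

text \<open>Let X be the derivative of \<open>exact 0\<close> and E the z-derivative of
  \<open>shoot\<close> at the exact start. Differentiating \<open>shoot_exact\<close> gives E X = v
  + (0, derivative of the defect momentum), while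
  \<open>shoot_deriv y (start_deriv y v) = v\<close>. So \<open>shoot_deriv y\<close> maps the
  difference \<open>?u\<close> to (E - \<open>shoot_deriv y\<close>) X minus the defect term. Both
  parts have order h^(b+1): the first by \<open>start_hcong\<close>, the second by divisibility of
  space derivatives. As \<open>shoot_deriv y\<close> tends to the identity, it can be
  removed.\<close>

lemma start_deriv_hcong: "hcong (b + 1) x (\<lambda>y. start_deriv y v) (dir_deriv (v, 0) (exact 0))"
proof -
  let ?X = "dir_deriv (v, 0) (exact 0)" and ?u = "\<lambda>y. start_deriv y v - dir_deriv (v, 0) (exact 0) y"
  have t: "((\<lambda>y. (start y, snd y)) \<longlongrightarrow> (x, 0)) (hfilter x)" "((\<lambda>y. (exact 0 y, snd y)) \<longlongrightarrow> (x, 0)) (hfilter x)"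
    by (intro tendsto_Pair start_tendsto exact_tendsto snd_tendsto_hfilter; simp)+
  have tX: "((\<lambda>y. (?X y, 0 :: real)) \<longlongrightarrow> (?X (x, 0), 0)) (hfilter x)"
    by (intro tendsto_Pair dir_deriv_exact_tendsto tendsto_const) auto
  have cong: "hcong (b + 1) x (\<lambda>y. (start y, snd y)) (\<lambda>y. (exact 0 y, snd y))"
    using hcong_add[OF hcong_bounded_linear[OF bounded_linear_Pair_0(1) start_hcong] hcong_refl[where f="\<lambda>y. (0, snd y)"]] by simp
  have "hcong (b + 1) x (\<lambda>y. frechet_derivative shoot (at (exact 0 y, snd y)) (?X y, 0)) (\<lambda>y. frechet_derivative shoot (at (start y, snd y)) (?X y, 0))"
    by (rule hcong_derivative_apply[OF open_D smooth_shoot zero_D t(2) t(1) hcong_sym[OF cong] tX hcong_refl])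
  then obtain l where l: "hlim (b + 1) (\<lambda>y. frechet_derivative shoot (at (exact 0 y, snd y)) (?X y, 0) - shoot_deriv y (?X y)) x l"
    unfolding hcong_def shoot_deriv_def by blast
  obtain m where "hlim (b + 1) (dir_deriv (v, 0) (defect 1)) x m" using defect_derivative_hlim[OF zero_le_one order_refl, of v x] by blast
  from hlim_diff[OF l hlim_bounded_linear[OF bounded_linear_compose[OF bounded_linear_Pair_0(2) bounded_linear_snd] this]]
  have "hlim (b + 1) (\<lambda>y. frechet_derivative shoot (at (exact 0 y, snd y)) (?X y, 0) - shoot_deriv y (?X y)
      - (0, snd (dir_deriv (v, 0) (defect 1) y))) x (l - (0, snd m))" .
  moreover have "\<forall>\<^sub>F y in hfilter x. frechet_derivative shoot (at (exact 0 y, snd y)) (?X y, 0) - shoot_deriv y (?X y)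
      - (0, snd (dir_deriv (v, 0) (defect 1) y)) = shoot_deriv y (?u y)"
    using eventually_regular_hfilter eventually_hfilter_in_open[OF open_defect_domain zero_defect_domain[of x 1]]
  proof eventually_elim
    case (elim y)
    have yW: "y \<in> W" and yD: "(exact 0 y, snd y) \<in> D" using elim(2) by (auto simp: defect_domain_def)
    have "((\<lambda>x. (exact 0 (x, snd y), snd y)) has_derivative (\<lambda>v. (dir_deriv (v, 0) (exact 0) y, 0))) (at (fst y))"
      by (intro has_derivative_Pair exact_has_derivative_x yW has_derivative_const) auto
    from has_derivative_compose[OF this] smooth_on_differentiable[OF smooth_shoot yD]
    have 1: "((\<lambda>x. shoot (exact 0 (x, snd y), snd y)) has_derivative
        (\<lambda>v. frechet_derivative shoot (at (exact 0 y, snd y)) (dir_deriv (v, 0) (exact 0) y, 0))) (at (fst y))"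
      by simp
    have "((\<lambda>x. defect 1 (x, snd y)) has_derivative (\<lambda>v. dir_deriv (v, 0) (defect 1) y)) (at (fst y))"
      unfolding dir_deriv_def
      by (rule has_derivative_compose[where f="\<lambda>x. (x, snd y)"])
        (use smooth_on_differentiable[OF smooth_defect elim(2)] in \<open>auto intro!: derivative_eq_intros\<close>)
    from has_derivative_add[OF has_derivative_ident bounded_linear.has_derivative[OF
        bounded_linear_compose[OF bounded_linear_Pair_0(2) bounded_linear_snd] this]]
    have 2: "((\<lambda>x. x + (0, snd (defect 1 (x, snd y)))) has_derivative (\<lambda>v. v + (0, snd (dir_deriv (v, 0) (defect 1) y)))) (at (fst y))" .
    have "open ((\<lambda>x. (x, snd y)) -` W)" by (intro open_vimage open_W continuous_intros)
    then have "((\<lambda>x. shoot (exact 0 (x, snd y), snd y)) has_derivative (\<lambda>v. v + (0, snd (dir_deriv (v, 0) (defect 1) y)))) (at (fst y))"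
    proof (rule has_derivative_transform_within_open[OF 2])
      fix x' assume "x' \<in> (\<lambda>x. (x, snd y)) -` W"
      then show "x' + (0, snd (defect 1 (x', snd y))) = shoot (exact 0 (x', snd y), snd y)"
        using shoot_exact[of "(x', snd y)"] by simp
    qed (use yW in simp)
    from has_derivative_unique[OF 1 this]
    have "frechet_derivative shoot (at (exact 0 y, snd y)) (?X y, 0) = v + (0, snd (dir_deriv (v, 0) (defect 1) y))"
      by metis
    moreover have "linear (shoot_deriv y)"
      using elim(1) by (intro bounded_linear.linear bounded_linear_shoot_deriv) (simp add: regular_def)
    ultimately show ?case
      by (simp add: linear_diff start_has_derivative(2)[OF elim(1)])
  qed
  ultimately have "hlim (b + 1) (\<lambda>y. shoot_deriv y (?u y)) x (l - (0, snd m))"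
    by (rule hlim_cong[rotated])
  then have "hlim (b + 1) ?u x (l - (0, snd m))"
    by (rule hlim_near_identity[rotated])
      (rule eventually_hfilterI, use shoot_deriv_near in \<open>fastforce elim: eventually_mono\<close>)
  then show ?thesis unfolding hcong_def by blast
qed

section \<open>The shooting nodes and their derivatives\<close>

definition node :: "nat \<Rightarrow> 'q cotangent \<times> real \<Rightarrow> 'q cotangent" where
  "node j y = integrator (start y, c j * snd y)"

definition node_deriv :: "nat \<Rightarrow> 'q cotangent \<times> real \<Rightarrow> 'q cotangent \<Rightarrow> 'q cotangent" where
  "node_deriv j y v = frechet_derivative integrator (at (start y, c j * snd y)) (start_deriv y v, 0)"

lemma shooting_node_eq: "shooting_node c \<Phi> p0 h j x = node j (x, h)"
  by (simp add: shooting_node_def node_def integrator_def start_def)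

lemma node_arg_tendsto:
  assumes "0 \<le> k" "k \<le> 1"
  shows "((\<lambda>y. (start y, k * snd y)) \<longlongrightarrow> (x, 0)) (hfilter x)" "((\<lambda>y. (exact 0 y, k * snd y)) \<longlongrightarrow> (x, 0)) (hfilter x)"
  by (intro tendsto_Pair start_tendsto exact_tendsto time_tendsto; simp)+

lemma node_arg_hcong: "hcong (b + 1) x (\<lambda>y. (start y, k * snd y)) (\<lambda>y. (exact 0 y, k * snd y))"
  using hcong_add[OF hcong_bounded_linear[OF bounded_linear_Pair_0(1) start_hcong] hcong_refl[where f="\<lambda>y. (0, k * snd y)"]]
  by simp

text \<open>Two replacements: first the start by the exact one at the same step size, then the
  integrator by the flow, with the defect as error.\<close>

lemma node_hcong:
  assumes "j \<le> n" shows "hcong (b + 1) x (node j) (exact (c j))"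
proof -
  have "hcong (b + 1) x (node j) (\<lambda>y. integrator (exact 0 y, c j * snd y))"
    unfolding node_def[abs_def]
    by (rule hcong_compose[OF open_D smooth_integrator zero_D node_arg_tendsto[OF _ _] node_arg_hcong]) (use nodes[OF assms] in auto)
  moreover have "hcong (b + 1) x (\<lambda>y. integrator (exact 0 y, c j * snd y)) (exact (c j))"
    using defect_hlim nodes[OF assms] unfolding hcong_def defect_def[abs_def] by blast
  ultimately show ?thesis by (rule hcong_trans)
qed

lemma node_deriv_hcong:
  assumes "j \<le> n" shows "hcong (b + 1) x (\<lambda>y. node_deriv j y v) (dir_deriv (v, 0) (exact (c j)))"
proof -
  let ?X = "dir_deriv (v, 0) (exact 0)"
  have c: "0 \<le> c j" "c j \<le> 1" using nodes[OF assms] by auto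
  have tX: "((\<lambda>y. (?X y, 0 :: real)) \<longlongrightarrow> (?X (x, 0), 0)) (hfilter x)"
    by (intro tendsto_Pair dir_deriv_exact_tendsto tendsto_const) auto
  have "hcong (b + 1) x (\<lambda>y. node_deriv j y v) (\<lambda>y. frechet_derivative integrator (at (exact 0 y, c j * snd y)) (?X y, 0))"
    unfolding node_deriv_def
    by (rule hcong_derivative_apply[OF open_D smooth_integrator zero_D node_arg_tendsto[OF c] node_arg_hcong tX
          hcong_bounded_linear[OF bounded_linear_Pair_0(1) start_deriv_hcong]])
  moreover have "hcong (b + 1) x (\<lambda>y. frechet_derivative integrator (at (exact 0 y, c j * snd y)) (?X y, 0))
      (dir_deriv (v, 0) (exact (c j)))"
  proof -
    obtain l where l: "hlim (b + 1) (dir_deriv (v, 0) (defect (c j))) x l"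
      using defect_derivative_hlim[OF c, of v x] by blast
    have "\<forall>\<^sub>F y in hfilter x. dir_deriv (v, 0) (defect (c j)) y =
        frechet_derivative integrator (at (exact 0 y, c j * snd y)) (?X y, 0) - dir_deriv (v, 0) (exact (c j)) y"
      using eventually_hfilter_in_open[OF open_defect_domain zero_defect_domain[of x "c j"]]
      by (rule eventually_mono) (rule defect_derivative[OF c])
    from hlim_cong[OF this l] show ?thesis unfolding hcong_def by blast
  qed
  ultimately show ?thesis by (rule hcong_trans)
qed

lemma node_has_derivative:
  assumes "regular y" "j \<le> n"
  shows "((\<lambda>x. node j (x, snd y)) has_derivative node_deriv j y) (at (fst y))"
proof -
  have y: "(start y, c j * snd y) \<in> D" using assms by (auto simp: regular_def intro: shooting_node_D)
  have "((\<lambda>x. (start (x, snd y), c j * snd y)) has_derivative (\<lambda>v. (start_deriv y v, 0))) (at (fst y))"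
    by (intro has_derivative_Pair start_has_derivative(1)[OF assms(1)] has_derivative_const)
  from has_derivative_compose[OF this] smooth_on_differentiable[OF smooth_integrator y]
  show ?thesis by (simp add: node_def node_deriv_def[abs_def])
qed

lemma isCont_node: "y \<in> S \<Longrightarrow> j \<le> n \<Longrightarrow> isCont (node j) y"
  unfolding node_def[abs_def]
  by (rule isCont_o2[where f="\<lambda>y. (start y, c j * snd y)" and g=integrator])
    (intro continuous_intros isCont_start smooth_on_isCont[OF smooth_integrator open_D] shooting_node_D; assumption)+

lemma isCont_node_deriv:
  assumes "\<forall>\<^sub>F y' in nhds y. regular y'" "j \<le> n" shows "isCont (\<lambda>y. node_deriv j y v) y"
proof -
  \<comment> \<open>The direction \<open>start_deriv y v\<close> moves with y and has to be expanded
    in coordinates.\<close>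
  obtain B and \<beta> :: "'q cotangent \<Rightarrow> 'q cotangent \<Rightarrow> real"
    where B: "finite B" "\<And>e. bounded_linear (\<beta> e)" "\<And>x. (\<Sum>e\<in>B. \<beta> e x *\<^sub>R e) = x"
    using fin_dim_coordsE by blast
  let ?z = "\<lambda>y. (start y, c j * snd y)"
  have "regular y" using assms(1) by (rule eventually_nhds_x_imp_x)
  then have y: "y \<in> S" by (simp add: regular_def)
  have "isCont (\<lambda>y. frechet_derivative integrator (at (?z y)) (e, 0)) y" for e
    by (rule isCont_o2[where f="?z" and g="\<lambda>z. frechet_derivative integrator (at z) (e, 0)"])
      (intro continuous_intros isCont_start smooth_on_isCont[OF smooth_on_frechet_derivative[OF smooth_integrator] open_D]
        shooting_node_D y assms(2))+
  moreover have "isCont (\<lambda>y. \<beta> e (start_deriv y v)) y" for e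
    by (rule bounded_linear.isCont[OF B(2) isCont_start_deriv[OF assms(1)]])
  ultimately have "isCont (\<lambda>y. \<Sum>e\<in>B. \<beta> e (start_deriv y v) *\<^sub>R frechet_derivative integrator (at (?z y)) (e, 0)) y"
    by (intro continuous_intros)
  moreover have "\<forall>\<^sub>F y in nhds y. node_deriv j y v = (\<Sum>e\<in>B. \<beta> e (start_deriv y v) *\<^sub>R frechet_derivative integrator (at (?z y)) (e, 0))"
    using assms(1)
  proof (rule eventually_mono)
    fix y' assume "regular y'"
    then have "?z y' \<in> D" using assms(2) by (auto simp: regular_def intro: shooting_node_D)
    from smooth_on_differentiable[OF smooth_integrator this]
    have "bounded_linear (\<lambda>u. frechet_derivative integrator (at (?z y')) (u, 0))"
      by (intro bounded_linear_compose[OF has_derivative_bounded_linear bounded_linear_Pair_0(1)])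
    from linear_fin_dim_expand[OF bounded_linear.linear[OF this] B(3), of "start_deriv y' v"]
    show "node_deriv j y' v = (\<Sum>e\<in>B. \<beta> e (start_deriv y' v) *\<^sub>R frechet_derivative integrator (at (?z y')) (e, 0))"
      unfolding node_deriv_def .
  qed
  ultimately show ?thesis by (rule isCont_eventually_eq)
qed

subsection \<open>The generating function\<close>

text \<open>Along trajectories \<open>D2 H\<close> is the velocity, so this function of the phase
  point serves both as the integrand of the exact generating function and as the summand of the
  discrete one.\<close>

definition lagrangian :: "'q cotangent \<Rightarrow> real" where
  "lagrangian z = blinfun_apply (snd z) (D2 H z) - H z"

lemma smooth_lagrangian: "smooth_on UNIV lagrangian"
  using system unfolding lagrangian_def[abs_def] forced_hamiltonian_system_def
  by (intro smooth_on_diff open_UNIV bounded_bilinear.smooth_on[OF bounded_bilinear_blinfun_apply]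
      smooth_on_bounded_linear[OF _ bounded_linear_snd] smooth_on_D2) auto

lemma smooth_lagrangian_F: "smooth_on V (\<lambda>z. lagrangian (F z))"
  by (rule smooth_on_compose[OF open_V open_UNIV smooth_F smooth_lagrangian]) simp

lemma shooting_H_eq:
  "shooting_H H n c w \<Phi> p0 (snd y) (fst y) = blinfun_apply (snd (node n y)) (fst (node n y))
    - (\<Sum>j=0..n. (snd y * w j) * lagrangian (node j y))"
  by (simp add: shooting_H_def Let_def shooting_node_eq lagrangian_def)

lemma continuous_on_segment:
  fixes f :: "'q cotangent \<times> real \<times> real \<Rightarrow> real"
  assumes "smooth_on V f" "(x, h) \<in> W"
  shows "continuous_on (closed_segment 0 h) (\<lambda>t. f (x, h, t))"
  by (rule continuous_on_compose2[OF smooth_on_imp_continuous_on[OF assms(1)]])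
    (use in_V[OF assms(2)] in \<open>auto intro!: continuous_intros\<close>)

text \<open>A trajectory has derivatives within the closed interval, whereas \<open>exact_H\<close>
  uses two-sided ones; they agree in the interior, which is all that the integral sees.\<close>

lemma open_segment_interior:
  fixes h :: real
  assumes "min 0 h < t" "t < max 0 h"
  shows "t \<in> closed_segment 0 h" "at t within closed_segment 0 h = at t"
proof -
  show "t \<in> closed_segment 0 h" using assms by (auto simp: closed_segment_eq_real_ivl)
  have "closed_segment 0 h = {min 0 h..max 0 h}" by (auto simp: closed_segment_eq_real_ivl)
  then show "at t within closed_segment 0 h = at t" using assms by (simp add: at_within_Icc_at)
qed

text \<open>One formula for all h, including the separate case h = 0 of the definition, with a fixed
  interval of integration and an integrand smooth in the parameters.\<close>

lemma exact_H_eq: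
  assumes y: "y \<in> W"
  shows "exact_H H \<phi> (snd y) (fst y) = blinfun_apply (snd (exact 1 y)) (fst (exact 1 y))
    - snd y * integral {0..1} (\<lambda>s. lagrangian (exact s y))"
proof (cases "snd y = 0")
  case True
  then have "y = (fst y, 0)" by (simp add: prod_eq_iff)
  then have "exact 1 y = fst y" by (metis exact_zero)
  then show ?thesis using True by (simp add: exact_H_def)
next
  case False
  obtain x h where xh: "y = (x, h)" by (cases y)
  have W: "(x, h) \<in> W" and h: "h \<noteq> 0" using y False xh by auto
  have bvp: "bvp_flow H \<phi> h t x = F (x, h, t)" if "t \<in> closed_segment 0 h" for t
    using F_eq[OF W that] by simp
  let ?q = "\<lambda>t. fst (bvp_flow H \<phi> h t x)" and ?p = "\<lambda>t. snd (bvp_flow H \<phi> h t x)"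
  have "(LBINT t=ereal 0..ereal h. blinfun_apply (?p t) (vector_derivative ?q (at t)) - H (?q t, ?p t))
      = (LBINT t=ereal 0..ereal h. lagrangian (F (x, h, t)))"
  proof (rule interval_integral_cong)
    fix t assume "t \<in> einterval (min (ereal 0) (ereal h)) (max (ereal 0) (ereal h))"
    then have t: "min 0 h < t" "t < max 0 h" by (auto simp: einterval_def min_def max_def split: if_splits)
    note seg = open_segment_interior[OF t]
    have "((\<lambda>t. F (x, h, t)) has_vector_derivative ham_field H \<phi> (F (x, h, t))) (at t)"
      using F_trajectory[OF W] seg unfolding bvp_trajectory_def trajectory_iff by metis
    \<comment> \<open>\<open>bvp_flow\<close> is known to equal \<open>F\<close> only for t in the
      segment, so the derivative is transferred on its interior.\<close>
    then have "((\<lambda>t. bvp_flow H \<phi> h t x) has_vector_derivative ham_field H \<phi> (F (x, h, t))) (at t)"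
      by (rule has_vector_derivative_transform_within_open[where S="{min 0 h<..<max 0 h}"])
        (use t bvp open_segment_interior(1) in auto)
    from bounded_linear.has_vector_derivative[OF bounded_linear_fst this]
    have "vector_derivative ?q (at t) = D2 H (F (x, h, t))"
      by (auto simp: ham_field_def intro: vector_derivative_at)
    then show "blinfun_apply (?p t) (vector_derivative ?q (at t)) - H (?q t, ?p t) = lagrangian (F (x, h, t))"
      by (simp add: bvp[OF seg(1)] lagrangian_def)
  qed
  also have "\<dots> = h * integral {0..1} (\<lambda>s. lagrangian (F (x, h, s * h)))"
    by (rule interval_integral_rescale[OF continuous_on_segment[OF smooth_lagrangian_F W]])
  finally show ?thesis
    using h bvp[OF ends_in_segment(2)] by (simp add: exact_H_def xh Let_def exact_def)
qed

lemma isCont_integral: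
  fixes f :: "'q cotangent \<times> real \<times> real \<Rightarrow> real"
  assumes "smooth_on V f" "y \<in> W"
  shows "isCont (\<lambda>y. integral {0..1} (\<lambda>s. f (fst y, snd y, s * snd y))) y"
proof -
  have "continuous_on W (\<lambda>y. integral (cbox 0 1) (\<lambda>s. f (fst y, snd y, s * snd y)))"
  proof (rule integral_continuous_on_param)
    show "continuous_on (W \<times> cbox 0 1) (\<lambda>(y, s). f (fst y, snd y, s * snd y))"
      unfolding case_prod_unfold
    proof (rule continuous_on_compose2[OF smooth_on_imp_continuous_on[OF assms(1)]])
      show "(\<lambda>z. (fst (fst z), snd (fst z), snd z * snd (fst z))) ` (W \<times> cbox 0 1) \<subseteq> V"
        by (rule image_subsetI, rule exact_in_V) (auto simp: mem_Times_iff)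
    qed (intro continuous_intros)
  qed
  then show ?thesis
    using assms(2) open_W continuous_on_eq_continuous_at by force
qed

lemma eventually_nhds_W: "y \<in> W \<Longrightarrow> \<forall>\<^sub>F y in nhds y. y \<in> W"
  by (rule eventually_nhds_in_open[OF open_W])

lemma isCont_exact_H: "y \<in> W \<Longrightarrow> isCont (\<lambda>(x, h). exact_H H \<phi> h x) y"
proof -
  assume y: "y \<in> W"
  have "isCont (\<lambda>y. blinfun_apply (snd (exact 1 y)) (fst (exact 1 y))
      - snd y * integral {0..1} (\<lambda>s. lagrangian (exact s y))) y"
    using isCont_integral[OF smooth_lagrangian_F y] unfolding exact_def[symmetric]
    by (intro continuous_intros isCont_exact y) auto
  moreover have "\<forall>\<^sub>F y in nhds y. (case y of (x, h) \<Rightarrow> exact_H H \<phi> h x) = blinfun_apply (snd (exact 1 y)) (fst (exact 1 y))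
      - snd y * integral {0..1} (\<lambda>s. lagrangian (exact s y))"
    using eventually_nhds_W[OF y] by (rule eventually_mono) (simp add: case_prod_unfold exact_H_eq)
  ultimately show ?thesis by (rule isCont_eventually_eq)
qed

lemma isCont_shooting_H: "y \<in> S \<Longrightarrow> isCont (\<lambda>(x, h). shooting_H H n c w \<Phi> p0 h x) y"
  unfolding case_prod_unfold shooting_H_eq
  by (intro continuous_intros isCont_node isCont_o2[OF _ smooth_on_isCont[OF smooth_lagrangian]]) auto

lemma node_tendsto: "j \<le> n \<Longrightarrow> (node j \<longlongrightarrow> x) (hfilter x)"
  by (rule hcong_tendsto[OF node_hcong exact_tendsto]) (use nodes in auto)

lemma H_hcong: "hcong (min a b + 1) x (\<lambda>(x, h). shooting_H H n c w \<Phi> p0 h x) (\<lambda>(x, h). exact_H H \<phi> h x)"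
proof -
  have node: "hcong (b + 1) x (node j) (exact (c j))" "(node j \<longlongrightarrow> x) (hfilter x)" "(exact (c j) \<longlongrightarrow> x) (hfilter x)"
    if "j \<in> {0..n}" for j
    using that nodes[of j] by (auto intro: node_hcong[of j x, simplified] node_tendsto exact_tendsto)
  have "hcong (b + 1) x (\<lambda>y. blinfun_apply (snd (node n y)) (fst (node n y)) - (\<Sum>j=0..n. (snd y * w j) * lagrangian (node j y)))
      (\<lambda>y. blinfun_apply (snd (exact (c n) y)) (fst (exact (c n) y)) - (\<Sum>j=0..n. (snd y * w j) * lagrangian (exact (c j) y)))"
  proof (intro hcong_diff hcong_sum)
    show "hcong (b + 1) x (\<lambda>y. blinfun_apply (snd (node n y)) (fst (node n y)))
        (\<lambda>y. blinfun_apply (snd (exact (c n) y)) (fst (exact (c n) y)))"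
      by (rule bounded_bilinear.hcong[OF bounded_bilinear_blinfun_apply hcong_bounded_linear[OF bounded_linear_snd node(1)]
            hcong_bounded_linear[OF bounded_linear_fst node(1)] tendsto_snd[OF node(2)] tendsto_fst[OF node(3)]]) auto
    fix j assume j: "j \<in> {0..n}"
    show "hcong (b + 1) x (\<lambda>y. (snd y * w j) * lagrangian (node j y)) (\<lambda>y. (snd y * w j) * lagrangian (exact (c j) y))"
      by (rule bounded_bilinear.hcong[OF bounded_bilinear_mult hcong_refl
            hcong_compose[OF open_UNIV smooth_lagrangian UNIV_I node(2,3,1)[OF j]]
            tendsto_mult[OF snd_tendsto_hfilter tendsto_const]
            isCont_tendsto_compose[OF smooth_on_isCont[OF smooth_lagrangian open_UNIV UNIV_I] node(3)[OF j]]])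
  qed
  then have "hcong (min a b + 1) x (\<lambda>y. blinfun_apply (snd (node n y)) (fst (node n y)) - (\<Sum>j=0..n. (snd y * w j) * lagrangian (node j y)))
      (\<lambda>y. blinfun_apply (snd (exact 1 y)) (fst (exact 1 y)) - (\<Sum>j=0..n. (snd y * w j) * lagrangian (exact (c j) y)))"
    \<comment> \<open>With c n = 1 the last exact node is the endpoint of the trajectory and yields
      the boundary term p(h) q(h).\<close>
    unfolding last_node by (rule hcong_mono) simp
  also have "hcong (min a b + 1) x \<dots>
      (\<lambda>y. blinfun_apply (snd (exact 1 y)) (fst (exact 1 y)) - snd y * integral {0..1} (\<lambda>s. lagrangian (exact s y)))"
    unfolding exact_def
    by (intro hcong_diff hcong_refl hcong_mono[OF quadrature_hcong[OF quadrature _ open_V smooth_lagrangian_F]])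
      (use nodes in_V[OF zero_W] in auto)
  finally show ?thesis
    by (rule hcong_cong)
      (simp add: case_prod_unfold shooting_H_eq, use eventually_W in \<open>eventually_elim, simp add: case_prod_unfold exact_H_eq\<close>)
qed

subsection \<open>The discrete force\<close>

text \<open>\<open>Blinfun\<close> describes the intended form once its argument is bounded linear;
  at regular points this holds because the nodes are differentiable in x. Horizontality puts
  \<open>\<phi>\<close> in place of \<open>base_force\<close>, to match the exact force.\<close>

lemma shooting_force_apply:
  assumes "regular y"
  shows "blinfun_apply (shooting_force \<phi> n c w \<Phi> p0 (snd y) (fst y)) v =
    (\<Sum>j=0..n. (snd y * w j) * blinfun_apply (\<phi> (node j y)) (node_deriv j y v))"
proof -
  have D: "((\<lambda>x. fst (node j (x, snd y))) has_derivative (\<lambda>v. fst (node_deriv j y v))) (at (fst y))"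
    if "j \<in> {0..n}" for j
    using that by (intro bounded_linear.has_derivative[OF bounded_linear_fst node_has_derivative[OF assms]]) auto
  define A where "A = (\<lambda>v. \<Sum>j=0..n. (snd y * w j) * blinfun_apply (base_force \<phi> (node j y)) (fst (node_deriv j y v)))"
  have "bounded_linear A"
    unfolding A_def using has_derivative_bounded_linear[OF D]
    by (intro bounded_linear_sum bounded_linear_const_mult bounded_linear_compose[OF blinfun.bounded_linear_right]) auto
  moreover have "shooting_force \<phi> n c w \<Phi> p0 (snd y) (fst y) = Blinfun A"
    unfolding shooting_force_def A_def
    by (intro arg_cong[where f=Blinfun] ext sum.cong refl)
      (simp add: frechet_derivative_at[OF D, symmetric] shooting_node_eq)
  moreover have "horizontal \<phi>" using system by (simp add: forced_hamiltonian_system_def)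
  ultimately show ?thesis
    by (simp add: bounded_linear_Blinfun_apply A_def horizontal_apply)
qed

text \<open>The integrand of the exact force in direction v, extended smoothly to \<open>V\<close>
  so that the quadrature estimate applies.\<close>

definition work :: "'q cotangent \<Rightarrow> 'q cotangent \<times> real \<times> real \<Rightarrow> real" where
  "work v z = blinfun_apply (\<phi> (F z)) (dir_deriv (v, 0, 0) F z)"

lemma smooth_\<phi>: "smooth_on UNIV \<phi>"
  using system by (simp add: forced_hamiltonian_system_def)

lemma smooth_work: "smooth_on V (work v)"
  unfolding work_def[abs_def]
  by (intro bounded_bilinear.smooth_on[OF bounded_bilinear_blinfun_apply] open_V smooth_on_dir_deriv smooth_F
      smooth_on_compose[OF open_V open_UNIV smooth_F smooth_\<phi>]) simp

lemma linear_work: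
  assumes "z \<in> V" shows "work (u + v) z = work u z + work v z" "work (r *\<^sub>R v) z = r * work v z"
proof -
  have lin: "linear (\<lambda>v. frechet_derivative F (at z) (v, 0))"
    by (rule bounded_linear.linear[OF bounded_linear_compose[OF has_derivative_bounded_linear[OF
            smooth_on_differentiable[OF smooth_F assms]] bounded_linear_Pair_0(1)]])
  show "work (u + v) z = work u z + work v z" "work (r *\<^sub>R v) z = r * work v z"
    using linear_add[OF lin] linear_scale[OF lin]
    by (simp_all add: work_def dir_deriv_def zero_prod_def blinfun.add_right blinfun.scaleR_right)
qed

text \<open>Linearity of the integrand in the direction passes to the integral, so
  \<open>Blinfun\<close> is applied to a genuine linear form. \<open>bvp_flow\<close> may be
  differentiated through \<open>F\<close>, since for fixed h the points x with (x, h) in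
  \<open>W\<close> form an open set.\<close>

lemma exact_force_apply:
  assumes y: "y \<in> W"
  shows "blinfun_apply (exact_force H \<phi> (snd y) (fst y)) v =
    snd y * integral {0..1} (\<lambda>s. work v (fst y, snd y, s * snd y))"
proof (cases "snd y = 0")
  case True then show ?thesis by (simp add: exact_force_def)
next
  case False
  obtain x h where xh: "y = (x, h)" by (cases y)
  have W: "(x, h) \<in> W" and h: "h \<noteq> 0" using y False xh by auto
  have eq: "blinfun_apply (\<phi> (bvp_flow H \<phi> h t x)) (frechet_derivative (bvp_flow H \<phi> h t) (at x) v) = work v (x, h, t)"
    if t: "t \<in> closed_segment 0 h" for t v
  proof -
    have "((\<lambda>x. F (x, h, t)) has_derivative (\<lambda>v. frechet_derivative F (at (x, h, t)) (v, 0, 0))) (at x)"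
      by (rule has_derivative_compose[where f="\<lambda>x. (x, h, t)"])
        (use smooth_on_differentiable[OF smooth_F in_V[OF W t]] in \<open>auto intro!: derivative_eq_intros simp: zero_prod_def\<close>)
    moreover have "open ((\<lambda>x. (x, h)) -` W)" by (intro open_vimage open_W continuous_intros)
    ultimately have "(bvp_flow H \<phi> h t has_derivative (\<lambda>v. frechet_derivative F (at (x, h, t)) (v, 0, 0))) (at x)"
      by (rule has_derivative_transform_within_open) (use W F_eq t in auto)
    from frechet_derivative_at[OF this, symmetric] show ?thesis
      by (simp add: work_def dir_deriv_def F_eq[OF W t])
  qed
  define A where "A v = (LBINT t=ereal 0..ereal h.
    blinfun_apply (\<phi> (bvp_flow H \<phi> h t x)) (frechet_derivative (bvp_flow H \<phi> h t) (at x) v))" for v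
  have A: "A v = h * integral {0..1} (\<lambda>s. work v (x, h, s * h))" for v
  proof -
    have "A v = (LBINT t=ereal 0..ereal h. work v (x, h, t))"
      unfolding A_def
    proof (rule interval_integral_cong)
      fix t assume "t \<in> einterval (min (ereal 0) (ereal h)) (max (ereal 0) (ereal h))"
      then have "min 0 h < t" "t < max 0 h" by (auto simp: einterval_def min_def max_def split: if_splits)
      from eq[OF open_segment_interior(1)[OF this]]
      show "blinfun_apply (\<phi> (bvp_flow H \<phi> h t x)) (frechet_derivative (bvp_flow H \<phi> h t) (at x) v) = work v (x, h, t)" .
    qed
    also have "\<dots> = h * integral {0..1} (\<lambda>s. work v (x, h, s * h))"
      by (rule interval_integral_rescale[OF continuous_on_segment[OF smooth_work W]])
    finally show ?thesis .
  qed
  have int: "(\<lambda>s. work v (x, h, s * h)) integrable_on {0..1}" for v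
    by (intro integrable_continuous_interval continuous_on_compose2[OF smooth_on_imp_continuous_on[OF smooth_work]])
      (use exact_in_V[OF y] xh in \<open>auto intro!: continuous_intros\<close>)
  have V: "(x, h, s * h) \<in> V" if "s \<in> {0..1}" for s using exact_in_V[OF y] xh that by auto
  have "linear A"
  proof (rule linearI)
    fix u v :: "'q cotangent" and r :: real
    have "integral {0..1} (\<lambda>s. work (u + v) (x, h, s * h)) = integral {0..1} (\<lambda>s. work u (x, h, s * h) + work v (x, h, s * h))"
      by (rule integral_cong) (rule linear_work(1)[OF V])
    also have "\<dots> = integral {0..1} (\<lambda>s. work u (x, h, s * h)) + integral {0..1} (\<lambda>s. work v (x, h, s * h))"
      by (rule integral_add[OF int int])
    finally show "A (u + v) = A u + A v" by (simp add: A distrib_left)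
    have "integral {0..1} (\<lambda>s. work (r *\<^sub>R v) (x, h, s * h)) = integral {0..1} (\<lambda>s. r * work v (x, h, s * h))"
      by (rule integral_cong) (rule linear_work(2)[OF V])
    then show "A (r *\<^sub>R v) = r *\<^sub>R A v" by (simp add: A)
  qed
  then have "blinfun_apply (Blinfun A) = A" by (intro bounded_linear_Blinfun_apply linear_fin_dim_bounded)
  moreover have "exact_force H \<phi> (snd y) (fst y) = Blinfun A"
    using h by (simp add: exact_force_def A_def[abs_def] xh)
  ultimately show ?thesis using A by (simp add: xh)
qed

lemma isCont_exact_force: "y \<in> W \<Longrightarrow> isCont (\<lambda>(x, h). exact_force H \<phi> h x) y"
proof (rule isCont_blinfunI)
  fix v assume y: "y \<in> W"
  have "isCont (\<lambda>y. snd y * integral {0..1} (\<lambda>s. work v (fst y, snd y, s * snd y))) y"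
    by (intro continuous_intros isCont_integral[OF smooth_work y])
  moreover have "\<forall>\<^sub>F y in nhds y. blinfun_apply (case y of (x, h) \<Rightarrow> exact_force H \<phi> h x) v =
      snd y * integral {0..1} (\<lambda>s. work v (fst y, snd y, s * snd y))"
    using eventually_nhds_W[OF y] by (rule eventually_mono) (simp add: case_prod_unfold exact_force_apply)
  ultimately show "isCont (\<lambda>y. blinfun_apply (case y of (x, h) \<Rightarrow> exact_force H \<phi> h x) v) y"
    by (rule isCont_eventually_eq)
qed

lemma isCont_shooting_force:
  assumes "\<forall>\<^sub>F y' in nhds y. regular y'" shows "isCont (\<lambda>(x, h). shooting_force \<phi> n c w \<Phi> p0 h x) y"
proof (rule isCont_blinfunI)
  fix v
  have "y \<in> S" using eventually_nhds_x_imp_x[OF assms] by (simp add: regular_def)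
  then have "isCont (\<lambda>y. \<Sum>j=0..n. (snd y * w j) * blinfun_apply (\<phi> (node j y)) (node_deriv j y v)) y"
    by (intro continuous_intros isCont_node_deriv[OF assms] isCont_o2[OF isCont_node smooth_on_isCont[OF smooth_\<phi>]]) auto
  moreover have "\<forall>\<^sub>F y in nhds y. blinfun_apply (case y of (x, h) \<Rightarrow> shooting_force \<phi> n c w \<Phi> p0 h x) v =
      (\<Sum>j=0..n. (snd y * w j) * blinfun_apply (\<phi> (node j y)) (node_deriv j y v))"
    using assms by (rule eventually_mono) (simp add: case_prod_unfold shooting_force_apply)
  ultimately show "isCont (\<lambda>y. blinfun_apply (case y of (x, h) \<Rightarrow> shooting_force \<phi> n c w \<Phi> p0 h x) v) y"
    by (rule isCont_eventually_eq)
qed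

lemma force_hcong:
  "hcong (min a b + 1) x (\<lambda>(x, h). shooting_force \<phi> n c w \<Phi> p0 h x) (\<lambda>(x, h). exact_force H \<phi> h x)"
proof (rule hcong_blinfunI)
  fix v
  let ?X = "\<lambda>j. dir_deriv (v, 0) (exact (c j))"
  have "hcong (b + 1) x (\<lambda>y. \<Sum>j=0..n. (snd y * w j) * blinfun_apply (\<phi> (node j y)) (node_deriv j y v))
      (\<lambda>y. \<Sum>j=0..n. (snd y * w j) * blinfun_apply (\<phi> (exact (c j) y)) (?X j y))"
  proof (rule hcong_sum)
    fix j assume "j \<in> {0..n}"
    then have j: "j \<le> n" and c: "0 \<le> c j" "c j \<le> 1" using nodes by auto
    have t: "((\<lambda>y. \<phi> (node j y)) \<longlongrightarrow> \<phi> x) (hfilter x)" "((\<lambda>y. \<phi> (exact (c j) y)) \<longlongrightarrow> \<phi> x) (hfilter x)"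
      by (rule isCont_tendsto_compose[OF smooth_on_isCont[OF smooth_\<phi> open_UNIV UNIV_I]], rule node_tendsto exact_tendsto, fact+)+
    have "hcong (b + 1) x (\<lambda>y. blinfun_apply (\<phi> (node j y)) (node_deriv j y v)) (\<lambda>y. blinfun_apply (\<phi> (exact (c j) y)) (?X j y))"
      by (rule bounded_bilinear.hcong[OF bounded_bilinear_blinfun_apply
            hcong_compose[OF open_UNIV smooth_\<phi> UNIV_I node_tendsto[OF j] exact_tendsto[OF c] node_hcong[OF j]]
            node_deriv_hcong[OF j] t(1) dir_deriv_exact_tendsto[OF c]])
    then show "hcong (b + 1) x (\<lambda>y. (snd y * w j) * blinfun_apply (\<phi> (node j y)) (node_deriv j y v))
        (\<lambda>y. (snd y * w j) * blinfun_apply (\<phi> (exact (c j) y)) (?X j y))"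
      by (rule bounded_bilinear.hcong[OF bounded_bilinear_mult hcong_refl _ tendsto_mult[OF snd_tendsto_hfilter tendsto_const]
            bounded_bilinear.tendsto[OF bounded_bilinear_blinfun_apply t(2) dir_deriv_exact_tendsto[OF c]]])
  qed
  then have "hcong (min a b + 1) x (\<lambda>y. \<Sum>j=0..n. (snd y * w j) * blinfun_apply (\<phi> (node j y)) (node_deriv j y v))
      (\<lambda>y. \<Sum>j=0..n. (snd y * w j) * blinfun_apply (\<phi> (exact (c j) y)) (?X j y))"
    by (rule hcong_mono) simp
  moreover have "\<forall>\<^sub>F y in hfilter x. (\<Sum>j=0..n. (snd y * w j) * blinfun_apply (\<phi> (node j y)) (node_deriv j y v))
      = blinfun_apply (case y of (x, h) \<Rightarrow> shooting_force \<phi> n c w \<Phi> p0 h x) v"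
    using eventually_regular_hfilter by (rule eventually_mono) (simp add: case_prod_unfold shooting_force_apply)
  moreover have "\<forall>\<^sub>F y in hfilter x. (\<Sum>j=0..n. (snd y * w j) * blinfun_apply (\<phi> (exact (c j) y)) (?X j y))
      = (\<Sum>j=0..n. (snd y * w j) * work v (fst y, snd y, c j * snd y))"
    using eventually_W
    by (rule eventually_mono) (intro sum.cong refl, simp add: dir_deriv_exact nodes work_def, simp add: exact_def)
  ultimately have "hcong (min a b + 1) x (\<lambda>y. blinfun_apply (case y of (x, h) \<Rightarrow> shooting_force \<phi> n c w \<Phi> p0 h x) v)
      (\<lambda>y. \<Sum>j=0..n. (snd y * w j) * work v (fst y, snd y, c j * snd y))"
    by (rule hcong_cong)
  also have "hcong (min a b + 1) x \<dots> (\<lambda>y. snd y * integral {0..1} (\<lambda>s. work v (fst y, snd y, s * snd y)))"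
    by (rule hcong_mono[OF quadrature_hcong[OF quadrature _ open_V smooth_work]])
      (use nodes in_V[OF zero_W] in auto)
  finally show "hcong (min a b + 1) x (\<lambda>y. blinfun_apply (case y of (x, h) \<Rightarrow> shooting_force \<phi> n c w \<Phi> p0 h x) v)
      (\<lambda>y. blinfun_apply (case y of (x, h) \<Rightarrow> exact_force H \<phi> h x) v)"
    by (rule hcong_cong)
      (simp, use eventually_W in \<open>eventually_elim, simp add: case_prod_unfold exact_force_apply\<close>)
qed

section \<open>Order of both discrete maps\<close>

lemma eventually_domain: "\<forall>\<^sub>F y in nhds (x, 0). y \<in> W \<inter> S"
  by (rule eventually_nhds_in_open) (auto intro: open_W open_S zero_W zero_S)

lemma shooting_order:
  "eq_upto_O S (\<lambda>(x, h). shooting_H H n c w \<Phi> p0 h x) W (\<lambda>(x, h). exact_H H \<phi> h x) (min a b + 1)"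
  "eq_upto_O S (\<lambda>(x, h). shooting_force \<phi> n c w \<Phi> p0 h x) W (\<lambda>(x, h). exact_force H \<phi> h x) (min a b + 1)"
proof -
  show "eq_upto_O S (\<lambda>(x, h). shooting_H H n c w \<Phi> p0 h x) W (\<lambda>(x, h). exact_H H \<phi> h x) (min a b + 1)"
  proof (rule eq_upto_O_I[OF eventually_domain _ _ H_hcong])
    show "\<forall>\<^sub>F y in nhds (x, 0). snd y \<noteq> 0 \<longrightarrow> isCont (\<lambda>(x, h). exact_H H \<phi> h x) y \<and> isCont (\<lambda>(x, h). shooting_H H n c w \<Phi> p0 h x) y" for x
      using eventually_domain by (rule eventually_mono) (blast intro: isCont_exact_H isCont_shooting_H)
    show "(case (x, 0) of (x, h) \<Rightarrow> shooting_H H n c w \<Phi> p0 h x) = (case (x, 0) of (x, h) \<Rightarrow> exact_H H \<phi> h x)" for x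
      \<comment> \<open>For h = 0 the sum vanishes because of its factor h, and the last node is
        \<open>integrator (x, 0)\<close>, which is x.\<close>
      using shooting_H_eq[of "(x, 0)"] by (simp add: exact_H_def node_def)
  qed simp
  show "eq_upto_O S (\<lambda>(x, h). shooting_force \<phi> n c w \<Phi> p0 h x) W (\<lambda>(x, h). exact_force H \<phi> h x) (min a b + 1)"
  proof (rule eq_upto_O_I[OF eventually_domain _ _ force_hcong])
    \<comment> \<open>Continuity of the discrete force at y uses regularity at all points near y,
      hence the nested neighborhoods.\<close>
    have "\<forall>\<^sub>F y in nhds (x, 0). \<forall>\<^sub>F y' in nhds y. regular y'" for x
      using eventually_regular by (simp add: eventually_eventually)
    from eventually_conj[OF eventually_domain this]
    show "\<forall>\<^sub>F y in nhds (x, 0). snd y \<noteq> 0 \<longrightarrow> isCont (\<lambda>(x, h). exact_force H \<phi> h x) y \<and> isCont (\<lambda>(x, h). shooting_force \<phi> n c w \<Phi> p0 h x) y" for x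
      by (rule eventually_mono) (blast intro: isCont_exact_force isCont_shooting_force)
    show "(case (x, 0) of (x, h) \<Rightarrow> shooting_force \<phi> n c w \<Phi> p0 h x) = (case (x, 0) of (x, h) \<Rightarrow> exact_force H \<phi> h x)" for x
      by (simp add: exact_force_def shooting_force_def zero_blinfun_def)
  qed simp
qed

end

theorem proposition7p1:
  fixes H :: "'q::euclidean_space cotangent \<Rightarrow> real"
    and \<phi> :: "'q cotangent \<Rightarrow> ('q cotangent \<Rightarrow>\<^sub>L real)"
    and \<Phi> :: "real \<Rightarrow> 'q cotangent \<Rightarrow> 'q cotangent"
    and p0 :: "real \<Rightarrow> 'q cotangent \<Rightarrow> ('q \<Rightarrow>\<^sub>L real)"
    and W D S :: "('q cotangent \<times> real) set"
    and c w :: "nat \<Rightarrow> real"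
    and n a b :: nat
  assumes system: "forced_hamiltonian_system H \<phi>"
    and well_posed: "bvp_well_posed H \<phi> W"
    and nodes: "\<forall>j\<le>n. 0 \<le> c j \<and> c j \<le> 1"
    and last_node: "c n = 1"
    and quadrature: "quadrature_order n c w a"
    and integrator_domain: "open D" "UNIV \<times> {0} \<subseteq> D"
    and integrator_smooth: "smooth_on D (\<lambda>(z, h). \<Phi> h z)"
    and integrator_order:
      "eq_upto_O D (\<lambda>(z, h). \<Phi> h z) (ivp_domain H \<phi>) (\<lambda>(z, h). ivp_flow H \<phi> h z) (b + 1)"
    and shooting: "shooting_momentum n c D \<Phi> S p0"
  shows "eq_upto_O S (\<lambda>(x, h). shooting_H H n c w \<Phi> p0 h x)
           W (\<lambda>(x, h). exact_H H \<phi> h x) (min a b + 1)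
       \<and> eq_upto_O S (\<lambda>(x, h). shooting_force \<phi> n c w \<Phi> p0 h x)
           W (\<lambda>(x, h). exact_force H \<phi> h x) (min a b + 1)"
proof -
  obtain V F where V: "open V" "smooth_on V F"
    "\<forall>(x, h)\<in>W. \<forall>t\<in>closed_segment 0 h. (x, h, t) \<in> V \<and> F (x, h, t) = bvp_flow H \<phi> h t x"
    using well_posed unfolding bvp_well_posed_def by blast
  have W: "open W" "UNIV \<times> {0} \<subseteq> W"
    and bvp: "\<forall>(x, h)\<in>W. (\<exists>\<gamma>. bvp_trajectory H \<phi> h x \<gamma>) \<and>
        (\<forall>\<gamma> \<gamma>'. bvp_trajectory H \<phi> h x \<gamma> \<longrightarrow> bvp_trajectory H \<phi> h x \<gamma>' \<longrightarrow>
           (\<forall>t\<in>closed_segment 0 h. \<gamma> t = \<gamma>' t))"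
    using well_posed unfolding bvp_well_posed_def by blast+
  interpret shooting_scheme H \<phi> \<Phi> p0 W D S c w n a b V F
  proof
    show "\<exists>\<gamma>. bvp_trajectory H \<phi> h x \<gamma>" if "(x, h) \<in> W" for x h using bspec[OF bvp that] by simp
    show "\<gamma> t = \<gamma>' t" if "(x, h) \<in> W" "bvp_trajectory H \<phi> h x \<gamma>" "bvp_trajectory H \<phi> h x \<gamma>'" "t \<in> closed_segment 0 h"
      for x h \<gamma> \<gamma>' t using bspec[OF bvp that(1)] that by simp
    show "(x, h, t) \<in> V" "F (x, h, t) = bvp_flow H \<phi> h t x" if "(x, h) \<in> W" "t \<in> closed_segment 0 h" for x h t
      using bspec[OF V(3) that(1)] that(2) by auto
    show "(x, 0) \<in> W" "(x, 0) \<in> D" for x using W(2) integrator_domain(2) by auto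
    show "0 \<le> c j \<and> c j \<le> 1" if "j \<le> n" for j using nodes that by blast
  qed fact+
  show ?thesis using shooting_order by blast
qed

end
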